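(* Let $F\subset\mathrm{Sym}^2(\mathbb R^n)$ be an ST-invariant cone subequation with finite Riesz characteristic $p$, and suppose $u$ is $F$-subharmonic on an open set $X\subset\mathbb R^n$. Then the density $\Theta^M(u,x)$ and, when $F$ is convex, also the densities $\Theta^S(u,x)$ and $\Theta^V(u,x)$, are upper semi-continuous functions of $x\in X$. Equivalently, for all $c\ge0$ and each such density $\Theta$, the set $E_c=\{x\in X:\Theta(u,x)\ge c\}$ is closed in $X$.
   Context: Fix $n\ge 2$; $B=\{|x|\le1\}\subset\mathbb R^n$, $S=\partial B$. $\mathrm{Sym}^2(\mathbb R^n)$ is the space of real symmetric $n\times n$ matrices and $\mathcal P=\{A: A\ge 0\}$. A subequation is a nonempty proper closed subset $F\subset \mathrm{Sym}^2(\mathbb R^n)$ with $F+\mathcal P\subset F$. It is a cone if $tF\subset F$ for all $t\ge 0$. It is ST-invariant if there is a subgroup $G\subset O(n)$ acting transitively on $S^{n-1}$ such that $F$ is invariant under $A\mapsto gAg^t$ for all $g\in G$. For a unit vector $e$, $P_e$ and $P_{e^\perp}=I-P_e$ are the orthogonal projections onto $\mathbb R e$ and $e^\perp$. The Riesz characteristic is $p_F=\sup\{\bar p: P_{e^\perp}-(\bar p-1)P_e\in F\}\in[1,\infty]$ (independent of $e$). The Riesz kernel $K=K_p$ is $K_p(t)=t^{2-p}$ if $1\le p<2$, $K_2(t)=\log t$, $K_p(t)=-t^{2-p}$ if $2<p<\infty$. An upper semi-continuous $u:X\to[-\infty,\infty)$ on an open set $X$, not identically $-\infty$ on any connected component of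 $X$, is $F$-subharmonic if whenever $\varphi$ is $C^2$ near $x_0\in X$ with $u\le\varphi$ near $x_0$ and equality at $x_0$, one has $D^2\varphi(x_0)\in F$. Averages at $x\in X$: $M(u,x,r)=\sup_{|y|\le r}u(x+y)$, $S(u,x,r)=\frac1{|S|}\int_S u(x+r\sigma)\,d\sigma$, $V(u,x,r)=\frac1{|B|}\int_B u(x+ry)\,dy$. Densities: $\Theta^\Psi(u,x)=\lim_{0<s<r\downarrow0}\frac{\Psi(u,x,r)-\Psi(u,x,s)}{K(r)-K(s)}$ for $\Psi=M$, and for $\Psi=S,V$ when $F$ is convex (decreasing limits which exist in $[0,\infty)$). *)

theory Defs
  imports "HOL-Analysis.Analysis"
begin

subsection \<open>Subequations\<close>

definition Sym2 :: "(real^'n^'n) set" where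
  "Sym2 = {A. transpose A = A}"

definition PSD :: "(real^'n^'n) set" where
  "PSD = {A \<in> Sym2. \<forall>x. 0 \<le> x \<bullet> (A *v x)}"

text \<open>\<^const>\<open>Sym2\<close> is closed in the space of all matrices, so closedness in the ambient
  space is the same as closedness in \<^const>\<open>Sym2\<close>.\<close>

definition subequation :: "(real^'n^'n) set \<Rightarrow> bool" where
  "subequation F \<longleftrightarrow> F \<noteq> {} \<and> F \<subset> Sym2 \<and> closed F \<and> (\<forall>A\<in>F. \<forall>P\<in>PSD. A + P \<in> F)"

definition orthogonal_subgroup :: "(real^'n^'n) set \<Rightarrow> bool" where
  "orthogonal_subgroup G \<longleftrightarrow> (\<forall>g\<in>G. orthogonal_matrix g) \<and> mat 1 \<in> G \<and>
     (\<forall>g\<in>G. \<forall>h\<in>G. g ** h \<in> G) \<and> (\<forall>g\<in>G. matrix_inv g \<in> G)"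

definition ST_invariant :: "(real^'n^'n) set \<Rightarrow> bool" where
  "ST_invariant F \<longleftrightarrow> (\<exists>G. orthogonal_subgroup G \<and>
     (\<forall>x\<in>sphere 0 1. \<forall>y\<in>sphere 0 1. \<exists>g\<in>G. g *v x = y) \<and>
     (\<forall>g\<in>G. \<forall>A\<in>F. g ** A ** transpose g \<in> F))"

text \<open>For a unit vector \<open>e\<close> this is the matrix of the orthogonal projection onto the line
  spanned by \<open>e\<close>.\<close>

definition proj_line :: "real^'n \<Rightarrow> real^'n^'n" where
  "proj_line e = (\<chi> i j. e $ i * e $ j)"

definition proj_perp :: "real^'n \<Rightarrow> real^'n^'n" where
  "proj_perp e = mat 1 - proj_line e"

text \<open>Meant for a unit vector \<open>e\<close>; for ST-invariant \<open>F\<close> the value does not depend on \<open>e\<close>.\<close>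

definition riesz_characteristic :: "(real^'n^'n) set \<Rightarrow> real^'n \<Rightarrow> ereal" where
  "riesz_characteristic F e =
     Sup {ereal q | q. proj_perp e - (q - 1) *\<^sub>R proj_line e \<in> F}"

definition riesz_kernel :: "real \<Rightarrow> real \<Rightarrow> real" where
  "riesz_kernel p t =
     (if p < 2 then t powr (2 - p) else if p = 2 then ln t else - (t powr (2 - p)))"


subsection \<open>Subharmonic functions\<close>

definition usc_on :: "'a::topological_space set \<Rightarrow> ('a \<Rightarrow> ereal) \<Rightarrow> bool" where
  "usc_on X f \<longleftrightarrow> (\<forall>x\<in>X. \<forall>c. f x < c \<longrightarrow> (\<forall>\<^sub>F y in at x within X. f y < c))"

text \<open>\<open>\<phi>\<close> is of class \<open>C\<^sup>2\<close> on the open set \<open>U\<close>, with gradient \<open>g\<close> and second derivative \<open>H\<close>.\<close>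

definition C2_with :: "(real^'n) set \<Rightarrow> (real^'n \<Rightarrow> real) \<Rightarrow> (real^'n \<Rightarrow> real^'n)
    \<Rightarrow> (real^'n \<Rightarrow> real^'n^'n) \<Rightarrow> bool" where
  "C2_with U \<phi> g H \<longleftrightarrow> (\<forall>x\<in>U. GDERIV \<phi> x :> g x) \<and>
     (\<forall>x\<in>U. (g has_derivative (\<lambda>h. H x *v h)) (at x)) \<and> continuous_on U H"

text \<open>Only the values of \<open>u\<close> on \<open>X\<close> matter.\<close>

definition F_subharmonic ::
    "(real^'n^'n) set \<Rightarrow> (real^'n) set \<Rightarrow> (real^'n \<Rightarrow> ereal) \<Rightarrow> bool" where
  "F_subharmonic F X u \<longleftrightarrow>
     (\<forall>x\<in>X. u x < \<infinity>) \<and> usc_on X u \<and>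
     (\<forall>C\<in>components X. \<exists>x\<in>C. u x \<noteq> -\<infinity>) \<and>
     (\<forall>x0\<in>X. \<forall>U \<phi> g H. open U \<and> x0 \<in> U \<and> U \<subseteq> X \<and> C2_with U \<phi> g H \<and>
        (\<forall>x\<in>U. u x \<le> ereal (\<phi> x)) \<and> u x0 = ereal (\<phi> x0) \<longrightarrow> H x0 \<in> F)"


subsection \<open>Averages and densities\<close>

text \<open>Surface measure on the unit sphere, obtained from polar coordinates:
  the measure of \<open>E\<close> is \<open>n\<close> times the Lebesgue measure of
  \<open>{t \<theta>. 0 < t \<le> 1, \<theta> \<in> E}\<close>.\<close>

definition surface_measure :: "(real^'n) measure" where
  "surface_measure =
     distr (scale_measure (of_nat CARD('n)) (restrict_space lborel (cball 0 1 - {0})))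
       (restrict_space borel (sphere 0 1)) (\<lambda>x. x /\<^sub>R norm x)"

text \<open>Integral of an extended-real function whose positive part has finite integral;
  the value may be \<open>-\<infinity>\<close>.\<close>

definition ext_integral :: "'a measure \<Rightarrow> ('a \<Rightarrow> ereal) \<Rightarrow> ereal" where
  "ext_integral \<mu> f =
     enn2ereal (\<integral>\<^sup>+x. e2ennreal (f x) \<partial>\<mu>) - enn2ereal (\<integral>\<^sup>+x. e2ennreal (- f x) \<partial>\<mu>)"

definition max_avg :: "(real^'n \<Rightarrow> ereal) \<Rightarrow> real^'n \<Rightarrow> real \<Rightarrow> ereal" where
  "max_avg u x r = (SUP y\<in>cball 0 r. u (x + y))"

definition sphere_avg :: "(real^'n \<Rightarrow> ereal) \<Rightarrow> real^'n \<Rightarrow> real \<Rightarrow> ereal" where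
  "sphere_avg u x r =
     ext_integral surface_measure (\<lambda>\<sigma>. u (x + r *\<^sub>R \<sigma>))
       / ereal (measure (surface_measure :: (real^'n) measure) (sphere 0 1))"

definition vol_avg :: "(real^'n \<Rightarrow> ereal) \<Rightarrow> real^'n \<Rightarrow> real \<Rightarrow> ereal" where
  "vol_avg u x r =
     ext_integral (restrict_space lborel (cball 0 1)) (\<lambda>y. u (x + r *\<^sub>R y))
       / ereal (measure lborel (cball 0 1 :: (real^'n) set))"

text \<open>The joint limit as \<open>s\<close> and \<open>r\<close> tend to \<open>0\<close> subject to \<open>0 < s < r\<close>.\<close>

definition avg_density :: "(real \<Rightarrow> real) \<Rightarrow>
    ((real^'n \<Rightarrow> ereal) \<Rightarrow> real^'n \<Rightarrow> real \<Rightarrow> ereal) \<Rightarrow> (real^'n \<Rightarrow> ereal) \<Rightarrow> real^'n \<Rightarrow> ereal" where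
  "avg_density K \<Psi> u x =
     Lim (at (0, 0) within {(s, r). 0 < s \<and> s < r})
       (\<lambda>(s, r). (\<Psi> u x r - \<Psi> u x s) / ereal (K r - K s))"

end

theory Submission
  imports Defs "HOL-Library.Function_Algebras" "HOL-Complex_Analysis.Great_Picard"
begin

text \<open>
  Write \<open>K\<close> for the Riesz kernel with characteristic \<open>p\<close>. The radial functions \<open>a + b K(|y|)\<close> with
  \<open>b > 0\<close> are borderline for \<open>F\<close>: their Hessians are positive multiples of
  \<open>P\<^sub>\<bottom> - (p - 1) P\<^sub>e\<close> (projections orthogonal to and along the radial direction \<open>e\<close>), and
  subtracting a small multiple of \<open>|y|\<^sup>2\<close> moves the Hessian out of \<open>F\<close>. Comparing \<open>u\<close> with these functions on
  annuli (\<open>radial_comparison\<close>) gives a three circles theorem: \<open>M(u,x,r)\<close> is increasing in \<open>r\<close> and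
  convex as a function of \<open>K(r)\<close>. For an average \<open>\<Psi>\<close> with this property the difference quotients
  \<open>(\<Psi>(r) - \<Psi>(s)) / (K(r) - K(s))\<close> increase in \<open>s\<close> and in \<open>r\<close>, so the density is their infimum
  (\<open>avg_density_eq\<close>). If each quotient with small radii depends upper semicontinuously on \<open>x\<close>,
  then so does the infimum.

  For the maxima, balls with nearby centres are nested after a small change of the radius, and convexity
  makes \<open>M(u,x,r)\<close> continuous in \<open>r\<close>; hence the quotients are upper semicontinuous.

  For the other two averages \<open>F\<close> is convex, and the main point is that spherical and volume averages are
  again convex in \<open>K\<close>. Averaging \<open>u\<close> over the transitive group \<open>G\<close> should produce a radial subsolution
  with the same averages, to which the result on maxima applies. No Haar measure is used
  (\<open>radial_average\<close>): among the equicontinuous subsolutions which have the same averages as \<open>u\<close> for all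
  rotation invariant measures, choose one of least \<open>L\<^sup>2\<close> norm. Its midpoint with a copy rotated by an
  element of \<open>G\<close> is again admissible, so by strict convexity of the norm the two agree, and transitivity
  of \<open>G\<close> makes the minimiser radial. That midpoints of continuous subsolutions are subsolutions is
  \<open>midpoint_subsolution\<close>: \<open>F\<close> is an intersection of half spaces \<open>B \<bullet> A \<ge> 0\<close>, and for the degenerate elliptic
  operator \<open>\<phi> \<mapsto> B \<bullet> D\<^sup>2\<phi>\<close> the Dirichlet problem on a ball with polynomial boundary values has a polynomial
  solution by linear algebra. Adding and subtracting such a solution splits the claim into one comparison for
  each of the two functions. A general \<open>u\<close> is the decreasing limit of \<open>M(u,\<cdot>,\<delta>)\<close> as \<open>\<delta> \<rightarrow> 0\<close>, and these
  functions are continuous subsolutions (\<open>max_regularization\<close>).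

  For convex \<open>F\<close>, \<open>u\<close> is finite on a dense set and lies below its averages, so it is locally
  integrable; hence \<open>V(u,x,r)\<close> is continuous in \<open>x\<close> and its density is upper semicontinuous. Since \<open>V\<close> is
  an average of \<open>S\<close> over smaller radii, the density of \<open>V\<close> is that of \<open>S\<close> times the mean of
  \<open>|y|\<^bsup>2-p\<^esup>\<close> over the unit ball; if that mean is infinite, the density of \<open>S\<close> vanishes.
\<close>

section \<open>Semicontinuity and viscosity subsolutions\<close>

text \<open>Besides \<open>F\<close>-subharmonic functions this admits functions that are \<open>-\<infinity>\<close> on whole components, and no
  nondegeneracy has to be carried along when \<open>X\<close> shrinks.\<close>

definition subsolution :: "(real^'n^'n) set \<Rightarrow> (real^'n) set \<Rightarrow> (real^'n \<Rightarrow> ereal) \<Rightarrow> bool" where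
  "subsolution F X u \<longleftrightarrow>
     (\<forall>x\<in>X. u x < \<infinity>) \<and> usc_on X u \<and>
     (\<forall>x0\<in>X. \<forall>U \<phi> g H. open U \<and> x0 \<in> U \<and> U \<subseteq> X \<and> C2_with U \<phi> g H \<and>
        (\<forall>x\<in>U. u x \<le> ereal (\<phi> x)) \<and> u x0 = ereal (\<phi> x0) \<longrightarrow> H x0 \<in> F)"

lemma F_subharmonic_imp_subsolution: "F_subharmonic F X u \<Longrightarrow> subsolution F X u"
  unfolding F_subharmonic_def subsolution_def by auto

lemma subsolutionD:
  assumes "subsolution F X u" "x0 \<in> X" "open U" "x0 \<in> U" "U \<subseteq> X" "C2_with U \<phi> g H"
    "\<And>x. x \<in> U \<Longrightarrow> u x \<le> ereal (\<phi> x)" "u x0 = ereal (\<phi> x0)"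
  shows "H x0 \<in> F"
  using assms unfolding subsolution_def by blast

lemma subsolution_less_top: "subsolution F X u \<Longrightarrow> x \<in> X \<Longrightarrow> u x < \<infinity>"
  unfolding subsolution_def by auto

lemma subsolution_usc: "subsolution F X u \<Longrightarrow> usc_on X u"
  unfolding subsolution_def by auto

lemma usc_on_subset: "usc_on X f \<Longrightarrow> Y \<subseteq> X \<Longrightarrow> usc_on Y f"
  unfolding usc_on_def by (meson filter_leD at_le subsetD)

lemma usc_on_open_nhd:
  assumes "usc_on X f" "x \<in> X" "f x < c"
  obtains T where "open T" "x \<in> T" "\<And>y. y \<in> T \<inter> X \<Longrightarrow> f y < c"
proof -
  have "\<forall>\<^sub>F y in at x within X. f y < c" using assms unfolding usc_on_def by blast
  then obtain T where "open T" "x \<in> T" "\<forall>y\<in>T. y \<noteq> x \<longrightarrow> y \<in> X \<longrightarrow> f y < c"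
    unfolding eventually_at_topological by blast
  then have "f y < c" if "y \<in> T \<inter> X" for y
    using assms(3) that by (cases "y = x") simp_all
  with \<open>open T\<close> \<open>x \<in> T\<close> show thesis by (rule that)
qed

lemma usc_onI:
  assumes "\<And>x c. x \<in> X \<Longrightarrow> f x < c \<Longrightarrow> \<exists>T. open T \<and> x \<in> T \<and> (\<forall>y\<in>T \<inter> X. f y < c)"
  shows "usc_on X f"
  unfolding usc_on_def eventually_at_topological
proof (intro ballI allI impI)
  fix x c assume "x \<in> X" "f x < c"
  from assms[OF this] obtain T where "open T" "x \<in> T" "\<forall>y\<in>T \<inter> X. f y < c" by blast
  then show "\<exists>S. open S \<and> x \<in> S \<and> (\<forall>y\<in>S. y \<noteq> x \<longrightarrow> y \<in> X \<longrightarrow> f y < c)"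
    by (intro exI[of _ T]) simp
qed

lemma usc_on_open_sublevel:
  assumes usc: "usc_on X f" and X: "open X"
  shows "open {x \<in> X. f x < c}"
  unfolding open_subopen[of "{x \<in> X. f x < c}"]
proof
  fix x assume x: "x \<in> {x \<in> X. f x < c}"
  then obtain T where T: "open T" "x \<in> T" "\<And>y. y \<in> T \<inter> X \<Longrightarrow> f y < c"
    using usc_on_open_nhd[OF usc, of x c] by blast
  then show "\<exists>T. open T \<and> x \<in> T \<and> T \<subseteq> {x \<in> X. f x < c}"
    using X x by (intro exI[of _ "T \<inter> X"]) auto
qed

lemma usc_on_attains_max:
  fixes f :: "'a::topological_space \<Rightarrow> ereal"
  assumes usc: "usc_on C f" and C: "compact C" "C \<noteq> {}"
  obtains x where "x \<in> C" "\<And>y. y \<in> C \<Longrightarrow> f y \<le> f x"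
proof (rule ccontr)
  assume "\<not> thesis"
  then have "\<forall>x\<in>C. \<exists>y\<in>C. f x < f y" using that by (meson not_le)
  then obtain y where y: "\<And>x. x \<in> C \<Longrightarrow> y x \<in> C \<and> f x < f (y x)" by metis
  have "\<forall>x\<in>C. \<exists>T. open T \<and> x \<in> T \<and> (\<forall>z\<in>T \<inter> C. f z < f (y x))"
    using usc_on_open_nhd[OF usc] y by metis
  then obtain T where T: "\<And>x. x \<in> C \<Longrightarrow> open (T x) \<and> x \<in> T x \<and> (\<forall>z\<in>T x \<inter> C. f z < f (y x))"
    by metis
  obtain C' where C': "C' \<subseteq> C" "finite C'" "C \<subseteq> (\<Union>x\<in>C'. T x)"
    using compactE_image[OF C(1), of C T] T by blast
  then have ne: "C' \<noteq> {}" using C(2) by auto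
  have "Max ((\<lambda>x. f (y x)) ` C') \<in> (\<lambda>x. f (y x)) ` C'" using C'(2) ne by simp
  then obtain m where "m \<in> C'" and fm: "Max ((\<lambda>x. f (y x)) ` C') = f (y m)" by blast
  have m: "m \<in> C'" "\<And>x. x \<in> C' \<Longrightarrow> f (y x) \<le> f (y m)"
    using \<open>m \<in> C'\<close> C'(2) by (auto simp: fm[symmetric])
  obtain x' where "x' \<in> C'" "y m \<in> T x'" using y C' m(1) by blast
  then have "f (y m) < f (y x')" using T y C' m(1) by blast
  with m(2)[OF \<open>x' \<in> C'\<close>] show False by simp
qed

lemma usc_on_diff_continuous:
  fixes u :: "'a::topological_space \<Rightarrow> ereal"
  assumes "usc_on C u" "continuous_on C \<phi>" "\<And>x. x \<in> C \<Longrightarrow> u x < \<infinity>"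
  shows "usc_on C (\<lambda>x. u x - ereal (\<phi> x))"
proof (rule usc_onI)
  fix x c assume x: "x \<in> C" and c: "u x - ereal (\<phi> x) < c"
  obtain c1 where c1: "u x < ereal c1" "ereal (c1 - \<phi> x) < c"
  proof -
    obtain d where d: "u x - ereal (\<phi> x) < ereal d" "ereal d < c"
      using c ereal_dense2 by blast
    have "u x < ereal (d + \<phi> x)" using d(1) by (cases "u x") auto
    with d(2) that[of "d + \<phi> x"] show thesis by auto
  qed
  obtain e where e: "e > 0" "ereal (c1 - \<phi> x + e) < c"
  proof (cases c)
    case (real r)
    then show ?thesis using c1(2) that[of "(r - (c1 - \<phi> x))/2"] by (auto simp: field_simps)
  qed (use c1(2) that[of 1] in auto)
  obtain T where T: "open T" "x \<in> T" "\<And>y. y \<in> T \<inter> C \<Longrightarrow> u y < ereal c1"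
    using usc_on_open_nhd[OF assms(1) x c1(1)] by blast
  obtain T' where T': "open T'" "x \<in> T'" "\<And>y. y \<in> T' \<inter> C \<Longrightarrow> \<bar>\<phi> y - \<phi> x\<bar> < e"
  proof -
    have "\<exists>T'. open T' \<and> x \<in> T' \<and> (\<forall>y\<in>T' \<inter> C. \<phi> y \<in> ball (\<phi> x) e)"
      using assms(2) x e(1) unfolding continuous_on_topological
      by (metis Int_iff centre_in_ball open_ball)
    then show thesis using that by (auto simp: dist_real_def abs_minus_commute)
  qed
  have "u y - ereal (\<phi> y) < c" if y: "y \<in> (T \<inter> T') \<inter> C" for y
  proof -
    have "u y < ereal c1" "\<bar>\<phi> y - \<phi> x\<bar> < e" using T T' y by auto
    then have "u y - ereal (\<phi> y) \<le> ereal (c1 - \<phi> x + e)" by (cases "u y") auto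
    with e(2) show ?thesis by order
  qed
  then show "\<exists>T. open T \<and> x \<in> T \<and> (\<forall>y\<in>T \<inter> C. u y - ereal (\<phi> y) < c)"
    using T T' by (intro exI[of _ "T \<inter> T'"]) auto
qed

lemma C2_with_subset: "C2_with U \<phi> g H \<Longrightarrow> V \<subseteq> U \<Longrightarrow> C2_with V \<phi> g H"
  unfolding C2_with_def by (auto intro: continuous_on_subset)

lemma C2_with_continuous_on: "C2_with U \<phi> g H \<Longrightarrow> continuous_on U \<phi>"
  unfolding C2_with_def gderiv_def
  by (meson continuous_at_imp_continuous_on has_derivative_continuous)

lemma C2_with_add:
  assumes "C2_with U \<phi> g H" "C2_with U \<psi> g' H'"
  shows "C2_with U (\<lambda>x. \<phi> x + \<psi> x) (\<lambda>x. g x + g' x) (\<lambda>x. H x + H' x)"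
  unfolding C2_with_def
proof (intro conjI ballI)
  fix x assume x: "x \<in> U"
  have eq: "(\<lambda>h. (H x + H' x) *v h) = (\<lambda>h. H x *v h + H' x *v h)"
    by (simp add: fun_eq_iff matrix_vector_mult_add_rdistrib)
  have d: "(g has_derivative (*v) (H x)) (at x)" "(g' has_derivative (*v) (H' x)) (at x)"
    "(\<phi> has_derivative (\<lambda>h. h \<bullet> g x)) (at x)" "(\<psi> has_derivative (\<lambda>h. h \<bullet> g' x)) (at x)"
    using assms x unfolding C2_with_def gderiv_def by simp_all
  show "((\<lambda>x. g x + g' x) has_derivative (\<lambda>h. (H x + H' x) *v h)) (at x)"
    unfolding eq by (rule has_derivative_add[OF d(1,2)])
  show "GDERIV (\<lambda>x. \<phi> x + \<psi> x) x :> g x + g' x"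
    unfolding gderiv_def inner_right_distrib by (rule has_derivative_add[OF d(3,4)])
next
  show "continuous_on U (\<lambda>x. H x + H' x)"
    using assms unfolding C2_with_def by (auto intro: continuous_on_add)
qed

lemma C2_with_cmult:
  assumes "C2_with U \<phi> g H"
  shows "C2_with U (\<lambda>x. c * \<phi> x) (\<lambda>x. c *\<^sub>R g x) (\<lambda>x. c *\<^sub>R H x)"
proof -
  have "GDERIV (\<lambda>x. c * \<phi> x) x :> c *\<^sub>R g x" if "x \<in> U" for x
  proof -
    have "(\<phi> has_derivative (\<lambda>h. h \<bullet> g x)) (at x)"
      using assms that unfolding C2_with_def gderiv_def by auto
    from has_derivative_mult_right[OF this, of c] show ?thesis
      unfolding gderiv_def by simp
  qed
  moreover have "((\<lambda>x. c *\<^sub>R g x) has_derivative (\<lambda>h. (c *\<^sub>R H x) *v h)) (at x)" if "x \<in> U" for x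
  proof -
    have "(g has_derivative (\<lambda>h. H x *v h)) (at x)"
      using assms that unfolding C2_with_def by auto
    from has_derivative_scaleR_right[OF this, of c] show ?thesis
      by (simp add: scaleR_matrix_vector_assoc)
  qed
  ultimately show ?thesis
    using assms unfolding C2_with_def by (auto intro!: continuous_intros)
qed

lemma C2_with_const: "C2_with U (\<lambda>x. c) (\<lambda>x. 0) (\<lambda>x. 0 :: real^'n^'n)"
proof -
  have "(*v) (0 :: real^'n^'n) = (\<lambda>h. 0)" by auto
  then show ?thesis unfolding C2_with_def gderiv_def by (auto intro!: continuous_intros)
qed

text \<open>Where \<open>u - \<phi>\<close> has a positive interior maximum, a vertical translate of \<open>\<phi>\<close> touches \<open>u\<close> from above,
  which forces the Hessian of \<open>\<phi>\<close> into \<open>F\<close>.\<close>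

lemma subsolution_comparison:
  fixes u :: "real^'n \<Rightarrow> ereal"
  assumes u: "subsolution F X u" and C: "compact C" "C \<subseteq> X" and D: "open D" "D \<subseteq> C"
    and cont: "continuous_on C \<phi>" and C2: "C2_with D \<phi> g H" and H: "\<And>x. x \<in> D \<Longrightarrow> H x \<notin> F"
    and bd: "\<And>x. x \<in> C - D \<Longrightarrow> u x \<le> ereal (\<phi> x)" and x: "x \<in> C"
  shows "u x \<le> ereal (\<phi> x)"
proof (rule ccontr)
  assume not_le: "\<not> u x \<le> ereal (\<phi> x)"
  have top: "u y < \<infinity>" if "y \<in> C" for y using u C(2) that subsolution_less_top by blast
  have "usc_on C u" using subsolution_usc[OF u] C(2) usc_on_subset by blast
  then have usc: "usc_on C (\<lambda>x. u x - ereal (\<phi> x))"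
    by (rule usc_on_diff_continuous) (use cont top in auto)
  have "C \<noteq> {}" using x by blast
  obtain z where z: "z \<in> C" "\<And>y. y \<in> C \<Longrightarrow> u y - ereal (\<phi> y) \<le> u z - ereal (\<phi> z)"
    using usc_on_attains_max[OF usc C(1) \<open>C \<noteq> {}\<close>] by blast
  have "0 < u x - ereal (\<phi> x)" using not_le by (cases "u x") auto
  with z(2)[OF x] have pos: "0 < u z - ereal (\<phi> z)" by order
  then obtain a where a: "u z = ereal a" using top[OF z(1)] by (cases "u z") auto
  have "z \<in> D" using pos bd[of z] z(1) a by fastforce
  define m where "m = a - \<phi> z"
  have le: "u y \<le> ereal (\<phi> y + m)" if "y \<in> D" for y
    using z(2)[of y] D(2) that a unfolding m_def by (cases "u y") auto
  have "C2_with D (\<lambda>x. \<phi> x + m) (\<lambda>x. g x + 0) (\<lambda>x. H x + 0)"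
    using C2 C2_with_const by (rule C2_with_add)
  moreover have "u z = ereal (\<phi> z + m)" using a m_def by simp
  ultimately have "H z \<in> F"
    using subsolutionD[OF u, of z D "\<lambda>x. \<phi> x + m" g H] le \<open>z \<in> D\<close> D C(2) by auto
  with H \<open>z \<in> D\<close> show False by blast
qed

section \<open>Radial comparison functions\<close>

lemma proj_line_mult_vec: "proj_line z *v h = (z \<bullet> h) *\<^sub>R z"
  by (simp add: proj_line_def matrix_vector_mult_def inner_vec_def vec_eq_iff
      sum_distrib_left mult_ac)

lemma proj_line_scaleR: "proj_line (c *\<^sub>R e) = (c\<^sup>2) *\<^sub>R proj_line e"
  by (simp add: proj_line_def vec_eq_iff power2_eq_square)

lemma continuous_on_proj_line [continuous_intros]:
  "continuous_on S f \<Longrightarrow> continuous_on S (\<lambda>x. proj_line (f x))"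
  unfolding proj_line_def by (intro continuous_intros)

lemma proj_line_conjugate: "g ** proj_line v ** transpose g = proj_line (g *v v)"
proof -
  have "(\<Sum>k\<in>UNIV. (\<Sum>l\<in>UNIV. g $ i $ l * (v $ l * v $ k)) * g $ j $ k) =
    (\<Sum>l\<in>UNIV. g $ i $ l * v $ l) * (\<Sum>k\<in>UNIV. g $ j $ k * v $ k)" for i j
  proof -
    have "(\<Sum>k\<in>UNIV. (\<Sum>l\<in>UNIV. g $ i $ l * (v $ l * v $ k)) * g $ j $ k) =
      (\<Sum>k\<in>UNIV. \<Sum>l\<in>UNIV. (g $ i $ l * v $ l) * (g $ j $ k * v $ k))"
      by (simp add: sum_distrib_left sum_distrib_right mult_ac)
    also have "\<dots> = (\<Sum>l\<in>UNIV. \<Sum>k\<in>UNIV. (g $ i $ l * v $ l) * (g $ j $ k * v $ k))"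
      by (rule sum.swap)
    finally show ?thesis by (simp only: sum_product)
  qed
  then show ?thesis
    by (simp add: proj_line_def matrix_matrix_mult_def matrix_vector_mult_def transpose_def vec_eq_iff)
qed

lemma scaleR_matrix_mul_left: "(c *\<^sub>R A) ** B = c *\<^sub>R (A ** (B :: real^'n^'n))"
  by (simp add: matrix_matrix_mult_def vec_eq_iff sum_distrib_left mult_ac)

lemma scaleR_matrix_mul_right: "A ** (c *\<^sub>R B) = c *\<^sub>R (A ** (B :: real^'n^'n))"
  by (simp add: matrix_matrix_mult_def vec_eq_iff sum_distrib_left mult_ac)

text \<open>Using the squared radius as variable keeps square roots out of the Hessian, which becomes a
  combination of the identity and \<open>z z\<^sup>T\<close> with \<open>z = y - x\<close>.\<close>

lemma C2_with_radial:
  fixes x :: "real^'n"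
  assumes k: "\<And>s. s \<in> I \<Longrightarrow> (k has_real_derivative k1 s) (at s)"
    and k1: "\<And>s. s \<in> I \<Longrightarrow> (k1 has_real_derivative k2 s) (at s)"
    and k2: "continuous_on I k2"
    and U: "\<And>y. y \<in> U \<Longrightarrow> (norm (y - x))\<^sup>2 \<in> I"
  shows "C2_with U (\<lambda>y. k ((norm (y - x))\<^sup>2)) (\<lambda>y. (2 * k1 ((norm (y - x))\<^sup>2)) *\<^sub>R (y - x))
     (\<lambda>y. (2 * k1 ((norm (y - x))\<^sup>2)) *\<^sub>R mat 1 + (4 * k2 ((norm (y - x))\<^sup>2)) *\<^sub>R proj_line (y - x))"
proof -
  let ?s = "\<lambda>y::real^'n. (norm (y - x))\<^sup>2"
  have s: "(?s has_derivative (\<lambda>h. 2 * (h \<bullet> (y - x)))) (at y)" for y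
    unfolding power2_norm_eq_inner
    by (auto intro!: derivative_eq_intros simp: inner_commute)
  have d: "((\<lambda>y. k (?s y)) has_derivative (\<lambda>h. k1 (?s y) * (2 * (h \<bullet> (y - x))))) (at y)"
    if "y \<in> U" for y
    using has_derivative_compose[OF s k[OF U[OF that], unfolded has_field_derivative_def]]
    by simp
  have d1: "((\<lambda>y. k1 (?s y)) has_derivative (\<lambda>h. k2 (?s y) * (2 * (h \<bullet> (y - x))))) (at y)"
    if "y \<in> U" for y
    using has_derivative_compose[OF s k1[OF U[OF that], unfolded has_field_derivative_def]]
    by simp
  have A: "GDERIV (\<lambda>y. k (?s y)) y :> (2 * k1 (?s y)) *\<^sub>R (y - x)" if "y \<in> U" for y
    using d[OF that] unfolding gderiv_def by (simp add: algebra_simps)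
  have B: "((\<lambda>y. (2 * k1 (?s y)) *\<^sub>R (y - x)) has_derivative
     (\<lambda>h. ((2 * k1 (?s y)) *\<^sub>R mat 1 + (4 * k2 (?s y)) *\<^sub>R proj_line (y - x)) *v h)) (at y)"
    if "y \<in> U" for y
    by (rule has_derivative_eq_rhs, (rule derivative_intros d1[OF that])+)
      (auto simp: matrix_vector_mult_add_rdistrib proj_line_mult_vec
        scaleR_matrix_vector_assoc[symmetric] fun_eq_iff inner_commute algebra_simps)
  have "continuous_on I k1"
    using k1 by (meson DERIV_isCont continuous_at_imp_continuous_on)
  then have "continuous_on U (\<lambda>y. k1 (?s y))"
    by (rule continuous_on_compose2) (use U in \<open>auto intro!: continuous_intros\<close>)
  moreover
  have "continuous_on U (\<lambda>y. k2 (?s y))"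
    by (rule continuous_on_compose2[OF k2]) (use U in \<open>auto intro!: continuous_intros\<close>)
  ultimately have "continuous_on U (\<lambda>y. (2 * k1 (?s y)) *\<^sub>R mat 1 + (4 * k2 (?s y)) *\<^sub>R proj_line (y - x))"
    by (intro continuous_intros)
  with A B show ?thesis unfolding C2_with_def by blast
qed

section \<open>The Riesz kernel\<close>

lemma riesz_kernel_strict_mono:
  assumes "0 < s" "s < t"
  shows "riesz_kernel p s < riesz_kernel p t"
  using assms powr_less_mono2[of "2 - p" s t] powr_less_mono2_neg[of "2 - p" s t]
  unfolding riesz_kernel_def by auto

lemma riesz_kernel_mono:
  assumes "0 < s" "s \<le> t"
  shows "riesz_kernel p s \<le> riesz_kernel p t"
  using riesz_kernel_strict_mono[of s t p] assms by (cases "s = t") auto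

lemma has_field_derivative_cong_eventually_nhds:
  fixes f g :: "real \<Rightarrow> real"
  assumes "(g has_real_derivative D) (at s)" "\<forall>\<^sub>F t in nhds s. f t = g t"
  shows "(f has_real_derivative D) (at s)"
  using DERIV_cong_ev[OF refl assms(2) refl] assms(1) by blast

text \<open>As functions of the squared radius, the kernels of all three types have a derivative of the same form,
  a positive multiple of \<open>s\<^bsup>-p/2\<^esup>\<close>.\<close>

lemma riesz_kernel_sqrt_derivative:
  assumes s: "0 < s"
  shows "((\<lambda>s. riesz_kernel p (sqrt s)) has_real_derivative
    (if p = 2 then 1 else \<bar>2 - p\<bar>) / 2 * s powr (- p / 2)) (at s)"
proof -
  have ev: "\<forall>\<^sub>F t in nhds s. t > 0"
    using s eventually_nhds_in_open[of "{0<..}" s] by auto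
  have pw: "sqrt t powr (2 - p) = t powr ((2 - p) / 2)" if "t > 0" for t
    using that by (simp add: powr_half_sqrt[symmetric] powr_powr field_simps)
  have d: "((\<lambda>t. t powr ((2 - p) / 2)) has_real_derivative (2 - p) / 2 * s powr (- p / 2)) (at s)"
  proof -
    have "(2 - p) / 2 - 1 = - p / 2" by (simp add: field_simps)
    then show ?thesis using has_real_derivative_powr[OF s, of "(2 - p) / 2"] by simp
  qed
  consider "p < 2" | "p = 2" | "p > 2" by linarith
  then show ?thesis
  proof cases
    case 1
    have "\<forall>\<^sub>F t in nhds s. riesz_kernel p (sqrt t) = t powr ((2 - p) / 2)"
      by (rule eventually_mono[OF ev]) (use 1 pw in \<open>auto simp: riesz_kernel_def\<close>)
    with d have "((\<lambda>s. riesz_kernel p (sqrt s)) has_real_derivative (2 - p) / 2 * s powr (- p / 2)) (at s)"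
      by (rule has_field_derivative_cong_eventually_nhds)
    with 1 show ?thesis by simp
  next
    case 2
    have "((\<lambda>t. ln t / 2) has_real_derivative 1 / 2 * s powr (- p / 2)) (at s)"
      using s 2 by (auto intro!: derivative_eq_intros simp: powr_minus field_simps)
    moreover have "\<forall>\<^sub>F t in nhds s. riesz_kernel p (sqrt t) = ln t / 2"
      by (rule eventually_mono[OF ev]) (use 2 in \<open>auto simp: riesz_kernel_def ln_sqrt\<close>)
    ultimately have "((\<lambda>s. riesz_kernel p (sqrt s)) has_real_derivative 1 / 2 * s powr (- p / 2)) (at s)"
      by (rule has_field_derivative_cong_eventually_nhds)
    with 2 show ?thesis by simp
  next
    case 3
    have "((\<lambda>t. - (t powr ((2 - p) / 2))) has_real_derivative - ((2 - p) / 2 * s powr (- p / 2))) (at s)"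
      using d by (rule DERIV_minus)
    moreover have "\<forall>\<^sub>F t in nhds s. riesz_kernel p (sqrt t) = - (t powr ((2 - p) / 2))"
      by (rule eventually_mono[OF ev]) (use 3 pw in \<open>auto simp: riesz_kernel_def\<close>)
    ultimately have "((\<lambda>s. riesz_kernel p (sqrt s)) has_real_derivative
       - ((2 - p) / 2 * s powr (- p / 2))) (at s)"
      by (rule has_field_derivative_cong_eventually_nhds)
    moreover have "- ((2 - p) / 2 * s powr (- p / 2)) = \<bar>2 - p\<bar> / 2 * s powr (- p / 2)"
      using 3 by (simp add: field_simps)
    ultimately have "((\<lambda>s. riesz_kernel p (sqrt s)) has_real_derivative
       \<bar>2 - p\<bar> / 2 * s powr (- p / 2)) (at s)" by (simp only:)
    with 3 show ?thesis by simp
  qed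
qed

lemma continuous_on_riesz_kernel: "continuous_on {0<..} (riesz_kernel p)"
  unfolding riesz_kernel_def
  by (cases "p < 2"; cases "p = 2") (auto intro!: continuous_intros)

section \<open>Cones with finite Riesz characteristic\<close>

locale riesz_cone =
  fixes F :: "(real^'n^'n) set" and e :: "real^'n" and p :: real
  assumes subequation: "subequation F" and cone: "cone F" and ST_invariant: "ST_invariant F"
    and norm_e: "norm e = 1" and characteristic: "riesz_characteristic F e = ereal p"
begin

lemma F_scale: "A \<in> F \<Longrightarrow> 0 \<le> c \<Longrightarrow> c *\<^sub>R A \<in> F"
  using cone unfolding cone_def by blast

lemma F_add_PSD: "A \<in> F \<Longrightarrow> P \<in> PSD \<Longrightarrow> A + P \<in> F"
  using subequation unfolding subequation_def by blast

lemma F_Sym2: "A \<in> F \<Longrightarrow> A \<in> Sym2"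
  using subequation unfolding subequation_def by blast

lemma closed_F: "closed F"
  using subequation unfolding subequation_def by blast

lemma zero_in_F: "0 \<in> F"
proof -
  obtain A where "A \<in> F" using subequation unfolding subequation_def by blast
  from F_scale[OF this, of 0] show ?thesis by simp
qed

lemma PSD_subset_F: "P \<in> PSD \<Longrightarrow> P \<in> F"
  using F_add_PSD[OF zero_in_F] by simp

lemma add_multiple_of_identity_PSD:
  fixes A :: "real^'n^'n"
  assumes "A \<in> Sym2"
  shows "\<exists>c>0. A + c *\<^sub>R mat 1 \<in> PSD"
proof -
  obtain B where B: "B > 0" "\<And>x. norm (A *v x) \<le> norm x * B"
    using bounded_linear.pos_bounded[OF matrix_vector_mul_bounded_linear[of A]] by blast
  have "0 \<le> x \<bullet> ((A + B *\<^sub>R mat 1) *v x)" for x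
  proof -
    have "\<bar>x \<bullet> (A *v x)\<bar> \<le> norm x * norm (A *v x)" by (rule Cauchy_Schwarz_ineq2)
    also have "\<dots> \<le> norm x * (norm x * B)" by (intro mult_left_mono B) simp
    also have "\<dots> = B * (x \<bullet> x)" by (simp add: power2_norm_eq_inner[symmetric] power2_eq_square)
    finally show ?thesis
      by (simp add: matrix_vector_mult_add_rdistrib inner_right_distrib
          scaleR_matrix_vector_assoc[symmetric])
  qed
  moreover have "transpose (A + B *\<^sub>R mat 1) = A + B *\<^sub>R mat 1"
    using assms unfolding Sym2_def by (simp add: transpose_def vec_eq_iff mat_def)
  ultimately show ?thesis using B(1) unfolding PSD_def Sym2_def by blast
qed

text \<open>Otherwise every symmetric matrix \<open>A\<close> would be the sum of a negative multiple of the identity in \<open>F\<close>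
  and a positive semidefinite matrix.\<close>

lemma negative_identity_notin_F:
  assumes "c < 0"
  shows "c *\<^sub>R mat 1 \<notin> F"
proof
  assume c: "c *\<^sub>R mat 1 \<in> F"
  have "A \<in> F" if A: "A \<in> Sym2" for A
  proof -
    obtain d where d: "d > 0" "A + d *\<^sub>R mat 1 \<in> PSD" using add_multiple_of_identity_PSD[OF A] by blast
    have dc: "d / (- c) * c = - d" using assms by (simp add: field_simps)
    have "(d / (- c)) *\<^sub>R (c *\<^sub>R mat 1) + (A + d *\<^sub>R mat 1) \<in> F"
      by (intro F_add_PSD F_scale c d) (use assms d in \<open>auto simp: divide_nonneg_neg\<close>)
    moreover have "(d / (- c)) *\<^sub>R (c *\<^sub>R mat 1) + (A + d *\<^sub>R mat 1) = A"
      by (simp only: scaleR_scaleR dc) simp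
    ultimately show ?thesis by (simp only:)
  qed
  then show False using subequation unfolding subequation_def by blast
qed

lemma p_ge_1: "1 \<le> p"
proof -
  have "transpose (proj_perp e) = proj_perp e"
    by (simp add: proj_perp_def proj_line_def transpose_def vec_eq_iff mat_def mult.commute)
  moreover have "0 \<le> x \<bullet> (proj_perp e *v x)" for x
  proof -
    have "(e \<bullet> x)\<^sup>2 \<le> (e \<bullet> e) * (x \<bullet> x)" by (rule Cauchy_Schwarz_ineq)
    moreover have "e \<bullet> e = 1" using norm_e by (simp add: norm_eq_1)
    ultimately show ?thesis
      by (simp add: proj_perp_def matrix_vector_mult_diff_rdistrib proj_line_mult_vec
          inner_diff_right power2_eq_square inner_commute)
  qed
  ultimately have "proj_perp e - (1 - 1) *\<^sub>R proj_line e \<in> F"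
    using PSD_subset_F unfolding PSD_def Sym2_def by simp
  then have "ereal 1 \<le> riesz_characteristic F e"
    unfolding riesz_characteristic_def by (intro Sup_upper) blast
  then show ?thesis using characteristic by simp
qed

lemma matrix_diff_mul: "(A - B) ** C = A ** C - B ** (C :: real^'n^'n)"
  by (simp add: matrix_matrix_mult_def vec_eq_iff sum_subtractf algebra_simps)

lemma matrix_mul_diff: "C ** (A - B) = C ** A - C ** (B :: real^'n^'n)"
  by (simp add: matrix_matrix_mult_def vec_eq_iff sum_subtractf algebra_simps)

text \<open>A group element carries \<open>e'\<close> to the direction \<open>e\<close> in which \<open>p\<close> was computed.\<close>

lemma above_characteristic_notin_F:
  assumes "norm e' = 1" "p < q"
  shows "proj_perp e' - (q - 1) *\<^sub>R proj_line e' \<notin> F"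
proof
  assume A: "proj_perp e' - (q - 1) *\<^sub>R proj_line e' \<in> F"
  obtain G where G: "orthogonal_subgroup G"
    "\<And>x y. norm x = 1 \<Longrightarrow> norm y = 1 \<Longrightarrow> \<exists>g\<in>G. g *v x = y"
    "\<And>g A. g \<in> G \<Longrightarrow> A \<in> F \<Longrightarrow> g ** A ** transpose g \<in> F"
    using ST_invariant unfolding ST_invariant_def by auto
  obtain g where g: "g \<in> G" "g *v e' = e" using G(2)[of e' e] assms norm_e by auto
  have "orthogonal_matrix g" using G(1) g(1) unfolding orthogonal_subgroup_def by blast
  then have "g ** transpose g = mat 1" unfolding orthogonal_matrix_def by simp
  then have "g ** (proj_perp e' - (q - 1) *\<^sub>R proj_line e') ** transpose g
      = proj_perp e - (q - 1) *\<^sub>R proj_line e"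
    unfolding proj_perp_def
    by (simp add: matrix_diff_mul matrix_mul_diff scaleR_matrix_mul_left
        scaleR_matrix_mul_right proj_line_conjugate g)
  then have "proj_perp e - (q - 1) *\<^sub>R proj_line e \<in> F" using G(3)[OF g(1) A] by simp
  then have "ereal q \<le> riesz_characteristic F e"
    unfolding riesz_characteristic_def by (intro Sup_upper) blast
  then show False using characteristic assms by simp
qed

text \<open>The Hessian of \<open>a + b K(|y - x|)\<close> lies on the boundary of \<open>F\<close>. Subtracting \<open>\<delta> |y - x|\<^sup>2\<close> replaces
  the exponent \<open>p\<close> in it by some \<open>q > p\<close>, so that the Hessian leaves \<open>F\<close> and the comparison principle
  applies on the annulus; then \<open>\<delta>\<close> tends to \<open>0\<close>.\<close>

lemma radial_comparison:
  assumes u: "subsolution F X u" and X: "cball x R \<subseteq> X" and s: "0 < s" "s < R" and b: "0 < b"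
    and bd_s: "\<And>y. dist x y = s \<Longrightarrow> u y \<le> ereal (a + b * riesz_kernel p s)"
    and bd_R: "\<And>y. dist x y = R \<Longrightarrow> u y \<le> ereal (a + b * riesz_kernel p R)"
    and y: "s \<le> dist x y" "dist x y \<le> R"
  shows "u y \<le> ereal (a + b * riesz_kernel p (dist x y))"
proof -
  define c where "c = (if p = 2 then 1 else \<bar>2 - p\<bar>) / 2"
  have c: "c > 0" unfolding c_def by auto
  define k1 where "k1 \<tau> = c * \<tau> powr (- p / 2)" for \<tau>
  define k2 where "k2 \<tau> = c * (- p / 2) * \<tau> powr (- p / 2 - 1)" for \<tau>
  define \<delta>0 where "\<delta>0 = b * k1 (R\<^sup>2)"
  have "\<delta>0 > 0" using b c s unfolding \<delta>0_def k1_def by simp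
  have dK: "((\<lambda>\<tau>. riesz_kernel p (sqrt \<tau>)) has_real_derivative k1 \<tau>) (at \<tau>)" if "\<tau> > 0" for \<tau>
    using riesz_kernel_sqrt_derivative[OF that, of p] unfolding k1_def c_def by simp
  have dk1: "(k1 has_real_derivative k2 \<tau>) (at \<tau>)" if "\<tau> > 0" for \<tau>
    using DERIV_cmult[OF has_real_derivative_powr[OF that, of "- p / 2"], of c]
    unfolding k1_def k2_def by (simp add: mult_ac)
  have k12: "2 * \<tau> * k2 \<tau> = - p * k1 \<tau>" if "\<tau> > 0" for \<tau>
  proof -
    have "\<tau> * \<tau> powr (- p / 2 - 1) = \<tau> powr (- p / 2)"
      using powr_mult_base[of \<tau> "- p / 2 - 1"] that by simp
    then have "2 * c * (- p / 2) * (\<tau> * \<tau> powr (- p / 2 - 1)) = - p * (c * \<tau> powr (- p / 2))"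
      by (simp only:) simp
    then show ?thesis unfolding k1_def k2_def by (simp only: mult_ac)
  qed
  let ?D = "ball x R - cball x s" and ?C = "cball x R - ball x s"
  have less: "u y \<le> ereal (a + b * riesz_kernel p (dist x y) + \<delta> * R\<^sup>2)" if \<delta>: "0 < \<delta>" "\<delta> < \<delta>0" for \<delta>
  proof -
    define k where "k \<tau> = a + b * riesz_kernel p (sqrt \<tau>) + \<delta> * R\<^sup>2 - \<delta> * \<tau>" for \<tau>
    define \<phi> where "\<phi> z = k ((norm (z - x))\<^sup>2)" for z
    define H where "H z = (2 * (b * k1 ((norm (z - x))\<^sup>2) - \<delta>)) *\<^sub>R mat 1
       + (4 * (b * k2 ((norm (z - x))\<^sup>2))) *\<^sub>R proj_line (z - x)" for z
    have dk: "(k has_real_derivative b * k1 \<tau> - \<delta>) (at \<tau>)" if "\<tau> > 0" for \<tau>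
      unfolding k_def using that by (auto intro!: derivative_eq_intros dK)
    have dk': "((\<lambda>\<tau>. b * k1 \<tau> - \<delta>) has_real_derivative b * k2 \<tau>) (at \<tau>)" if "\<tau> > 0" for \<tau>
      using that by (auto intro!: derivative_eq_intros dk1)
    have C2: "C2_with (- {x}) \<phi> (\<lambda>z. (2 * (b * k1 ((norm (z - x))\<^sup>2) - \<delta>)) *\<^sub>R (z - x)) H"
      unfolding \<phi>_def[abs_def] H_def[abs_def]
      by (rule C2_with_radial[where I = "{0<..}"])
        (use dk dk' in \<open>auto simp: k2_def intro!: continuous_intros\<close>)
    have \<phi>_eq: "\<phi> z = a + b * riesz_kernel p (dist x z) + \<delta> * (R\<^sup>2 - (dist x z)\<^sup>2)" for z
      unfolding \<phi>_def k_def by (simp add: dist_norm norm_minus_commute algebra_simps)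
    have H_notin: "H z \<notin> F" if z: "z \<in> ?D" for z
    proof
      assume "H z \<in> F"
      let ?\<tau> = "(norm (z - x))\<^sup>2"
      have n: "0 < norm (z - x)" "norm (z - x) < R" using z s by (auto simp: dist_norm norm_minus_commute)
      have "k1 (R\<^sup>2) \<le> k1 ?\<tau>"
        unfolding k1_def using n c p_ge_1
        by (intro mult_left_mono powr_mono2') (auto intro: power_mono)
      then have pos: "0 < b * k1 ?\<tau> - \<delta>" using \<delta> b unfolding \<delta>0_def
        by (smt (verit) mult_left_mono)
      \<comment> \<open>In the radial direction \<open>e'\<close> the Hessian is a positive multiple of \<open>P\<^sub>\<bottom> - (q - 1) P\<close>.\<close>
      define q where "q = p * (b * k1 ?\<tau>) / (b * k1 ?\<tau> - \<delta>)"
      define e' where "e' = (z - x) /\<^sub>R norm (z - x)"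
      have e': "norm e' = 1" "z - x = norm (z - x) *\<^sub>R e'" using n unfolding e'_def by auto
      have "p < q" using pos \<delta> p_ge_1 unfolding q_def by (simp add: field_simps)
      have "4 * (b * k2 ?\<tau>) * ?\<tau> = 2 * (b * k1 ?\<tau> - \<delta>) * (- q)"
      proof -
        have q: "(b * k1 ?\<tau> - \<delta>) * q = p * (b * k1 ?\<tau>)" using pos unfolding q_def by simp
        have "4 * (b * k2 ?\<tau>) * ?\<tau> = 2 * b * (2 * ?\<tau> * k2 ?\<tau>)" by simp
        also have "\<dots> = - 2 * (p * (b * k1 ?\<tau>))" using k12[of ?\<tau>] n by simp
        also have "\<dots> = 2 * (b * k1 ?\<tau> - \<delta>) * (- q)" by (simp only: q[symmetric])
        finally show ?thesis .
      qed
      then have "H z = (2 * (b * k1 ?\<tau> - \<delta>)) *\<^sub>R (mat 1 - q *\<^sub>R proj_line e')"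
        unfolding H_def by (subst (3) e'(2)) (simp add: proj_line_scaleR scaleR_diff_right)
      then have "(1 / (2 * (b * k1 ?\<tau> - \<delta>))) *\<^sub>R H z = mat 1 - q *\<^sub>R proj_line e'"
        using pos by simp
      moreover have "mat 1 - q *\<^sub>R proj_line e' = proj_perp e' - (q - 1) *\<^sub>R proj_line e'"
        unfolding proj_perp_def by (simp add: algebra_simps)
      ultimately have "proj_perp e' - (q - 1) *\<^sub>R proj_line e' \<in> F"
        using F_scale[OF \<open>H z \<in> F\<close>, of "1 / (2 * (b * k1 ?\<tau> - \<delta>))"] pos by simp
      then show False using above_characteristic_notin_F[OF e'(1) \<open>p < q\<close>] by blast
    qed
    have "u y \<le> ereal (\<phi> y)"
    proof (rule subsolution_comparison[OF u])
      show "compact ?C" by (intro compact_diff) auto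
      show "?C \<subseteq> X" using X by auto
      show "open ?D" "?D \<subseteq> ?C" by auto
      show "continuous_on ?C \<phi>"
        using C2_with_continuous_on[OF C2] by (rule continuous_on_subset) (use s in auto)
      show "C2_with ?D \<phi> (\<lambda>z. (2 * (b * k1 ((norm (z - x))\<^sup>2) - \<delta>)) *\<^sub>R (z - x)) H"
        using C2 by (rule C2_with_subset) (use s in auto)
      show "u z \<le> ereal (\<phi> z)" if "z \<in> ?C - ?D" for z
      proof -
        have "dist x z = s \<or> dist x z = R" using that by auto
        then have "u z \<le> ereal (a + b * riesz_kernel p (dist x z))" using bd_s bd_R by auto
        moreover have "0 \<le> \<delta> * (R\<^sup>2 - (dist x z)\<^sup>2)" using that \<delta> by (auto intro!: mult_nonneg_nonneg power_mono)
        then have "ereal (a + b * riesz_kernel p (dist x z)) \<le> ereal (\<phi> z)" unfolding \<phi>_eq by simp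
        ultimately show ?thesis by order
      qed
    qed (use H_notin y in auto)
    also have "ereal (\<phi> y) \<le> ereal (a + b * riesz_kernel p (dist x y) + \<delta> * R\<^sup>2)"
      unfolding \<phi>_eq using \<delta> by (simp add: algebra_simps)
    finally show ?thesis .
  qed
  show ?thesis
  proof (rule ereal_le_epsilon2)
    fix \<epsilon> :: real assume "0 < \<epsilon>"
    define \<delta> where "\<delta> = min (\<delta>0 / 2) (\<epsilon> / R\<^sup>2)"
    have "0 < \<delta>" "\<delta> < \<delta>0" using \<open>\<epsilon> > 0\<close> \<open>\<delta>0 > 0\<close> s unfolding \<delta>_def by auto
    from less[OF this] have "u y \<le> ereal (a + b * riesz_kernel p (dist x y) + \<delta> * R\<^sup>2)" .
    moreover have "\<delta> \<le> \<epsilon> / R\<^sup>2" unfolding \<delta>_def by simp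
    then have "\<delta> * R\<^sup>2 \<le> \<epsilon>" using s by (simp add: pos_le_divide_eq)
    then have "ereal (a + b * riesz_kernel p (dist x y) + \<delta> * R\<^sup>2)
       \<le> ereal (a + b * riesz_kernel p (dist x y)) + ereal \<epsilon>" by simp
    ultimately show "u y \<le> ereal (a + b * riesz_kernel p (dist x y)) + ereal \<epsilon>" by order
  qed
qed

end

section \<open>Maxima over balls\<close>

lemma max_avg_le_iff: "max_avg u x r \<le> c \<longleftrightarrow> (\<forall>z\<in>cball x r. u z \<le> c)"
proof
  assume le: "max_avg u x r \<le> c"
  show "\<forall>z\<in>cball x r. u z \<le> c"
  proof
    fix z assume "z \<in> cball x r"
    then have "z - x \<in> cball 0 r" by (simp add: dist_norm norm_minus_commute)
    then have "u (x + (z - x)) \<le> max_avg u x r" unfolding max_avg_def by (rule SUP_upper)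
    with le show "u z \<le> c" by simp
  qed
next
  assume "\<forall>z\<in>cball x r. u z \<le> c"
  then show "max_avg u x r \<le> c"
    unfolding max_avg_def by (intro SUP_least) (simp add: dist_norm)
qed

lemma le_max_avg: "dist x z \<le> r \<Longrightarrow> u z \<le> max_avg u x r"
  using max_avg_le_iff[of u x r "max_avg u x r"] by simp

lemma max_avg_mono_ball: "cball x r \<subseteq> cball y s \<Longrightarrow> max_avg u x r \<le> max_avg u y s"
  unfolding max_avg_le_iff by (auto intro!: le_max_avg)

lemma max_avg_mono: "r \<le> s \<Longrightarrow> max_avg u x r \<le> max_avg u x s"
  by (rule max_avg_mono_ball) auto

lemma max_avg_attained:
  assumes "usc_on X u" "cball x r \<subseteq> X" "0 \<le> r"
  obtains z where "dist x z \<le> r" "max_avg u x r = u z"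
proof -
  have "usc_on (cball x r) u" using assms(1,2) by (rule usc_on_subset)
  then obtain z where z: "z \<in> cball x r" "\<And>y. y \<in> cball x r \<Longrightarrow> u y \<le> u z"
    by (rule usc_on_attains_max) (use assms(3) in auto)
  then have "max_avg u x r \<le> u z" unfolding max_avg_le_iff by blast
  moreover have "u z \<le> max_avg u x r" using z(1) by (intro le_max_avg) simp
  ultimately show thesis using that[of z] z(1) by auto
qed

lemma max_avg_less_top:
  assumes "subsolution F X u" "cball x r \<subseteq> X" "0 \<le> r"
  shows "max_avg u x r < \<infinity>"
proof -
  obtain z where "dist x z \<le> r" "max_avg u x r = u z"
    using max_avg_attained[OF subsolution_usc[OF assms(1)] assms(2,3)] .
  moreover from this have "u z < \<infinity>" using subsolution_less_top[OF assms(1)] assms(2) by auto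
  ultimately show ?thesis by simp
qed

text \<open>The function \<open>m\<close> is increasing and is convex as a function of \<open>K(r)\<close>. The slopes are compared without
  division.\<close>

definition kernel_convex :: "real \<Rightarrow> real \<Rightarrow> (real \<Rightarrow> real) \<Rightarrow> bool" where
  "kernel_convex p R m \<longleftrightarrow>
     (\<forall>s t. 0 < s \<and> s \<le> t \<and> t < R \<longrightarrow> m s \<le> m t) \<and>
     (\<forall>s t r. 0 < s \<and> s < t \<and> t < r \<and> r < R \<longrightarrow>
        (m t - m s) * (riesz_kernel p r - riesz_kernel p s)
          \<le> (m r - m s) * (riesz_kernel p t - riesz_kernel p s))"

lemma kernel_convexI:
  assumes "\<And>s t. 0 < s \<Longrightarrow> s \<le> t \<Longrightarrow> t < R \<Longrightarrow> m s \<le> m t"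
    and "\<And>s t r. 0 < s \<Longrightarrow> s < t \<Longrightarrow> t < r \<Longrightarrow> r < R \<Longrightarrow>
        (m t - m s) * (riesz_kernel p r - riesz_kernel p s)
          \<le> (m r - m s) * (riesz_kernel p t - riesz_kernel p s)"
  shows "kernel_convex p R m"
  using assms unfolding kernel_convex_def by blast

lemma kernel_convex_mono:
  "kernel_convex p R m \<Longrightarrow> 0 < s \<Longrightarrow> s \<le> t \<Longrightarrow> t < R \<Longrightarrow> m s \<le> m t"
  unfolding kernel_convex_def by blast

lemma kernel_convexD:
  "kernel_convex p R m \<Longrightarrow> 0 < s \<Longrightarrow> s < t \<Longrightarrow> t < r \<Longrightarrow> r < R \<Longrightarrow>
    (m t - m s) * (riesz_kernel p r - riesz_kernel p s)
      \<le> (m r - m s) * (riesz_kernel p t - riesz_kernel p s)"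
  unfolding kernel_convex_def by blast

text \<open>The slopes of \<open>m\<close> between \<open>t\<close> and \<open>r\<close> are bounded by those between \<open>r\<close> and the larger radius \<open>r'\<close>,
  where \<open>m\<close> can have grown by at most \<open>m r' - m s\<close>.\<close>

lemma kernel_convex_Lipschitz:
  assumes m: "kernel_convex p R m" and r: "0 < s" "s < r" "r < r'" "r' < R" "s \<le> t" "t \<le> r'"
  shows "\<bar>m t - m r\<bar> \<le> (m r' - m s) / (riesz_kernel p r' - riesz_kernel p r) *
     \<bar>riesz_kernel p t - riesz_kernel p r\<bar>"
proof -
  let ?K = "riesz_kernel p"
  have K: "?K r < ?K r'" using riesz_kernel_strict_mono r by simp
  consider "t < r" | "t = r" | "r < t" by linarith
  then show ?thesis
  proof cases
    case 1
    have Kt: "?K t < ?K r" using 1 r by (intro riesz_kernel_strict_mono) auto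
    have "m t \<le> m r" "m s \<le> m t" "m t \<le> m r'" using kernel_convex_mono[OF m] 1 r by simp_all
    have "(m r - m t) * (?K r' - ?K r) \<le> (m r - m t) * (?K r' - ?K t)"
      using \<open>m t \<le> m r\<close> Kt by (intro mult_left_mono) auto
    also have "\<dots> \<le> (m r' - m t) * (?K r - ?K t)"
      using kernel_convexD[OF m _ 1 r(3,4)] r by simp
    also have "\<dots> \<le> (m r' - m s) * (?K r - ?K t)"
      using \<open>m s \<le> m t\<close> Kt by (intro mult_right_mono) auto
    finally have "m r - m t \<le> (m r' - m s) * (?K r - ?K t) / (?K r' - ?K r)"
      using K by (simp add: pos_le_divide_eq)
    then show ?thesis using \<open>m t \<le> m r\<close> Kt by simp
  next
    case 3
    have Kt: "?K r < ?K t" using 3 r by (intro riesz_kernel_strict_mono) auto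
    have le: "m r \<le> m t" "m s \<le> m r" using kernel_convex_mono[OF m] 3 r by simp_all
    have "(m t - m r) * (?K r' - ?K r) \<le> (m r' - m r) * (?K t - ?K r)"
      using kernel_convexD[OF m _ 3 _ r(4)] r by (cases "t = r'") auto
    also have "\<dots> \<le> (m r' - m s) * (?K t - ?K r)"
      using le Kt by (intro mult_right_mono) auto
    finally have "m t - m r \<le> (m r' - m s) * (?K t - ?K r) / (?K r' - ?K r)"
      using K by (simp add: pos_le_divide_eq)
    then show ?thesis using le Kt by simp
  qed simp
qed

lemma isCont_riesz_kernel: "0 < r \<Longrightarrow> isCont (riesz_kernel p) r"
  using continuous_on_riesz_kernel[of p] by (simp add: continuous_on_eq_continuous_at)

lemma kernel_convex_isCont:
  assumes m: "kernel_convex p R m" and r: "0 < r" "r < R"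
  shows "isCont m r"
proof -
  obtain s r' where sr: "0 < s" "s < r" "r < r'" "r' < R" using r dense by meson
  define C where "C = (m r' - m s) / (riesz_kernel p r' - riesz_kernel p r)"
  have "((\<lambda>t. C * \<bar>riesz_kernel p t - riesz_kernel p r\<bar>) \<longlongrightarrow> C * \<bar>riesz_kernel p r - riesz_kernel p r\<bar>) (at r)"
    using isCont_riesz_kernel[OF r(1), of p] unfolding isCont_def by (intro tendsto_intros)
  then have lim: "((\<lambda>t. C * \<bar>riesz_kernel p t - riesz_kernel p r\<bar>) \<longlongrightarrow> 0) (at r)" by simp
  have "\<forall>\<^sub>F t in nhds r. t \<in> {s<..<r'}" using sr by (intro eventually_nhds_in_open) auto
  then have "\<forall>\<^sub>F t in at r. t \<in> {s<..<r'}" unfolding eventually_at_filter by (rule eventually_mono) simp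
  then have "\<forall>\<^sub>F t in at r. norm (m t - m r) \<le> C * \<bar>riesz_kernel p t - riesz_kernel p r\<bar>"
    by (rule eventually_mono) (use kernel_convex_Lipschitz[OF m sr] in \<open>auto simp: C_def\<close>)
  then have "((\<lambda>t. m t - m r) \<longlongrightarrow> 0) (at r)" using lim by (rule Lim_null_comparison)
  then show ?thesis unfolding isCont_def by (simp add: LIM_zero_iff)
qed

context riesz_cone
begin

text \<open>The analogue of Hadamard's three circles theorem. Inside the small ball the bound \<open>\<alpha>\<close> is already enough,
  because the comparison function increases with the radius.\<close>

lemma three_circles:
  assumes u: "subsolution F X u" and X: "cball x R \<subseteq> X" and s: "0 < s" "s < R" "s \<le> t" "t \<le> R"
    and \<alpha>: "max_avg u x s \<le> ereal \<alpha>" and \<beta>: "max_avg u x R \<le> ereal \<beta>" and "\<alpha> < \<beta>"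
  shows "max_avg u x t \<le>
     ereal (\<alpha> + (\<beta> - \<alpha>) / (riesz_kernel p R - riesz_kernel p s) * (riesz_kernel p t - riesz_kernel p s))"
proof -
  let ?K = "riesz_kernel p"
  have K: "?K s < ?K R" using riesz_kernel_strict_mono s by simp
  define b where "b = (\<beta> - \<alpha>) / (?K R - ?K s)"
  have b: "b > 0" using K \<open>\<alpha> < \<beta>\<close> unfolding b_def by simp
  define a where "a = \<alpha> - b * ?K s"
  have "b * (?K R - ?K s) = \<beta> - \<alpha>" using K unfolding b_def by simp
  then have a: "a + b * ?K s = \<alpha>" "a + b * ?K R = \<beta>"
    unfolding a_def by (simp_all add: algebra_simps)
  have "u y \<le> ereal (a + b * ?K t)" if y: "dist x y \<le> t" for y
  proof (cases "dist x y \<le> s")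
    case True
    have "u y \<le> ereal (a + b * ?K s)" using True a \<alpha> le_max_avg order_trans by metis
    also have "\<dots> \<le> ereal (a + b * ?K t)" using b s riesz_kernel_mono by simp
    finally show ?thesis .
  next
    case False
    have "u y \<le> ereal (a + b * ?K (dist x y))"
    proof (rule radial_comparison[OF u X s(1,2) b])
      show "u z \<le> ereal (a + b * ?K s)" if "dist x z = s" for z
        using that a \<alpha> le_max_avg[of x z s u] by simp
      show "u z \<le> ereal (a + b * ?K R)" if "dist x z = R" for z
        using that a \<beta> le_max_avg[of x z R u] by simp
    qed (use False y s in auto)
    also have "?K (dist x y) \<le> ?K t" using s False y by (intro riesz_kernel_mono) linarith+
    then have "ereal (a + b * ?K (dist x y)) \<le> ereal (a + b * ?K t)" using b by simp
    finally show ?thesis .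
  qed
  then have "max_avg u x t \<le> ereal (a + b * ?K t)" unfolding max_avg_le_iff by simp
  then show ?thesis using a(1) by (simp add: b_def[symmetric] a_def algebra_simps)
qed

text \<open>In the three circles theorem the bound on the inner ball may now be taken arbitrarily negative.\<close>

lemma max_avg_minus_infinity_propagates:
  assumes u: "subsolution F X u" and X: "cball x R \<subseteq> X" and s: "0 < s" "s \<le> t" "t < R"
    and inf: "max_avg u x s = -\<infinity>"
  shows "max_avg u x t = -\<infinity>"
proof -
  let ?K = "riesz_kernel p"
  have "max_avg u x R < \<infinity>" using max_avg_less_top[OF u X] s by simp
  then obtain \<beta> where \<beta>: "max_avg u x R \<le> ereal \<beta>"
    by (cases "max_avg u x R") auto
  define l where "l = (?K t - ?K s) / (?K R - ?K s)"
  have l: "l < 1" using riesz_kernel_strict_mono[of t R p] riesz_kernel_strict_mono[of s R p] s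
    unfolding l_def by (simp add: divide_less_eq)
  have "max_avg u x t \<le> ereal B" for B
  proof -
    \<comment> \<open>With this \<open>\<alpha>\<close> the three circles bound \<open>\<alpha> (1 - l) + \<beta> l\<close> is at most \<open>B\<close>.\<close>
    define \<alpha> where "\<alpha> = min (\<beta> - 1) ((B - \<beta> * l) / (1 - l))"
    have "max_avg u x t \<le> ereal (\<alpha> + (\<beta> - \<alpha>) / (?K R - ?K s) * (?K t - ?K s))"
      by (rule three_circles[OF u X _ _ _ _ _ \<beta>]) (use s inf in \<open>auto simp: \<alpha>_def\<close>)
    also have "\<alpha> + (\<beta> - \<alpha>) / (?K R - ?K s) * (?K t - ?K s) = \<alpha> * (1 - l) + \<beta> * l"
      unfolding l_def by (simp add: algebra_simps diff_divide_distrib)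
    also have "\<alpha> * (1 - l) \<le> (B - \<beta> * l) / (1 - l) * (1 - l)"
      using l unfolding \<alpha>_def by (intro mult_right_mono) auto
    then have "ereal (\<alpha> * (1 - l) + \<beta> * l) \<le> ereal B" using l by simp
    finally show ?thesis .
  qed
  then show ?thesis by (rule ereal_bot)
qed

text \<open>By the previous lemma the interior of \<open>{u = -\<infinity>}\<close> is relatively closed in \<open>X\<close>. If it were nonempty,
  it would contain a whole component of \<open>X\<close>.\<close>

lemma subharmonic_finite_dense:
  assumes u: "F_subharmonic F X u" and "open X" and x: "x \<in> X" and r: "0 < r"
  shows "\<exists>y\<in>ball x r \<inter> X. u y \<noteq> -\<infinity>"
proof (rule ccontr)
  assume neg: "\<not> ?thesis"
  have sub: "subsolution F X u" using u by (rule F_subharmonic_imp_subsolution)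
  \<comment> \<open>It remains to see that the open set \<open>Z\<close> is closed in \<open>X\<close>.\<close>
  define Z where "Z = interior {y \<in> X. u y = -\<infinity>}"
  have "ball x r \<inter> X \<subseteq> Z" unfolding Z_def
    using neg \<open>open X\<close> by (intro interior_maximal) auto
  then have xZ: "x \<in> Z" using x r by auto
  have ZX: "Z \<subseteq> X" "\<And>y. y \<in> Z \<Longrightarrow> u y = -\<infinity>" unfolding Z_def using interior_subset by auto
  have "open Z" unfolding Z_def by simp
  have cl: "y \<in> Z" if y: "y \<in> X" "y \<in> closure Z" for y
  proof -
    obtain d where d: "d > 0" "cball y d \<subseteq> X" using \<open>open X\<close> y(1) open_contains_cball by blast
    obtain z where z: "z \<in> Z" "dist z y < d / 4" using y(2) d(1) closure_approachable[of y Z] by (meson divide_pos_pos zero_less_numeral)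
    obtain s where s: "s > 0" "cball z s \<subseteq> Z" using \<open>open Z\<close> z(1) open_contains_cball by blast
    define s' where "s' = min s (d / 4)"
    have "max_avg u z s' \<le> -\<infinity>" unfolding max_avg_le_iff s'_def using s(2) ZX(2) by auto
    then have inf: "max_avg u z s' = -\<infinity>" by simp
    have zX: "cball z (d * (3/4)) \<subseteq> X"
    proof
      fix w assume "w \<in> cball z (d * (3/4))"
      then have "dist y w \<le> d" using z(2) dist_triangle[of y w z] by (simp add: dist_commute)
      then show "w \<in> X" using d(2) by auto
    qed
    have s': "0 < s'" "s' \<le> d / 2" "d / 2 < d * (3/4)" using s(1) d(1) unfolding s'_def by auto
    have "max_avg u z (d / 2) = -\<infinity>"
      by (rule max_avg_minus_infinity_propagates[OF sub zX s' inf])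
    then have "u w = -\<infinity>" if "w \<in> ball z (d / 2)" for w
      using le_max_avg[of z w "d / 2" u] that by simp
    moreover have "ball z (d / 2) \<subseteq> X" using zX d by (auto simp: subset_eq)
    ultimately have "ball z (d / 2) \<subseteq> Z" unfolding Z_def by (intro interior_maximal) auto
    moreover have "y \<in> ball z (d / 2)" using z(2) d by (simp add: dist_commute)
    ultimately show ?thesis by blast
  qed
  define C where "C = connected_component_set X x"
  have C: "C \<in> components X" unfolding C_def using x by (rule componentsI)
  have CX: "C \<subseteq> X" and "connected C" "x \<in> C"
    unfolding C_def using x by (auto simp: connected_component_subset connected_connected_component)
  have "C \<subseteq> Z"
  proof (rule ccontr)
    assume "\<not> C \<subseteq> Z"
    then obtain y where "y \<in> C" "y \<notin> Z" by blast
    then have "y \<notin> closure Z" using cl CX by blast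
    have "\<exists>A B. open A \<and> open B \<and> C \<subseteq> A \<union> B \<and> A \<inter> B \<inter> C = {} \<and> A \<inter> C \<noteq> {} \<and> B \<inter> C \<noteq> {}"
      using \<open>open Z\<close> cl CX \<open>x \<in> C\<close> xZ \<open>y \<in> C\<close> \<open>y \<notin> closure Z\<close> closure_subset[of Z]
      by (intro exI[of _ Z] exI[of _ "- closure Z"]) auto
    with \<open>connected C\<close> show False unfolding connected_def by blast
  qed
  then have "\<forall>y\<in>C. u y = -\<infinity>" using ZX(2) by blast
  moreover have "\<exists>y\<in>C. u y \<noteq> -\<infinity>" using u C unfolding F_subharmonic_def by simp
  ultimately show False by blast
qed

lemma max_avg_finite:
  assumes "F_subharmonic F X u" "open X" "cball x r \<subseteq> X" "0 < r"
  shows "max_avg u x r = ereal (real_of_ereal (max_avg u x r))"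
proof -
  have "max_avg u x r < \<infinity>"
    using max_avg_less_top[OF F_subharmonic_imp_subsolution[OF assms(1)] assms(3)] assms(4) by simp
  moreover have "x \<in> X" using assms(3,4) by (simp add: subset_eq)
  then obtain y where "y \<in> ball x r" "u y \<noteq> -\<infinity>"
    using subharmonic_finite_dense[OF assms(1,2) _ assms(4)] by blast
  then have "max_avg u x r \<noteq> -\<infinity>" using le_max_avg[of x y r u] by auto
  ultimately show ?thesis by (cases "max_avg u x r") auto
qed

lemma max_avg_kernel_convex:
  assumes u: "subsolution F X u" and X: "ball x R \<subseteq> X"
    and fin: "\<And>r. 0 < r \<Longrightarrow> r < R \<Longrightarrow> max_avg u x r = ereal (m r)"
  shows "kernel_convex p R m"
proof (rule kernel_convexI)
  fix s t assume "0 < s" "s \<le> t" "t < R"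
  then show "m s \<le> m t" using max_avg_mono[of s t u x] fin[of s] fin[of t] by simp
next
  let ?K = "riesz_kernel p"
  fix s t r assume r: "0 < s" "s < t" "t < r" "r < R"
  have K: "?K s < ?K r" using r by (intro riesz_kernel_strict_mono) auto
  have mono: "m s \<le> m t" "m t \<le> m r"
    using max_avg_mono[of s t u x] max_avg_mono[of t r u x] fin[of s] fin[of t] fin[of r] r by simp_all
  show "(m t - m s) * (?K r - ?K s) \<le> (m r - m s) * (?K t - ?K s)"
  proof (cases "m s = m r")
    case False
    then have "m s < m r" using mono by simp
    moreover have "cball x r \<subseteq> X" using X r by (auto simp: subset_eq)
    ultimately have "max_avg u x t \<le> ereal (m s + (m r - m s) / (?K r - ?K s) * (?K t - ?K s))"
      by (intro three_circles[OF u]) (use fin r in auto)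
    then have "m t - m s \<le> (m r - m s) * (?K t - ?K s) / (?K r - ?K s)" using fin[of t] r by simp
    then show ?thesis using K by (simp add: pos_le_divide_eq)
  qed (use mono in simp)
qed

end

section \<open>Polynomial functions of bounded degree\<close>

text \<open>Linearity is asked for on the span only, because differential operators are linear only on
  differentiable functions.\<close>

lemma (in vector_space) injective_on_finite_span_imp_surjective:
  assumes S: "finite S"
    and T: "\<And>x. x \<in> span S \<Longrightarrow> T x \<in> span S"
    and add: "\<And>x y. x \<in> span S \<Longrightarrow> y \<in> span S \<Longrightarrow> T (x + y) = T x + T y"
    and hom: "\<And>c x. x \<in> span S \<Longrightarrow> T (scale c x) = scale c (T x)"
    and ker: "\<And>x. x \<in> span S \<Longrightarrow> T x = 0 \<Longrightarrow> x = 0"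
    and y: "y \<in> span S"
  shows "\<exists>x\<in>span S. T x = y"
proof -
  obtain b where b: "b \<subseteq> S" "independent b" "S \<subseteq> span b"
    using maximal_independent_subset[of S] by blast
  have fb: "finite b" using b(1) S finite_subset by blast
  have sb: "span b = span S"
    using b by (metis span_mono span_span subset_antisym)
  have T0: "T 0 = 0" using hom[of 0 0] span_zero by simp
  have lin: "T (\<Sum>v\<in>A. scale (u v) v) = (\<Sum>v\<in>A. scale (u v) (T v))" if "finite A" "A \<subseteq> b" for A u
    using that
  proof (induction A rule: finite_induct)
    case (insert a A)
    then have "a \<in> span S" "(\<Sum>v\<in>A. scale (u v) v) \<in> span S"
      using sb span_base by (auto intro!: span_sum span_scale)
    with insert show ?case by (simp add: add hom span_scale)
  qed (simp add: T0)
  have inj: "inj_on T b"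
  proof (rule inj_onI)
    fix v w assume vw: "v \<in> b" "w \<in> b" "T v = T w"
    then have "v \<in> span S" "w \<in> span S" using sb span_base by auto
    then have "T (v + scale (-1) w) = T v + scale (-1) (T w)" by (simp only: add hom span_scale)
    then have "T (v + scale (-1) w) = 0" using vw(3) by simp
    then have "v + scale (-1) w = 0"
      using ker \<open>v \<in> span S\<close> \<open>w \<in> span S\<close> by (metis span_add span_scale)
    then show "v = w" by simp
  qed
  have ind: "independent (T ` b)"
  proof
    assume "dependent (T ` b)"
    then obtain u where u: "\<exists>v\<in>T ` b. u v \<noteq> 0" "(\<Sum>v\<in>T ` b. scale (u v) v) = 0"
      using dependent_finite[of "T ` b"] fb by auto
    have "T (\<Sum>v\<in>b. scale (u (T v)) v) = 0"
      using u(2) by (simp add: lin[OF fb] sum.reindex[OF inj])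
    moreover have "(\<Sum>v\<in>b. scale (u (T v)) v) \<in> span S"
      using sb span_base by (auto intro!: span_sum span_scale)
    ultimately have "(\<Sum>v\<in>b. scale (u (T v)) v) = 0" using ker by blast
    moreover have "\<exists>v\<in>b. u (T v) \<noteq> 0" using u(1) by blast
    ultimately have "dependent b"
      unfolding dependent_finite[OF fb] by (intro exI[of _ "\<lambda>v. u (T v)"] conjI)
    with b(2) show False by blast
  qed
  have Tb: "T ` b \<subseteq> span b" using T sb span_base by blast
  have "y \<in> span (T ` b)"
  proof (rule ccontr)
    assume ny: "y \<notin> span (T ` b)"
    then have "y \<notin> T ` b" using span_base by blast
    have "independent (insert y (T ` b))" using ind ny by (rule independent_insertI[rotated])
    moreover have "insert y (T ` b) \<subseteq> span b" using Tb y sb by blast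
    ultimately have "card (insert y (T ` b)) \<le> card b" using independent_span_bound[OF fb] by blast
    moreover have "card (insert y (T ` b)) = Suc (card b)"
      using fb \<open>y \<notin> T ` b\<close> by (simp add: card_image[OF inj])
    ultimately show False by simp
  qed
  then obtain u where "y = (\<Sum>v\<in>T ` b. scale (u v) v)"
    using span_finite[of "T ` b"] fb by auto
  then have "y = T (\<Sum>v\<in>b. scale (u (T v)) v)" by (simp add: lin[OF fb] sum.reindex[OF inj])
  moreover have "(\<Sum>v\<in>b. scale (u (T v)) v) \<in> span S"
    using sb span_base by (auto intro!: span_sum span_scale)
  ultimately show ?thesis by blast
qed

interpretation function_space: vector_space "\<lambda>(c::real) (f::'a \<Rightarrow> real). (\<lambda>x. c * f x)"
  by unfold_locales (simp_all add: fun_eq_iff algebra_simps)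

primrec monomials :: "nat \<Rightarrow> (real^'n \<Rightarrow> real) set" where
  "monomials 0 = {\<lambda>x. 1}"
| "monomials (Suc k) = insert (\<lambda>x. 1) (\<Union>i. (\<lambda>m x. x $ i * m x) ` monomials k)"

text \<open>The polynomial functions of degree at most \<open>k\<close>.\<close>

definition polys :: "nat \<Rightarrow> (real^'n \<Rightarrow> real) set" where
  "polys k = function_space.span (monomials k)"

lemma finite_monomials: "finite (monomials k)"
  by (induction k) auto

lemma monomials_Suc: "(monomials k :: (real^'n \<Rightarrow> real) set) \<subseteq> monomials (Suc k)"
proof (induction k)
  case (Suc k)
  have "insert (\<lambda>x. 1) (\<Union>i. (\<lambda>m x. x $ i * m x) ` (monomials k :: (real^'n \<Rightarrow> real) set))
      \<subseteq> insert (\<lambda>x. 1) (\<Union>i. (\<lambda>m x. x $ i * m x) ` monomials (Suc k))"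
    by (intro insert_mono UN_mono image_mono Suc subset_refl)
  then show ?case by (simp only: monomials.simps(2)[symmetric])
qed simp

lemma polys_monomial: "m \<in> monomials k \<Longrightarrow> m \<in> polys k"
  unfolding polys_def by (rule function_space.span_base)

lemma polys_add: "f \<in> polys k \<Longrightarrow> g \<in> polys k \<Longrightarrow> (\<lambda>x. f x + g x) \<in> polys k"
  unfolding polys_def using function_space.span_add[of f _ g] by (simp add: plus_fun_def)

lemma polys_cmult: "f \<in> polys k \<Longrightarrow> (\<lambda>x. c * f x) \<in> polys k"
  unfolding polys_def by (rule function_space.span_scale)

lemma polys_const: "(\<lambda>x. c) \<in> polys k"
proof -
  have "(\<lambda>x. 1) \<in> polys k" by (rule polys_monomial) (cases k; simp)
  from polys_cmult[OF this, of c] show ?thesis by simp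
qed

lemma polys_sum: "(\<And>i. i \<in> I \<Longrightarrow> f i \<in> polys k) \<Longrightarrow> (\<lambda>x. \<Sum>i\<in>I. f i x) \<in> polys k"
  by (induction I rule: infinite_finite_induct) (simp_all add: polys_const polys_add)

lemma polys_Suc: "f \<in> polys k \<Longrightarrow> f \<in> polys (Suc k)"
  unfolding polys_def using function_space.span_mono[OF monomials_Suc] by blast

lemma polys_mono:
  assumes "f \<in> polys k" "k \<le> l"
  shows "f \<in> polys l"
  using assms(2) by (induction rule: dec_induct) (simp_all add: assms(1) polys_Suc)

lemma polys_induct [consumes 1, case_names monomial zero add cmult]:
  assumes "f \<in> polys k" "\<And>m. m \<in> monomials k \<Longrightarrow> P m"
    and "P (\<lambda>x. 0)" "\<And>f g. P f \<Longrightarrow> P g \<Longrightarrow> P (\<lambda>x. f x + g x)" "\<And>c f. P f \<Longrightarrow> P (\<lambda>x. c * f x)"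
  shows "P f"
proof (rule function_space.span_induct[OF assms(1)[unfolded polys_def]])
  show "function_space.subspace (Collect P)"
    using assms(3-5) by (auto simp: function_space.subspace_def zero_fun_def plus_fun_def)
qed (use assms(2) in simp)

lemma polys_coord_mult: "f \<in> polys k \<Longrightarrow> (\<lambda>x. x $ i * f x) \<in> polys (Suc k)"
proof (induction rule: polys_induct)
  case (monomial m)
  then show ?case by (intro polys_monomial) auto
next
  case (add f g)
  from polys_add[OF add] show ?case by (simp add: distrib_left)
next
  case (cmult c f)
  from polys_cmult[OF cmult, of c] show ?case by (simp add: mult_ac)
qed (simp add: polys_const)

lemma polys_coord: "(\<lambda>x. x $ i) \<in> polys (Suc k)"
  using polys_coord_mult[OF polys_const[of 1 k], of i] by simp

lemma polys_mult:
  assumes "f \<in> polys k" "g \<in> polys l"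
  shows "(\<lambda>x. f x * g x) \<in> polys (k + l)"
  using assms(1)
proof (induction rule: polys_induct)
  case (monomial m)
  then show ?case
  proof (induction k arbitrary: m)
    case 0
    then show ?case using assms(2) by simp
  next
    case (Suc k)
    show ?case
    proof (cases "m = (\<lambda>x. 1)")
      case True
      then show ?thesis using polys_mono[OF assms(2), of "Suc k + l"] by simp
    next
      case False
      then obtain i m' where m: "m' \<in> monomials k" "m = (\<lambda>x. x $ i * m' x)" using Suc.prems by auto
      from polys_coord_mult[OF Suc.IH[OF m(1)], of i] show ?thesis by (simp add: m(2) mult_ac)
    qed
  qed
next
  case (add f g)
  from polys_add[OF add] show ?case by (simp add: distrib_right)
next
  case (cmult c f)
  from polys_cmult[OF cmult, of c] show ?case by (simp add: mult_ac)
qed (simp add: polys_const)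

text \<open>On rays, questions about polynomials reduce to one variable, where a polynomial with infinitely many zeros
  vanishes.\<close>

lemma polys_along_ray: "f \<in> polys k \<Longrightarrow> \<exists>q. \<forall>t. f (t *\<^sub>R x) = poly q t"
proof (induction rule: polys_induct)
  case (monomial m)
  then show ?case
  proof (induction k arbitrary: m)
    case 0
    then show ?case by (intro exI[of _ 1]) simp
  next
    case (Suc k)
    show ?case
    proof (cases "m = (\<lambda>x. 1)")
      case True
      then show ?thesis by (intro exI[of _ 1]) simp
    next
      case False
      then obtain i m' where m: "m' \<in> monomials k" "m = (\<lambda>x. x $ i * m' x)" using Suc.prems by auto
      obtain q where "\<forall>t. m' (t *\<^sub>R x) = poly q t" using Suc.IH[OF m(1)] by blast
      then show ?thesis by (intro exI[of _ "[:0, x $ i:] * q"]) (simp add: m(2))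
    qed
  qed
next
  case zero
  show ?case by (intro exI[of _ 0]) simp
next
  case (add f g)
  then obtain q r where "\<forall>t. f (t *\<^sub>R x) = poly q t" "\<forall>t. g (t *\<^sub>R x) = poly r t" by blast
  then show ?case by (intro exI[of _ "q + r"]) simp
next
  case (cmult c f)
  then obtain q where "\<forall>t. f (t *\<^sub>R x) = poly q t" by blast
  then show ?case by (intro exI[of _ "smult c q"]) simp
qed

lemma GDERIV_coord: "GDERIV (\<lambda>x. x $ i) x :> axis i (1::real)"
  unfolding gderiv_def by (simp add: inner_axis bounded_linear_imp_has_derivative bounded_linear_vec_nth)

lemma polys_gradient:
  "f \<in> polys (Suc k) \<Longrightarrow> \<exists>g. (\<forall>x. GDERIV f x :> g x) \<and> (\<forall>i. (\<lambda>x. g x $ i) \<in> polys k)"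
proof (induction rule: polys_induct)
  case (monomial m)
  then show ?case
  proof (induction k arbitrary: m)
    case 0
    show ?case
    proof (cases "m = (\<lambda>x. 1)")
      case True
      then show ?thesis
        by (intro exI[of _ "\<lambda>x. 0"] conjI allI) (simp_all add: polys_const GDERIV_const)
    next
      case False
      then obtain i where "m = (\<lambda>x. x $ i)" using 0 by auto
      then show ?thesis using GDERIV_coord[of i]
        by (intro exI[of _ "\<lambda>x. axis i 1"]) (simp add: polys_const)
    qed
  next
    case (Suc k)
    show ?case
    proof (cases "m = (\<lambda>x. 1)")
      case True
      then show ?thesis
        by (intro exI[of _ "\<lambda>x. 0"] conjI allI) (simp_all add: polys_const GDERIV_const)
    next
      case False
      then obtain i m' where m: "m' \<in> monomials (Suc k)" "m = (\<lambda>x. x $ i * m' x)"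
        using Suc.prems by (auto simp del: monomials.simps simp add: monomials.simps(2)[of "Suc k"])
      obtain g where g: "\<And>x. GDERIV m' x :> g x" "\<And>j. (\<lambda>x. g x $ j) \<in> polys k"
        using Suc.IH[OF m(1)] by blast
      have "GDERIV m x :> x $ i *\<^sub>R g x + m' x *\<^sub>R axis i 1" for x
        unfolding m(2) by (rule GDERIV_mult[OF GDERIV_coord g(1)])
      moreover have "(\<lambda>x. (x $ i *\<^sub>R g x + m' x *\<^sub>R axis i 1) $ j) \<in> polys (Suc k)" for j
      proof -
        have "(\<lambda>x. x $ i * g x $ j + axis i 1 $ j * m' x) \<in> polys (Suc k)"
          by (intro polys_add polys_coord_mult polys_cmult g polys_monomial m)
        then show ?thesis by (simp add: mult_ac)
      qed
      ultimately show ?thesis by (intro exI[of _ "\<lambda>x. x $ i *\<^sub>R g x + m' x *\<^sub>R axis i 1"]) blast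
    qed
  qed
next
  case zero
  show ?case by (intro exI[of _ "\<lambda>x. 0"] conjI allI) (simp_all add: polys_const GDERIV_const)
next
  case (add f1 f2)
  then obtain g1 g2 where g: "\<And>x. GDERIV f1 x :> g1 x" "\<And>i. (\<lambda>x. g1 x $ i) \<in> polys k"
    "\<And>x. GDERIV f2 x :> g2 x" "\<And>i. (\<lambda>x. g2 x $ i) \<in> polys k" by blast
  then show ?case
    by (intro exI[of _ "\<lambda>x. g1 x + g2 x"]) (auto intro: GDERIV_add polys_add)
next
  case (cmult c f)
  then obtain g where g: "\<And>x. GDERIV f x :> g x" "\<And>i. (\<lambda>x. g x $ i) \<in> polys k" by blast
  have "GDERIV (\<lambda>x. c * f x) x :> c *\<^sub>R g x + f x *\<^sub>R 0" for x
    by (rule GDERIV_mult[OF GDERIV_const g(1)])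
  then show ?case using g(2)
    by (intro exI[of _ "\<lambda>x. c *\<^sub>R g x"]) (auto intro: polys_cmult)
qed

lemma polys_continuous_on: "f \<in> polys k \<Longrightarrow> continuous_on S f"
proof -
  assume "f \<in> polys k"
  then obtain g where "\<And>x. GDERIV f x :> g x" using polys_gradient[OF polys_Suc] by blast
  then show ?thesis unfolding gderiv_def
    by (meson continuous_at_imp_continuous_on has_derivative_continuous)
qed

lemma polys_C2:
  fixes f :: "real^'n \<Rightarrow> real"
  assumes f: "f \<in> polys (Suc (Suc k))"
  shows "\<exists>g H. C2_with UNIV f g H \<and> (\<forall>i j. (\<lambda>x. H x $ i $ j) \<in> polys k)"
proof -
  obtain g where g: "\<And>x. GDERIV f x :> g x" "\<And>i. (\<lambda>x. g x $ i) \<in> polys (Suc k)"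
    using polys_gradient[OF f] by blast
  have "\<forall>i. \<exists>h. (\<forall>x. GDERIV (\<lambda>x. g x $ i) x :> h x) \<and> (\<forall>j. (\<lambda>x. h x $ j) \<in> polys k)"
    using polys_gradient[OF g(2)] by blast
  then obtain h where h: "\<And>i x. GDERIV (\<lambda>x. g x $ i) x :> h i x" "\<And>i j. (\<lambda>x. h i x $ j) \<in> polys k"
    by metis
  define H where "H x = (\<chi> i. h i x)" for x
  have "(g has_derivative (*v) (H x)) (at x)" for x
    unfolding has_derivative_componentwise_within[of g]
  proof
    fix b :: "real^'n" assume "b \<in> Basis"
    then obtain i where i: "b = axis i 1" unfolding Basis_vec_def by auto
    have "(H x *v y) $ i = y \<bullet> h i x" for y
      by (simp add: matrix_vector_mult_def H_def inner_vec_def mult.commute)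
    then show "((\<lambda>y. g y \<bullet> b) has_derivative (\<lambda>y. (H x *v y) \<bullet> b)) (at x)"
      using h(1)[of i x] unfolding gderiv_def i by (simp add: inner_axis)
  qed
  moreover have H_eq: "H = (\<lambda>x. \<chi> i j. h i x $ j)" by (simp add: H_def fun_eq_iff vec_eq_iff)
  have "continuous_on UNIV H"
    unfolding H_eq by (intro continuous_on_vec_lambda polys_continuous_on[OF h(2)])
  ultimately have "C2_with UNIV f g H" using g(1) unfolding C2_with_def by simp
  moreover have "\<forall>i j. (\<lambda>x. H x $ i $ j) \<in> polys k" using h(2) by (simp add: H_def)
  ultimately show ?thesis by blast
qed

lemma polys_dense:
  fixes f :: "real^'n \<Rightarrow> real"
  assumes "compact S" "continuous_on S f" "0 < \<epsilon>"
  shows "\<exists>k. \<exists>q\<in>polys k. \<forall>x\<in>S. \<bar>f x - q x\<bar> < \<epsilon>"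
proof -
  interpret function_ring_on "\<Union>k. polys k :: (real^'n \<Rightarrow> real) set" S
  proof
    show "(\<lambda>x. f x + g x) \<in> (\<Union>k. polys k)" if fg: "f \<in> (\<Union>k. polys k)" "g \<in> (\<Union>k. polys k)"
      for f g :: "real^'n \<Rightarrow> real"
    proof -
      obtain k l where "f \<in> polys k" "g \<in> polys l" using fg by blast
      then have "(\<lambda>x. f x + g x) \<in> polys (k + l)"
        by (intro polys_add) (auto intro: polys_mono)
      then show ?thesis by blast
    qed
    show "(\<lambda>x. f x * g x) \<in> (\<Union>k. polys k)" if fg: "f \<in> (\<Union>k. polys k)" "g \<in> (\<Union>k. polys k)"
      for f g :: "real^'n \<Rightarrow> real"
      using fg polys_mult by blast
    show "\<exists>f\<in>\<Union>k. polys k. f x \<noteq> f y" if "x \<noteq> y" for x y :: "real^'n"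
    proof -
      obtain i where "x $ i \<noteq> y $ i" using \<open>x \<noteq> y\<close> by (auto simp: vec_eq_iff)
      then show ?thesis
        by (intro bexI[of _ "\<lambda>x. x $ i"] UN_I[of "Suc 0"] polys_coord) simp_all
    qed
    show "continuous_on S f" if "f \<in> (\<Union>k. polys k)" for f :: "real^'n \<Rightarrow> real"
      using that polys_continuous_on by blast
    show "(\<lambda>_. c) \<in> (\<Union>k. polys k :: (real^'n \<Rightarrow> real) set)" for c
      using polys_const[of c 0] by blast
  qed (rule assms(1))
  obtain q where "q \<in> (\<Union>k. polys k)" "\<forall>x\<in>S. \<bar>f x - q x\<bar> < \<epsilon>"
    using Stone_Weierstrass_basic[OF assms(2,3)] by blast
  then show ?thesis by blast
qed

section \<open>Second derivatives\<close>

lemma C2_withD: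
  assumes "C2_with U \<phi> g H" "x \<in> U"
  shows "(\<phi> has_derivative (\<lambda>h. h \<bullet> g x)) (at x)" "(g has_derivative (*v) (H x)) (at x)"
  using assms unfolding C2_with_def gderiv_def by simp_all

lemma C2_with_line_derivative:
  assumes "C2_with U \<phi> g H" "x + t *\<^sub>R v \<in> U"
  shows "((\<lambda>t. \<phi> (x + t *\<^sub>R v)) has_real_derivative v \<bullet> g (x + t *\<^sub>R v)) (at t)"
proof -
  have "((\<lambda>t. x + t *\<^sub>R v) has_derivative (\<lambda>s. s *\<^sub>R v)) (at t)"
    by (auto intro!: derivative_eq_intros)
  from has_derivative_compose[OF this C2_withD(1)[OF assms]]
  show ?thesis unfolding has_field_derivative_def
    by (rule has_derivative_eq_rhs) (simp add: fun_eq_iff)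
qed

lemma C2_with_gradient_line_derivative:
  assumes "C2_with U \<phi> g H" "x + t *\<^sub>R v \<in> U"
  shows "((\<lambda>t. a \<bullet> g (x + t *\<^sub>R v)) has_real_derivative a \<bullet> (H (x + t *\<^sub>R v) *v v)) (at t)"
proof -
  have "((\<lambda>t. x + t *\<^sub>R v) has_derivative (\<lambda>s. s *\<^sub>R v)) (at t)"
    by (auto intro!: derivative_eq_intros)
  from has_derivative_compose[OF this C2_withD(2)[OF assms]]
  have "((\<lambda>t. g (x + t *\<^sub>R v)) has_derivative (\<lambda>s. H (x + t *\<^sub>R v) *v (s *\<^sub>R v))) (at t)" .
  from has_derivative_inner_right[OF this, of a] show ?thesis
    unfolding has_field_derivative_def
    by (rule has_derivative_eq_rhs) (simp add: fun_eq_iff matrix_vector_mult_scaleR)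
qed

text \<open>Two applications of the mean value theorem, first in direction \<open>a\<close> and then in direction \<open>b\<close>, and
  continuity of \<open>H\<close>.\<close>

lemma second_difference_quotient:
  fixes x a b :: "real^'n"
  assumes C2: "C2_with U \<phi> g H" and U: "open U" "x \<in> U" and \<epsilon>: "0 < \<epsilon>"
  shows "\<exists>d>0. \<forall>s. 0 < s \<and> s < d \<longrightarrow>
    \<bar>\<phi> (x + s *\<^sub>R a + s *\<^sub>R b) - \<phi> (x + s *\<^sub>R a) - \<phi> (x + s *\<^sub>R b) + \<phi> x
       - s\<^sup>2 * (a \<bullet> (H x *v b))\<bar> \<le> \<epsilon> * s\<^sup>2"
proof -
  have "continuous_on U (\<lambda>y. a \<bullet> (H y *v b))"
    using C2 unfolding C2_with_def matrix_vector_mult_def by (intro continuous_intros) auto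
  then have "isCont (\<lambda>y. a \<bullet> (H y *v b)) x" using U by (simp add: continuous_on_eq_continuous_at)
  then obtain d1 where d1: "d1 > 0" "\<And>y. dist y x < d1 \<Longrightarrow> dist (a \<bullet> (H y *v b)) (a \<bullet> (H x *v b)) < \<epsilon>"
    unfolding continuous_at_eps_delta using \<epsilon> by blast
  obtain d2 where d2: "d2 > 0" "ball x d2 \<subseteq> U" using U open_contains_ball by blast
  define N where "N = norm a + norm b + 1"
  have "N > 0" unfolding N_def by (smt (verit) norm_ge_zero)
  define d where "d = min d1 d2 / N"
  have "d > 0" using d1 d2 \<open>N > 0\<close> unfolding d_def by simp
  have near: "dist (x + \<xi> *\<^sub>R a + \<eta> *\<^sub>R b) x < min d1 d2"
    if "0 \<le> \<xi>" "\<xi> \<le> s" "0 \<le> \<eta>" "\<eta> \<le> s" "0 < s" "s < d" for \<xi> \<eta> s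
  proof -
    have "dist (x + \<xi> *\<^sub>R a + \<eta> *\<^sub>R b) x = norm (\<xi> *\<^sub>R a + \<eta> *\<^sub>R b)" by (simp add: dist_norm add.assoc)
    also have "\<dots> \<le> \<xi> * norm a + \<eta> * norm b"
      using norm_triangle_ineq[of "\<xi> *\<^sub>R a" "\<eta> *\<^sub>R b"] that by simp
    also have "\<dots> \<le> s * norm a + s * norm b" using that by (intro add_mono mult_right_mono) auto
    also have "\<dots> < s * N" using that unfolding N_def by (simp add: algebra_simps)
    also have "\<dots> < d * N" using that \<open>N > 0\<close> by simp
    also have "\<dots> = min d1 d2" using \<open>N > 0\<close> unfolding d_def by simp
    finally show ?thesis .
  qed
  have inU: "x + \<xi> *\<^sub>R a + \<eta> *\<^sub>R b \<in> U"
    if "0 \<le> \<xi>" "\<xi> \<le> s" "0 \<le> \<eta>" "\<eta> \<le> s" "0 < s" "s < d" for \<xi> \<eta> s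
    using near[OF that] d2 by (auto simp: dist_commute subset_eq)
  have main: "\<bar>\<phi> (x + s *\<^sub>R a + s *\<^sub>R b) - \<phi> (x + s *\<^sub>R a) - \<phi> (x + s *\<^sub>R b) + \<phi> x
       - s\<^sup>2 * (a \<bullet> (H x *v b))\<bar> \<le> \<epsilon> * s\<^sup>2" if s: "0 < s" "s < d" for s
  proof -
    define \<psi> where "\<psi> t = \<phi> ((x + s *\<^sub>R b) + t *\<^sub>R a) - \<phi> (x + t *\<^sub>R a)" for t
    have d\<psi>: "(\<psi> has_real_derivative a \<bullet> g ((x + s *\<^sub>R b) + t *\<^sub>R a) - a \<bullet> g (x + t *\<^sub>R a)) (at t)"
      if "0 \<le> t" "t \<le> s" for t
      unfolding \<psi>_def
      by (intro DERIV_diff C2_with_line_derivative[OF C2])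
        (use inU[of t s s] inU[of t s 0] that s in \<open>simp_all add: add_ac\<close>)
    have "\<exists>\<xi>>0. \<xi> < s \<and>
      \<psi> s - \<psi> 0 = (s - 0) * (a \<bullet> g ((x + s *\<^sub>R b) + \<xi> *\<^sub>R a) - a \<bullet> g (x + \<xi> *\<^sub>R a))"
      by (rule MVT2[OF s(1)], rule d\<psi>)
    then obtain \<xi> where \<xi>: "0 < \<xi>" "\<xi> < s"
      "\<psi> s - \<psi> 0 = (s - 0) * (a \<bullet> g ((x + s *\<^sub>R b) + \<xi> *\<^sub>R a) - a \<bullet> g (x + \<xi> *\<^sub>R a))"
      by (elim exE conjE)
    have dg: "((\<lambda>t. a \<bullet> g ((x + \<xi> *\<^sub>R a) + t *\<^sub>R b)) has_real_derivative
        a \<bullet> (H ((x + \<xi> *\<^sub>R a) + t *\<^sub>R b) *v b)) (at t)" if "0 \<le> t" "t \<le> s" for t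
      by (intro C2_with_gradient_line_derivative[OF C2]) (use inU[of \<xi> s t] that s \<xi> in simp)
    have "\<exists>\<eta>>0. \<eta> < s \<and>
      a \<bullet> g ((x + \<xi> *\<^sub>R a) + s *\<^sub>R b) - a \<bullet> g ((x + \<xi> *\<^sub>R a) + 0 *\<^sub>R b)
        = (s - 0) * (a \<bullet> (H ((x + \<xi> *\<^sub>R a) + \<eta> *\<^sub>R b) *v b))"
      by (rule MVT2[OF s(1)], rule dg)
    then obtain \<eta> where \<eta>: "0 < \<eta>" "\<eta> < s"
      "a \<bullet> g ((x + \<xi> *\<^sub>R a) + s *\<^sub>R b) - a \<bullet> g ((x + \<xi> *\<^sub>R a) + 0 *\<^sub>R b)
        = (s - 0) * (a \<bullet> (H ((x + \<xi> *\<^sub>R a) + \<eta> *\<^sub>R b) *v b))"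
      by (elim exE conjE)
    have "\<psi> s - \<psi> 0 = s * (a \<bullet> g ((x + \<xi> *\<^sub>R a) + s *\<^sub>R b) - a \<bullet> g ((x + \<xi> *\<^sub>R a) + 0 *\<^sub>R b))"
      unfolding \<xi>(3) by (simp add: add_ac)
    also have "\<dots> = s * (s * (a \<bullet> (H (x + \<xi> *\<^sub>R a + \<eta> *\<^sub>R b) *v b)))" unfolding \<eta>(3) by simp
    finally have eq: "\<psi> s - \<psi> 0 = s\<^sup>2 * (a \<bullet> (H (x + \<xi> *\<^sub>R a + \<eta> *\<^sub>R b) *v b))"
      by (simp add: power2_eq_square)
    have "\<bar>a \<bullet> (H (x + \<xi> *\<^sub>R a + \<eta> *\<^sub>R b) *v b) - a \<bullet> (H x *v b)\<bar> \<le> \<epsilon>"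
      using d1(2)[of "x + \<xi> *\<^sub>R a + \<eta> *\<^sub>R b"] near[of \<xi> s \<eta>] \<xi> \<eta> s by (simp add: dist_real_def)
    then have "\<bar>s\<^sup>2 * (a \<bullet> (H (x + \<xi> *\<^sub>R a + \<eta> *\<^sub>R b) *v b) - a \<bullet> (H x *v b))\<bar> \<le> s\<^sup>2 * \<epsilon>"
      unfolding abs_mult by (intro mult_mono) auto
    moreover have "\<psi> s - \<psi> 0 = \<phi> (x + s *\<^sub>R a + s *\<^sub>R b) - \<phi> (x + s *\<^sub>R a) - \<phi> (x + s *\<^sub>R b) + \<phi> x"
      unfolding \<psi>_def by (simp add: add_ac)
    ultimately show ?thesis using eq by (simp add: right_diff_distrib mult.commute)
  qed
  show ?thesis using \<open>d > 0\<close> main by blast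
qed

text \<open>The second difference in directions \<open>a\<close> and \<open>b\<close> is symmetric in \<open>a\<close> and \<open>b\<close>.\<close>

lemma C2_with_symmetric:
  assumes C2: "C2_with U \<phi> g H" and U: "open U" "x \<in> U"
  shows "H x \<in> Sym2"
proof -
  have "a \<bullet> (H x *v b) = b \<bullet> (H x *v a)" for a b
  proof -
    have "\<bar>a \<bullet> (H x *v b) - b \<bullet> (H x *v a)\<bar> \<le> 0 + \<epsilon>" if "\<epsilon> > 0" for \<epsilon>
    proof -
      have "0 < \<epsilon> / 2" using that by simp
      define D where "D a b s = \<phi> (x + s *\<^sub>R a + s *\<^sub>R b) - \<phi> (x + s *\<^sub>R a) - \<phi> (x + s *\<^sub>R b) + \<phi> x" for a b s
      have q: "\<exists>d>0. \<forall>s. 0 < s \<and> s < d \<longrightarrow> \<bar>D a b s - s\<^sup>2 * (a \<bullet> (H x *v b))\<bar> \<le> \<epsilon> / 2 * s\<^sup>2" for a b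
        unfolding D_def by (rule second_difference_quotient[OF C2 U \<open>0 < \<epsilon> / 2\<close>])
      obtain d where d: "d > 0" "\<forall>s. 0 < s \<and> s < d \<longrightarrow> \<bar>D a b s - s\<^sup>2 * (a \<bullet> (H x *v b))\<bar> \<le> \<epsilon> / 2 * s\<^sup>2"
        using q[of a b] by blast
      obtain d' where d': "d' > 0" "\<forall>s. 0 < s \<and> s < d' \<longrightarrow> \<bar>D b a s - s\<^sup>2 * (b \<bullet> (H x *v a))\<bar> \<le> \<epsilon> / 2 * s\<^sup>2"
        using q[of b a] by blast
      define s where "s = min d d' / 2"
      have s: "0 < s" "s < d" "s < d'" using d(1) d'(1) unfolding s_def by auto
      have "D b a s = D a b s" unfolding D_def by (simp add: add_ac)
      moreover have "\<bar>D a b s - s\<^sup>2 * (a \<bullet> (H x *v b))\<bar> \<le> \<epsilon> / 2 * s\<^sup>2" using d(2) s by blast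
      moreover have "\<bar>D b a s - s\<^sup>2 * (b \<bullet> (H x *v a))\<bar> \<le> \<epsilon> / 2 * s\<^sup>2" using d'(2) s by blast
      ultimately have "\<bar>s\<^sup>2 * (a \<bullet> (H x *v b)) - s\<^sup>2 * (b \<bullet> (H x *v a))\<bar> \<le> \<epsilon> * s\<^sup>2"
        by linarith
      then have "\<bar>a \<bullet> (H x *v b) - b \<bullet> (H x *v a)\<bar> * s\<^sup>2 \<le> \<epsilon> * s\<^sup>2"
        by (simp add: abs_mult right_diff_distrib[symmetric] mult.commute)
      then show ?thesis using s by simp
    qed
    then have "\<bar>a \<bullet> (H x *v b) - b \<bullet> (H x *v a)\<bar> \<le> 0" by (rule field_le_epsilon)
    then show ?thesis by simp
  qed
  from this[of "axis _ 1" "axis _ 1"] have "H x $ i $ j = H x $ j $ i" for i j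
    by (simp add: inner_axis' matrix_vector_mult_basis column_def)
  then show ?thesis unfolding Sym2_def by (simp add: transpose_def vec_eq_iff)
qed

lemma local_max_second_derivative:
  assumes C2: "C2_with U \<phi> g H" and U: "open U" "x \<in> U" and mx: "\<And>y. y \<in> U \<Longrightarrow> \<phi> y \<le> \<phi> x"
  shows "v \<bullet> (H x *v v) \<le> 0"
proof (rule ccontr)
  assume neg: "\<not> ?thesis"
  then have v: "norm v > 0" by auto
  obtain r where r: "r > 0" "ball x r \<subseteq> U" using U open_contains_ball by blast
  define \<epsilon> where "\<epsilon> = r / norm v"
  have \<epsilon>: "\<epsilon> > 0" using r v unfolding \<epsilon>_def by simp
  have inU: "x + t *\<^sub>R v \<in> U" if "\<bar>t\<bar> < \<epsilon>" for t
  proof -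
    have "norm (t *\<^sub>R v) < r" using that v unfolding \<epsilon>_def by (simp add: pos_less_divide_eq)
    then have "x + t *\<^sub>R v \<in> ball x r" by (simp add: dist_norm)
    with r show ?thesis by blast
  qed
  have d: "((\<lambda>t. \<phi> (x + t *\<^sub>R v)) has_real_derivative v \<bullet> g (x + t *\<^sub>R v)) (at t)" if "\<bar>t\<bar> < \<epsilon>" for t
    by (rule C2_with_line_derivative[OF C2 inU[OF that]])
  have zero: "v \<bullet> g (x + 0 *\<^sub>R v) = 0"
    by (rule DERIV_local_max[OF d \<epsilon>]) (use inU mx \<epsilon> in auto)
  obtain \<delta> where \<delta>: "\<delta> > 0" "\<And>h. 0 < h \<Longrightarrow> h < \<delta> \<Longrightarrow> v \<bullet> g (x + 0 *\<^sub>R v) < v \<bullet> g (x + (0 + h) *\<^sub>R v)"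
    using DERIV_pos_inc_right[OF C2_with_gradient_line_derivative[OF C2, of x 0 v v]] neg U by auto
  define h where "h = min \<delta> \<epsilon> / 2"
  have h: "0 < h" "h < \<delta>" "h < \<epsilon>" using \<delta> \<epsilon> unfolding h_def by auto
  have dh: "((\<lambda>t. \<phi> (x + t *\<^sub>R v)) has_real_derivative v \<bullet> g (x + t *\<^sub>R v)) (at t)" if "0 \<le> t" "t \<le> h" for t
    using d[of t] that h by simp
  have "\<exists>z>0. z < h \<and> \<phi> (x + h *\<^sub>R v) - \<phi> (x + 0 *\<^sub>R v) = (h - 0) * (v \<bullet> g (x + z *\<^sub>R v))"
    by (rule MVT2[OF h(1)], rule dh)
  then obtain z where z: "0 < z" "z < h" "\<phi> (x + h *\<^sub>R v) - \<phi> (x + 0 *\<^sub>R v) = (h - 0) * (v \<bullet> g (x + z *\<^sub>R v))"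
    by (elim exE conjE)
  have "0 < v \<bullet> g (x + z *\<^sub>R v)" using \<delta>(2)[of z] z h zero by simp
  then have "\<phi> x < \<phi> (x + h *\<^sub>R v)" using z h by (smt (verit) mult_pos_pos scale_zero_left add_0_right)
  with mx[OF inU[of h]] h show False by simp
qed

lemma C2_with_affine:
  fixes R :: "real^'n^'n"
  assumes C2: "C2_with U \<phi> g H"
  shows "C2_with {x. R *v x + c \<in> U} (\<lambda>x. \<phi> (R *v x + c)) (\<lambda>x. transpose R *v g (R *v x + c))
     (\<lambda>x. transpose R ** H (R *v x + c) ** R)"
  unfolding C2_with_def
proof (intro conjI ballI)
  fix x assume "x \<in> {x. R *v x + c \<in> U}"
  then have x: "R *v x + c \<in> U" by simp
  have aff: "((\<lambda>x. R *v x + c) has_derivative (*v) R) (at x)"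
    using has_derivative_add[OF bounded_linear_imp_has_derivative[OF matrix_vector_mul_bounded_linear[of R]] has_derivative_const[of c]]
    by simp
  have "h \<bullet> (transpose R *v y) = (R *v h) \<bullet> y" for h y
    by (metis dot_lmul_matrix inner_commute transpose_matrix_vector transpose_transpose)
  then show "GDERIV (\<lambda>x. \<phi> (R *v x + c)) x :> transpose R *v g (R *v x + c)"
    using has_derivative_compose[OF aff C2_withD(1)[OF C2 x]] unfolding gderiv_def by simp
  have "((\<lambda>x. g (R *v x + c)) has_derivative (\<lambda>h. H (R *v x + c) *v (R *v h))) (at x)"
    by (rule has_derivative_compose[OF aff C2_withD(2)[OF C2 x]])
  from bounded_linear.has_derivative[OF matrix_vector_mul_bounded_linear[of "transpose R"] this]
  show "((\<lambda>x. transpose R *v g (R *v x + c)) has_derivative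
      (\<lambda>h. (transpose R ** H (R *v x + c) ** R) *v h)) (at x)"
    by (simp only: matrix_vector_mul_assoc matrix_mul_assoc)
next
  have cH: "continuous_on U H" using C2 unfolding C2_with_def by blast
  have aff: "continuous_on {x. R *v x + c \<in> U} (\<lambda>x. R *v x + c)"
    by (intro continuous_on_add matrix_vector_mult_linear_continuous_on continuous_on_const)
  have "continuous_on {x. R *v x + c \<in> U} (\<lambda>x. H (R *v x + c))"
    by (rule continuous_on_compose2[OF cH aff]) auto
  then show "continuous_on {x. R *v x + c \<in> U} (\<lambda>x. transpose R ** H (R *v x + c) ** R)"
    unfolding matrix_matrix_mult_def by (intro continuous_intros)
qed

section \<open>The Dirichlet problem for constant coefficient operators\<close>

text \<open>These are the matrices for which \<open>\<phi> \<mapsto> B \<bullet> D\<^sup>2\<phi>\<close> is elliptic, possibly degenerate, and nonzero.\<close>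

definition positive_weight :: "real^'n^'n \<Rightarrow> bool" where
  "positive_weight B \<longleftrightarrow> B \<in> Sym2 \<and> (\<forall>P\<in>PSD. 0 \<le> B \<bullet> P) \<and> 0 < B \<bullet> mat 1"

lemma inner_transpose: "transpose A \<bullet> transpose B = A \<bullet> (B :: real^'n^'n)"
  unfolding inner_vec_def transpose_def by (simp, subst sum.swap, simp)

lemma transpose_add: "transpose (A + B) = transpose A + transpose (B :: real^'n^'n)"
  by (simp add: transpose_def vec_eq_iff)

text \<open>Since \<open>B\<close> is symmetric, \<open>A\<close> may be replaced by its symmetric part.\<close>

lemma positive_weight_nonpos:
  assumes B: "positive_weight B" and A: "\<And>v. v \<bullet> (A *v v) \<le> 0"
  shows "B \<bullet> A \<le> 0"
proof -
  define P where "P = (-1) *\<^sub>R (A + transpose A)"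
  have "transpose P = P" unfolding P_def by (simp add: transpose_scalar transpose_add transpose_def vec_eq_iff)
  moreover have "0 \<le> v \<bullet> (P *v v)" for v
  proof -
    have "v \<bullet> (transpose A *v v) = v \<bullet> (A *v v)"
      by (metis dot_lmul_matrix inner_commute transpose_matrix_vector)
    moreover have "v \<bullet> (P *v v) = (-1) * (v \<bullet> (A *v v) + v \<bullet> (transpose A *v v))"
      unfolding P_def by (simp only: scaleR_matrix_vector_assoc[symmetric]
          matrix_vector_mult_add_rdistrib inner_right_distrib inner_scaleR_right)
    ultimately have "v \<bullet> (P *v v) = - (2 * (v \<bullet> (A *v v)))"
      by (simp only: mult_minus1 mult_2)
    then show ?thesis using A[of v] by simp
  qed
  ultimately have "0 \<le> B \<bullet> P" using B unfolding positive_weight_def PSD_def Sym2_def by blast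
  moreover have "B \<bullet> transpose A = B \<bullet> A"
    using inner_transpose[of B A] B unfolding positive_weight_def Sym2_def by simp
  ultimately show ?thesis unfolding P_def by (simp add: inner_right_distrib inner_diff_right)
qed

lemma C2_with_norm_square: "C2_with UNIV (\<lambda>x::real^'n. (norm (x - c))\<^sup>2) (\<lambda>x. 2 *\<^sub>R (x - c)) (\<lambda>x. 2 *\<^sub>R mat 1)"
  using C2_with_radial[of UNIV "\<lambda>s. s" "\<lambda>s. 1" "\<lambda>s. 0" UNIV c] by simp

text \<open>Adding \<open>\<delta> |x|\<^sup>2\<close> makes the inequality strict even where the operator is degenerate, because
  \<open>B \<bullet> I > 0\<close>.\<close>

lemma weighted_maximum_principle:
  fixes h :: "real^'n \<Rightarrow> real"
  assumes B: "positive_weight B" and \<rho>: "0 < \<rho>" and C2: "C2_with UNIV h g H"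
    and sub: "\<And>x. x \<in> ball 0 \<rho> \<Longrightarrow> 0 \<le> B \<bullet> H x" and bd: "\<And>x. x \<in> sphere 0 \<rho> \<Longrightarrow> h x \<le> 0"
    and x: "x \<in> ball 0 \<rho>"
  shows "h x \<le> 0"
proof (rule ccontr)
  assume neg: "\<not> h x \<le> 0"
  define \<delta> where "\<delta> = h x / (2 * \<rho>\<^sup>2)"
  have \<delta>: "\<delta> > 0" using neg \<rho> unfolding \<delta>_def by simp
  define k where "k y = h y + \<delta> * (norm (y - 0))\<^sup>2" for y
  have C2k: "C2_with UNIV k (\<lambda>y. g y + \<delta> *\<^sub>R (2 *\<^sub>R (y - 0))) (\<lambda>y. H y + \<delta> *\<^sub>R (2 *\<^sub>R mat 1))"
    unfolding k_def[abs_def] by (intro C2_with_add C2 C2_with_cmult C2_with_norm_square)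
  have "continuous_on (cball 0 \<rho>) k" using C2_with_continuous_on[OF C2k] continuous_on_subset by blast
  then obtain z where z: "z \<in> cball 0 \<rho>" "\<And>y. y \<in> cball 0 \<rho> \<Longrightarrow> k y \<le> k z"
    using continuous_attains_sup[of "cball 0 \<rho>" k] \<rho> by auto
  have "\<delta> * \<rho>\<^sup>2 = h x / 2" using \<rho> unfolding \<delta>_def by (simp add: field_simps)
  moreover have "h x \<le> k x" unfolding k_def using \<delta> by simp
  moreover have "k x \<le> k z" using z(2) x by simp
  ultimately have "\<delta> * \<rho>\<^sup>2 < k z" using neg by simp
  have "z \<notin> sphere 0 \<rho>"
  proof
    assume "z \<in> sphere 0 \<rho>"
    then have "k z \<le> \<delta> * \<rho>\<^sup>2" using bd unfolding k_def by simp
    with \<open>\<delta> * \<rho>\<^sup>2 < k z\<close> show False by simp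
  qed
  then have zb: "z \<in> ball 0 \<rho>" using z(1) by auto
  have "v \<bullet> ((H z + \<delta> *\<^sub>R (2 *\<^sub>R mat 1)) *v v) \<le> 0" for v
    by (rule local_max_second_derivative[OF C2_with_subset[OF C2k, of "ball 0 \<rho>"]]) (use zb z in auto)
  from positive_weight_nonpos[OF B this]
  have "B \<bullet> H z + 2 * \<delta> * (B \<bullet> mat 1) \<le> 0" by (simp add: inner_right_distrib)
  moreover have "0 < 2 * \<delta> * (B \<bullet> mat 1)" using B \<delta> unfolding positive_weight_def by simp
  ultimately show False using sub[OF zb] by simp
qed

lemma C2_with_unique:
  assumes "C2_with UNIV \<phi> g H" "C2_with UNIV \<phi> g' H'"
  shows "H = H'"
proof -
  have "g x = g' x" for x
  proof -
    have "(\<lambda>h. h \<bullet> g x) = (\<lambda>h. h \<bullet> g' x)"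
      using has_derivative_unique C2_withD(1)[OF assms(1)] C2_withD(1)[OF assms(2)] by blast
    then have "(g x - g' x) \<bullet> g x = (g x - g' x) \<bullet> g' x" by metis
    then have "(g x - g' x) \<bullet> (g x - g' x) = 0" by (simp add: inner_diff_right)
    then show ?thesis by simp
  qed
  then have "g = g'" by blast
  have "H x = H' x" for x
  proof -
    have "(*v) (H x) = (*v) (H' x)"
      using has_derivative_unique C2_withD(2)[OF assms(1)] C2_withD(2)[OF assms(2)] \<open>g = g'\<close> by blast
    then show ?thesis by (simp add: matrix_eq)
  qed
  then show ?thesis by blast
qed

text \<open>The Hessian if \<open>\<phi>\<close> is of class \<open>C\<^sup>2\<close>, and an arbitrary matrix otherwise; as a function of \<open>\<phi>\<close> it allows
  differential operators to be written as maps between function spaces.\<close>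

definition hessian :: "(real^'n \<Rightarrow> real) \<Rightarrow> real^'n \<Rightarrow> real^'n^'n" where
  "hessian \<phi> = (SOME H. \<exists>g. C2_with UNIV \<phi> g H)"

lemma hessian_eq: "C2_with UNIV \<phi> g H \<Longrightarrow> hessian \<phi> = H"
  unfolding hessian_def using C2_with_unique by (intro some_equality) blast+

lemma polys_hessian:
  fixes f :: "real^'n \<Rightarrow> real"
  assumes "f \<in> polys (Suc (Suc k))"
  shows "\<exists>g. C2_with UNIV f g (hessian f)" "(\<lambda>x. B \<bullet> hessian f x) \<in> polys k"
proof -
  obtain g H where gH: "C2_with UNIV f g H" "\<And>i j. (\<lambda>x. H x $ i $ j) \<in> polys k"
    using polys_C2[OF assms] by blast
  have eq: "hessian f = H" by (rule hessian_eq[OF gH(1)])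
  show "\<exists>g. C2_with UNIV f g (hessian f)" using gH(1) eq by blast
  show "(\<lambda>x. B \<bullet> hessian f x) \<in> polys k"
    unfolding eq inner_vec_def[of B] inner_vec_def[of "B $ _"] inner_real_def
    by (intro polys_sum polys_cmult gH(2))
qed

lemma polys_zero_on_ball:
  assumes f: "f \<in> polys k" and \<rho>: "0 < \<rho>" and zero: "\<And>x. x \<in> ball 0 \<rho> \<Longrightarrow> f x = 0"
  shows "f = (\<lambda>x. 0)"
proof
  fix x
  obtain q where q: "\<And>t. f (t *\<^sub>R x) = poly q t" using polys_along_ray[OF f] by blast
  have "poly q t = 0" if "t \<in> {0<..<\<rho> / (norm x + 1)}" for t
  proof -
    have "t * (norm x + 1) < \<rho>" using that by (simp add: pos_less_divide_eq add_nonneg_pos)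
    then have "norm (t *\<^sub>R x) < \<rho>" using that by (simp add: algebra_simps)
    then show ?thesis using zero[of "t *\<^sub>R x"] q by simp
  qed
  then have "{0<..<\<rho> / (norm x + 1)} \<subseteq> {t. poly q t = 0}" by blast
  moreover have "infinite {0<..<\<rho> / (norm x + 1)}"
    using \<rho> by (intro infinite_Ioo divide_pos_pos) (auto simp: add_nonneg_pos)
  ultimately have "infinite {t. poly q t = 0}" using infinite_super by blast
  then have "q = 0" using poly_roots_finite by blast
  then show "f x = 0" using q[of 1] by simp
qed

text \<open>A solution is sought in the form \<open>q + (\<rho>\<^sup>2 - |x|\<^sup>2) f\<close>, which has the right boundary values. This
  leaves the equation \<open>T f = - B \<bullet> D\<^sup>2q\<close> for the operator \<open>T f = B \<bullet> D\<^sup>2((\<rho>\<^sup>2 - |x|\<^sup>2) f)\<close>, which maps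
  polynomials of degree at most \<open>k\<close> to such polynomials. By the maximum principle \<open>T\<close> is injective, and on a
  space of finite dimension it is then surjective.\<close>

lemma polynomial_dirichlet_problem:
  fixes q :: "real^'n \<Rightarrow> real"
  assumes B: "positive_weight B" and \<rho>: "0 < \<rho>" and q: "q \<in> polys k"
  shows "\<exists>h g H. C2_with UNIV h g H \<and> (\<forall>x. B \<bullet> H x = 0) \<and> (\<forall>x\<in>sphere 0 \<rho>. h x = q x)"
proof -
  define w where "w f x = (\<rho>\<^sup>2 - (norm x)\<^sup>2) * f x" for f and x :: "real^'n"
  define T where "T f x = B \<bullet> hessian (w f) x" for f and x :: "real^'n"
  have quad: "(\<lambda>x::real^'n. \<rho>\<^sup>2 - (norm x)\<^sup>2) \<in> polys (Suc (Suc 0))"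
  proof -
    have "(\<lambda>x::real^'n. \<rho>\<^sup>2 + (-1) * (\<Sum>i\<in>UNIV. x $ i * x $ i)) \<in> polys (Suc (Suc 0))"
      by (intro polys_add polys_const polys_cmult polys_sum polys_coord_mult polys_coord)
    then show ?thesis by (simp add: power2_norm_eq_inner inner_vec_def)
  qed
  have w: "w f \<in> polys (Suc (Suc k))" if "f \<in> polys k" for f
    using polys_mult[OF quad that] unfolding w_def[abs_def] by simp
  have q2: "q \<in> polys (Suc (Suc k))" by (intro polys_Suc q)
  have Tp: "T f \<in> polys k" if "f \<in> polys k" for f
    unfolding T_def[abs_def] by (rule polys_hessian(2)[OF w[OF that]])
  have hess_add: "hessian (\<lambda>x. f x + f' x) = (\<lambda>x. hessian f x + hessian f' x)"
    if f: "f \<in> polys (Suc (Suc k))" "f' \<in> polys (Suc (Suc k))" for f f' :: "real^'n \<Rightarrow> real"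
  proof -
    obtain g g' where g: "C2_with UNIV f g (hessian f)" "C2_with UNIV f' g' (hessian f')"
      using polys_hessian(1)[OF f(1)] polys_hessian(1)[OF f(2)] by blast
    show ?thesis by (rule hessian_eq[OF C2_with_add[OF g]])
  qed
  have hess_cmult: "hessian (\<lambda>x. c * f x) = (\<lambda>x. c *\<^sub>R hessian f x)"
    if f: "f \<in> polys (Suc (Suc k))" for c and f :: "real^'n \<Rightarrow> real"
  proof -
    obtain g where g: "C2_with UNIV f g (hessian f)" using polys_hessian(1)[OF f] by blast
    show ?thesis by (rule hessian_eq[OF C2_with_cmult[OF g]])
  qed
  have T_add: "T (f + f') = T f + T f'" if "f \<in> polys k" "f' \<in> polys k" for f f'
  proof -
    have "w (f + f') = (\<lambda>x. w f x + w f' x)" by (simp add: w_def fun_eq_iff algebra_simps)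
    then show ?thesis
      unfolding T_def[abs_def] by (simp add: hess_add w that plus_fun_def inner_right_distrib)
  qed
  have T_cmult: "T (\<lambda>x. c * f x) = (\<lambda>x. c * T f x)" if "f \<in> polys k" for c f
  proof -
    have "w (\<lambda>x. c * f x) = (\<lambda>x. c * w f x)" by (simp add: w_def fun_eq_iff)
    then show ?thesis unfolding T_def[abs_def] by (simp add: hess_cmult w that)
  qed
  have le0: "f x \<le> 0" if f: "f \<in> polys k" "T f = (\<lambda>x. 0)" and x: "x \<in> ball 0 \<rho>" for f x
  proof -
    obtain g where C2: "C2_with UNIV (w f) g (hessian (w f))" using polys_hessian(1)[OF w[OF f(1)]] by blast
    have "w f x \<le> 0"
      by (rule weighted_maximum_principle[OF B \<rho> C2 _ _ x])
        (use fun_cong[OF f(2)] in \<open>auto simp: T_def w_def\<close>)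
    moreover have "0 < \<rho>\<^sup>2 - (norm x)\<^sup>2" using x \<rho> by (simp add: power_strict_mono)
    ultimately show ?thesis unfolding w_def by (simp add: mult_le_0_iff)
  qed
  have ker: "f = (\<lambda>x. 0)" if f: "f \<in> polys k" "T f = (\<lambda>x. 0)" for f
  proof (rule polys_zero_on_ball[OF f(1) \<rho>])
    fix x :: "real^'n" assume x: "x \<in> ball 0 \<rho>"
    have "T (\<lambda>x. (-1) * f x) = (\<lambda>x. 0)" using T_cmult[OF f(1), of "-1"] f(2) by simp
    from le0[OF polys_cmult[OF f(1)] this x] le0[OF f x] show "f x = 0" by simp
  qed
  define r where "r x = (-1) * (B \<bullet> hessian q x)" for x
  have "r \<in> polys k" unfolding r_def[abs_def] by (intro polys_cmult polys_hessian(2) q2)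
  obtain f where f: "f \<in> polys k" "T f = r"
    using function_space.injective_on_finite_span_imp_surjective[of "monomials k" T r]
      finite_monomials Tp T_add T_cmult ker \<open>r \<in> polys k\<close>
    unfolding polys_def zero_fun_def by blast
  obtain g g' where g: "C2_with UNIV q g (hessian q)" "C2_with UNIV (w f) g' (hessian (w f))"
    using polys_hessian(1)[OF q2] polys_hessian(1)[OF w[OF f(1)]] by blast
  have "C2_with UNIV (\<lambda>x. q x + w f x) (\<lambda>x. g x + g' x) (\<lambda>x. hessian q x + hessian (w f) x)"
    by (rule C2_with_add[OF g])
  moreover have "B \<bullet> (hessian q x + hessian (w f) x) = 0" for x
    using fun_cong[OF f(2), of x] unfolding T_def r_def by (simp add: inner_right_distrib)
  moreover have "\<forall>x\<in>sphere 0 \<rho>. q x + w f x = q x" unfolding w_def by simp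
  ultimately show ?thesis by blast
qed

lemma harmonic_approximation:
  fixes v :: "real^'n \<Rightarrow> real"
  assumes B: "positive_weight B" and \<rho>: "0 < \<rho>" and v: "continuous_on (sphere c \<rho>) v" and \<epsilon>: "0 < \<epsilon>"
  shows "\<exists>h g H. C2_with UNIV h g H \<and> (\<forall>x. B \<bullet> H x = 0) \<and> (\<forall>x\<in>sphere c \<rho>. \<bar>v x - h x\<bar> < \<epsilon>)"
proof -
  have "continuous_on (sphere 0 \<rho>) (\<lambda>y. v (c + y))"
    by (rule continuous_on_compose2[OF v]) (auto intro!: continuous_intros simp: dist_norm)
  then obtain k q where q: "q \<in> polys k" "\<And>y. y \<in> sphere 0 \<rho> \<Longrightarrow> \<bar>v (c + y) - q y\<bar> < \<epsilon>"
    using polys_dense[of "sphere 0 \<rho>" "\<lambda>y. v (c + y)" \<epsilon>] \<epsilon> by auto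
  obtain h g H where h: "C2_with UNIV h g H" "\<And>x. B \<bullet> H x = 0" "\<And>x. x \<in> sphere 0 \<rho> \<Longrightarrow> h x = q x"
    using polynomial_dirichlet_problem[OF B \<rho> q(1)] by blast
  have "C2_with UNIV (\<lambda>x. h (x - c)) (\<lambda>x. g (x - c)) (\<lambda>x. H (x - c))"
    using C2_with_affine[OF h(1), of "mat 1" "- c"] by (simp add: transpose_mat)
  moreover have "\<bar>v x - h (x - c)\<bar> < \<epsilon>" if "x \<in> sphere c \<rho>" for x
    using q(2)[of "x - c"] h(3)[of "x - c"] that by (simp add: dist_norm norm_minus_commute)
  ultimately show ?thesis using h(2)
    by (intro exI[of _ "\<lambda>x. h (x - c)"] exI[of _ "\<lambda>x. g (x - c)"] exI[of _ "\<lambda>x. H (x - c)"]) simp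
qed

section \<open>Closure properties of subsolutions\<close>

lemma usc_on_continuous:
  assumes "continuous_on X v"
  shows "usc_on X (\<lambda>x. ereal (v x))"
  unfolding usc_on_def
proof (intro ballI allI impI)
  fix x c assume x: "x \<in> X" and c: "ereal (v x) < c"
  have "(v \<longlongrightarrow> v x) (at x within X)" using assms x unfolding continuous_on by blast
  then have "((\<lambda>y. ereal (v y)) \<longlongrightarrow> ereal (v x)) (at x within X)" by (rule tendsto_ereal)
  then show "\<forall>\<^sub>F y in at x within X. ereal (v y) < c" using c by (rule order_tendstoD(2))
qed

lemma matrix_inv_orthogonal: "orthogonal_matrix g \<Longrightarrow> matrix_inv g = transpose (g :: real^'n^'n)"
proof -
  assume g: "orthogonal_matrix g"
  then have "invertible g" unfolding invertible_def orthogonal_matrix_def by blast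
  then have inv: "g ** matrix_inv g = mat 1"
    unfolding invertible_def matrix_inv_def by (rule someI2_ex) blast
  have "transpose g = transpose g ** (g ** matrix_inv g)" using inv by simp
  also have "\<dots> = (transpose g ** g) ** matrix_inv g" by (simp only: matrix_mul_assoc)
  also have "\<dots> = matrix_inv g" using g unfolding orthogonal_matrix_def by simp
  finally show ?thesis ..
qed

lemma subsolution_isometry:
  fixes R :: "real^'n^'n"
  assumes u: "subsolution F X u" and R: "orthogonal_matrix R"
    and inv: "\<And>A. A \<in> F \<Longrightarrow> transpose R ** A ** R \<in> F"
  shows "subsolution F {x. R *v x + c \<in> X} (\<lambda>x. u (R *v x + c))"
  unfolding subsolution_def
proof (intro conjI ballI allI impI)
  let ?T = "\<lambda>x. R *v x + c" and ?S = "\<lambda>y. transpose R *v y + (- (transpose R *v c))"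
  have RR: "R *v (transpose R *v y) = y" "transpose R *v (R *v y) = y" for y
    using R unfolding orthogonal_matrix_def by (simp_all only: matrix_vector_mul_assoc) simp_all
  have ST: "?S (?T x) = x" for x
    by (simp only: matrix_vector_right_distrib RR) simp
  have TS: "?T (?S x) = x" for x
    by (simp only: diff_conv_add_uminus[symmetric] matrix_vector_mult_diff_distrib RR) simp
  have contT: "continuous_on UNIV ?T"
    by (intro continuous_on_add matrix_vector_mult_linear_continuous_on continuous_on_const)
  show "u (?T x) < \<infinity>" if "x \<in> {x. ?T x \<in> X}" for x
    using subsolution_less_top[OF u] that by simp
  show "usc_on {x. ?T x \<in> X} (\<lambda>x. u (?T x))"
  proof (rule usc_onI)
    fix x d assume "x \<in> {x. ?T x \<in> X}" "u (?T x) < d"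
    then obtain V where V: "open V" "?T x \<in> V" "\<And>y. y \<in> V \<inter> X \<Longrightarrow> u y < d"
      using usc_on_open_nhd[OF subsolution_usc[OF u], of "?T x" d] by blast
    have "open (?T -` V)" using contT V(1) by (rule open_vimage[rotated])
    with V show "\<exists>W. open W \<and> x \<in> W \<and> (\<forall>y\<in>W \<inter> {x. ?T x \<in> X}. u (?T y) < d)"
      by (intro exI[of _ "?T -` V"]) auto
  qed
  fix x0 U \<phi> g H
  assume x0: "x0 \<in> {x. ?T x \<in> X}" and test: "open U \<and> x0 \<in> U \<and> U \<subseteq> {x. ?T x \<in> X} \<and>
    C2_with U \<phi> g H \<and> (\<forall>x\<in>U. u (?T x) \<le> ereal (\<phi> x)) \<and> u (?T x0) = ereal (\<phi> x0)"
  define V where "V = {y. ?S y \<in> U}"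
  have contS: "continuous_on UNIV ?S"
    by (intro continuous_on_add matrix_vector_mult_linear_continuous_on continuous_on_const)
  have "R ** H (?S (?T x0)) ** transpose R \<in> F"
  proof (rule subsolutionD[OF u, where H = "\<lambda>y. R ** H (?S y) ** transpose R" and ?x0.0 = "?T x0"])
    show "?T x0 \<in> X" using x0 by simp
    have "open (?S -` U)" using contS test by (intro open_vimage) auto
    then show "open V" unfolding V_def vimage_def .
    show "?T x0 \<in> V" unfolding V_def mem_Collect_eq ST using test by blast
    show "V \<subseteq> X"
    proof
      fix y assume "y \<in> V"
      then have "?T (?S y) \<in> X" using test unfolding V_def by blast
      then show "y \<in> X" unfolding TS .
    qed
    show "C2_with V (\<lambda>y. \<phi> (?S y)) (\<lambda>y. transpose (transpose R) *v g (?S y)) (\<lambda>y. R ** H (?S y) ** transpose R)"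
      using C2_with_affine[of U \<phi> g H "transpose R" "- (transpose R *v c)"] test
      unfolding V_def transpose_transpose by blast
    show "u y \<le> ereal (\<phi> (?S y))" if "y \<in> V" for y
    proof -
      have "u (?T (?S y)) \<le> ereal (\<phi> (?S y))" using that test unfolding V_def by blast
      then show ?thesis unfolding TS .
    qed
    show "u (?T x0) = ereal (\<phi> (?S (?T x0)))" unfolding ST using test by blast
  qed
  from inv[OF this] have "transpose R ** (R ** H x0 ** transpose R) ** R \<in> F" unfolding ST .
  moreover have "transpose R ** (R ** H x0 ** transpose R) ** R = (transpose R ** R) ** H x0 ** (transpose R ** R)"
    by (simp add: matrix_mul_assoc)
  ultimately show "H x0 \<in> F" using R unfolding orthogonal_matrix_def by simp
qed

lemma subsolution_translate:
  assumes "subsolution F X u"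
  shows "subsolution F {y. c + y \<in> X} (\<lambda>y. u (c + y))"
  using subsolution_isometry[OF assms, of "mat 1" c]
  by (simp add: orthogonal_matrix_def transpose_mat add.commute)

lemma subsolution_subset:
  assumes "subsolution F X u" "Y \<subseteq> X"
  shows "subsolution F Y u"
  using assms usc_on_subset[of X u Y] unfolding subsolution_def by blast

context riesz_cone
begin

text \<open>A closed convex cone is separated from a point outside it by a hyperplane through \<open>0\<close>. The normal is
  nonnegative on \<open>PSD \<subseteq> F\<close>, and only its symmetric part matters.\<close>

lemma separating_weight:
  assumes "convex F" and A: "A \<in> Sym2" "A \<notin> F"
  shows "\<exists>B. positive_weight B \<and> B \<bullet> A < 0 \<and> (\<forall>A'\<in>F. 0 \<le> B \<bullet> A')"
proof -
  obtain a b where ab: "a \<bullet> A < b" "\<And>x. x \<in> F \<Longrightarrow> b < a \<bullet> x"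
    using separating_hyperplane_closed_point[OF \<open>convex F\<close> closed_F A(2)] by blast
  have "b < 0" using ab(2)[OF zero_in_F] by simp
  have nonneg: "0 \<le> a \<bullet> A'" if "A' \<in> F" for A'
  proof (rule ccontr)
    assume neg: "\<not> 0 \<le> a \<bullet> A'"
    have "(b / (a \<bullet> A')) *\<^sub>R A' \<in> F" using neg \<open>b < 0\<close> by (intro F_scale that) (simp add: divide_nonpos_neg)
    from ab(2)[OF this] neg show False by simp
  qed
  define B where "B = (1/2) *\<^sub>R (a + transpose a)"
  have B: "B \<bullet> M = a \<bullet> M" if "M \<in> Sym2" for M
  proof -
    have "transpose a \<bullet> M = a \<bullet> M"
      using inner_transpose[of a M] that unfolding Sym2_def by simp
    then show ?thesis unfolding B_def by (simp add: inner_add_left)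
  qed
  have "B \<in> Sym2" unfolding B_def Sym2_def
    by (simp add: transpose_def vec_eq_iff add.commute)
  moreover have PSD: "0 \<le> B \<bullet> P" if "P \<in> PSD" for P
    using nonneg[OF PSD_subset_F[OF that]] B[of P] that unfolding PSD_def by simp
  moreover have BA: "B \<bullet> A < 0" using B[OF A(1)] ab(1) \<open>b < 0\<close> by simp
  moreover have "0 < B \<bullet> mat 1"
  proof -
    obtain c where c: "c > 0" "A + c *\<^sub>R mat 1 \<in> PSD" using add_multiple_of_identity_PSD[OF A(1)] by blast
    have "0 \<le> B \<bullet> A + c * (B \<bullet> mat 1)" using PSD[OF c(2)] by (simp add: inner_right_distrib)
    then have "0 < c * (B \<bullet> mat 1)" using BA by simp
    then show ?thesis using c(1) by (simp add: zero_less_mult_iff)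
  qed
  moreover have "\<forall>A'\<in>F. 0 \<le> B \<bullet> A'" using nonneg B F_Sym2 by simp
  ultimately show ?thesis unfolding positive_weight_def by blast
qed

text \<open>Let \<open>\<phi>\<close> touch the midpoint from above with \<open>B \<bullet> D\<^sup>2\<phi> < 0\<close> at \<open>x\<^sub>0\<close>. On a small sphere about
  \<open>x\<^sub>0\<close> approximate \<open>v1\<close> by a solution \<open>h\<close> of \<open>B \<bullet> D\<^sup>2h = 0\<close>. Inside, \<open>v1\<close> is at most \<open>h\<close> and
  \<open>v2\<close> is at most \<open>2 \<phi> - h\<close>, both up to small errors, by the comparison principle for each function. After \<open>\<phi>\<close> has been
  made to touch strictly, the sum of the two bounds at \<open>x\<^sub>0\<close> is a contradiction.\<close>

lemma midpoint_subsolution: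
  assumes "convex F" and D: "open D" and cont: "continuous_on D v1" "continuous_on D v2"
    and v1: "subsolution F D (\<lambda>x. ereal (v1 x))" and v2: "subsolution F D (\<lambda>x. ereal (v2 x))"
  shows "subsolution F D (\<lambda>x. ereal ((v1 x + v2 x) / 2))"
  unfolding subsolution_def
proof (intro conjI ballI allI impI)
  show "usc_on D (\<lambda>x. ereal ((v1 x + v2 x) / 2))"
    by (intro usc_on_continuous continuous_intros cont) simp
  fix x0 U \<phi> g H
  assume x0: "x0 \<in> D" and test: "open U \<and> x0 \<in> U \<and> U \<subseteq> D \<and> C2_with U \<phi> g H \<and>
    (\<forall>x\<in>U. ereal ((v1 x + v2 x) / 2) \<le> ereal (\<phi> x)) \<and> ereal ((v1 x0 + v2 x0) / 2) = ereal (\<phi> x0)"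
  then have U: "open U" "x0 \<in> U" "U \<subseteq> D" and C2: "C2_with U \<phi> g H"
    and le: "\<And>x. x \<in> U \<Longrightarrow> v1 x + v2 x \<le> 2 * \<phi> x" and eq: "v1 x0 + v2 x0 = 2 * \<phi> x0" by auto
  show "H x0 \<in> F"
  proof (rule ccontr)
    assume "H x0 \<notin> F"
    then obtain B where B: "positive_weight B" "B \<bullet> H x0 < 0" "\<And>A. A \<in> F \<Longrightarrow> 0 \<le> B \<bullet> A"
      using separating_weight[OF \<open>convex F\<close> C2_with_symmetric[OF C2 U(1,2)]] by blast
    have B1: "0 < B \<bullet> mat 1" using B(1) unfolding positive_weight_def by blast
    \<comment> \<open>Adding \<open>\<eta> |x - x\<^sub>0|\<^sup>2\<close> to \<open>\<phi>\<close> uses up half of the negative value \<open>B \<bullet> H x\<^sub>0\<close>.\<close>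
    define \<eta> where "\<eta> = - (B \<bullet> H x0) / (4 * (B \<bullet> mat 1))"
    have \<eta>: "\<eta> > 0" "2 * \<eta> * (B \<bullet> mat 1) = - (B \<bullet> H x0) / 2"
      using B1 B(2) unfolding \<eta>_def by (simp_all add: divide_pos_pos divide_neg_pos)
    have "continuous_on U H" using C2 unfolding C2_with_def by blast
    then have "continuous_on U (\<lambda>x. B \<bullet> H x)" by (intro continuous_intros)
    from continuous_open_preimage[OF this U(1) open_lessThan[of "(B \<bullet> H x0) / 2"]]
    have "open {x \<in> U. B \<bullet> H x < (B \<bullet> H x0) / 2}" by (simp add: vimage_def Int_def)
    moreover have "x0 \<in> {x \<in> U. B \<bullet> H x < (B \<bullet> H x0) / 2}" using U B(2) by simp
    ultimately obtain \<rho> where \<rho>: "\<rho> > 0" "cball x0 \<rho> \<subseteq> {x \<in> U. B \<bullet> H x < (B \<bullet> H x0) / 2}"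
      using open_contains_cball by blast
    have cb: "cball x0 \<rho> \<subseteq> U" "cball x0 \<rho> \<subseteq> D" using \<rho> U by auto
    \<comment> \<open>The strict touching gains \<open>2 \<eta> \<rho>\<^sup>2 = 4 \<epsilon>\<close> on the sphere, and the errors below add up to \<open>3 \<epsilon>\<close>.\<close>
    define \<epsilon> where "\<epsilon> = \<eta> * \<rho>\<^sup>2 / 2"
    have "\<epsilon> > 0" using \<eta> \<rho> unfolding \<epsilon>_def by simp
    have "continuous_on (sphere x0 \<rho>) v1"
      using cont(1) by (rule continuous_on_subset) (use cb in auto)
    then obtain h g1 H1 where h: "C2_with UNIV h g1 H1" "\<And>x. B \<bullet> H1 x = 0"
      "\<And>x. x \<in> sphere x0 \<rho> \<Longrightarrow> \<bar>v1 x - h x\<bar> < \<epsilon>"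
      using harmonic_approximation[OF B(1) \<rho>(1) _ \<open>\<epsilon> > 0\<close>] by blast
    have notin: "A \<notin> F" if "B \<bullet> A < 0" for A using B(3)[of A] that by auto
    have sq: "\<epsilon> / \<rho>\<^sup>2 * \<rho>\<^sup>2 = \<epsilon>" "\<epsilon> / \<rho>\<^sup>2 > 0" using \<rho> \<open>\<epsilon> > 0\<close> by simp_all
    have 1: "v1 x0 \<le> h x0 + 2 * \<epsilon>"
    proof -
      define \<psi> where "\<psi> x = (h x + (- (\<epsilon> / \<rho>\<^sup>2)) * (norm (x - x0))\<^sup>2) + 2 * \<epsilon>" for x
      have C2\<psi>: "C2_with UNIV \<psi> (\<lambda>x. (g1 x + (- (\<epsilon> / \<rho>\<^sup>2)) *\<^sub>R (2 *\<^sub>R (x - x0))) + 0)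
         (\<lambda>x. (H1 x + (- (\<epsilon> / \<rho>\<^sup>2)) *\<^sub>R (2 *\<^sub>R mat 1)) + 0)"
        unfolding \<psi>_def[abs_def] by (intro C2_with_add h(1) C2_with_cmult C2_with_norm_square C2_with_const)
      have "ereal (v1 x0) \<le> ereal (\<psi> x0)"
      proof (rule subsolution_comparison[OF v1, where C = "cball x0 \<rho>" and D = "ball x0 \<rho>"])
        show "C2_with (ball x0 \<rho>) \<psi> (\<lambda>x. (g1 x + (- (\<epsilon> / \<rho>\<^sup>2)) *\<^sub>R (2 *\<^sub>R (x - x0))) + 0)
           (\<lambda>x. (H1 x + (- (\<epsilon> / \<rho>\<^sup>2)) *\<^sub>R (2 *\<^sub>R mat 1)) + 0)"
          using C2\<psi> by (rule C2_with_subset) simp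
        show "continuous_on (cball x0 \<rho>) \<psi>"
          using C2_with_continuous_on[OF C2\<psi>] by (rule continuous_on_subset) simp
        show "(H1 x + (- (\<epsilon> / \<rho>\<^sup>2)) *\<^sub>R (2 *\<^sub>R mat 1)) + 0 \<notin> F" for x
          by (rule notin) (use h(2) B1 \<rho>(1) \<open>\<epsilon> > 0\<close> in
            \<open>auto simp: inner_right_distrib inner_diff_right intro!: divide_pos_pos mult_pos_pos\<close>)
        show "ereal (v1 x) \<le> ereal (\<psi> x)" if "x \<in> cball x0 \<rho> - ball x0 \<rho>" for x
        proof -
          have "norm (x - x0) = \<rho>" using that by (auto simp: dist_norm norm_minus_commute)
          then show ?thesis using h(3)[of x] that sq(1) unfolding \<psi>_def by auto
        qed
      qed (use cb \<rho> in auto)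
      then show ?thesis unfolding \<psi>_def by simp
    qed
    have 2: "v2 x0 \<le> 2 * \<phi> x0 - h x0 - 2 * \<eta> * \<rho>\<^sup>2 + \<epsilon>"
    proof -
      define \<psi> where "\<psi> x = (2 * \<phi> x + (2 * \<eta>) * (norm (x - x0))\<^sup>2) + ((-1) * h x + (\<epsilon> - 2 * \<eta> * \<rho>\<^sup>2))" for x
      have C2\<psi>: "C2_with U \<psi> (\<lambda>x. (2 *\<^sub>R g x + (2 * \<eta>) *\<^sub>R (2 *\<^sub>R (x - x0))) + ((-1) *\<^sub>R g1 x + 0))
         (\<lambda>x. (2 *\<^sub>R H x + (2 * \<eta>) *\<^sub>R (2 *\<^sub>R mat 1)) + ((-1) *\<^sub>R H1 x + 0))"
        unfolding \<psi>_def[abs_def]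
        by (intro C2_with_add C2 C2_with_cmult C2_with_const C2_with_subset[OF h(1)]
            C2_with_subset[OF C2_with_norm_square]) simp_all
      have "ereal (v2 x0) \<le> ereal (\<psi> x0)"
      proof (rule subsolution_comparison[OF v2, where C = "cball x0 \<rho>" and D = "ball x0 \<rho>"])
        show "C2_with (ball x0 \<rho>) \<psi> (\<lambda>x. (2 *\<^sub>R g x + (2 * \<eta>) *\<^sub>R (2 *\<^sub>R (x - x0))) + ((-1) *\<^sub>R g1 x + 0))
           (\<lambda>x. (2 *\<^sub>R H x + (2 * \<eta>) *\<^sub>R (2 *\<^sub>R mat 1)) + ((-1) *\<^sub>R H1 x + 0))"
          using C2\<psi> by (rule C2_with_subset) (use cb in auto)
        show "continuous_on (cball x0 \<rho>) \<psi>"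
          using C2_with_continuous_on[OF C2\<psi>] by (rule continuous_on_subset) (use cb in simp)
        show "(2 *\<^sub>R H x + (2 * \<eta>) *\<^sub>R (2 *\<^sub>R mat 1)) + ((-1) *\<^sub>R H1 x + 0) \<notin> F" if "x \<in> ball x0 \<rho>" for x
        proof (rule notin)
          have "x \<in> cball x0 \<rho>" using that by simp
          then have "B \<bullet> H x < (B \<bullet> H x0) / 2" using \<rho>(2) by blast
          moreover have "B \<bullet> ((2 *\<^sub>R H x + (2 * \<eta>) *\<^sub>R (2 *\<^sub>R mat 1)) + ((-1) *\<^sub>R H1 x + 0))
             = 2 * (B \<bullet> H x) + 2 * (2 * \<eta> * (B \<bullet> mat 1))"
            using h(2)[of x] by (simp add: inner_right_distrib inner_diff_right)
          ultimately show "B \<bullet> ((2 *\<^sub>R H x + (2 * \<eta>) *\<^sub>R (2 *\<^sub>R mat 1)) + ((-1) *\<^sub>R H1 x + 0)) < 0"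
            unfolding \<eta>(2) by simp
        qed
        show "ereal (v2 x) \<le> ereal (\<psi> x)" if "x \<in> cball x0 \<rho> - ball x0 \<rho>" for x
        proof -
          have n: "norm (x - x0) = \<rho>" using that by (auto simp: dist_norm norm_minus_commute)
          have "\<bar>v1 x - h x\<bar> < \<epsilon>" using h(3)[of x] that by auto
          moreover have "v1 x + v2 x \<le> 2 * \<phi> x" using le cb that by auto
          ultimately show ?thesis unfolding \<psi>_def n by simp
        qed
      qed (use cb \<rho> in auto)
      then show ?thesis unfolding \<psi>_def by simp
    qed
    have "\<eta> * \<rho>\<^sup>2 = 2 * \<epsilon>" unfolding \<epsilon>_def by simp
    with 1 2 eq \<open>\<epsilon> > 0\<close> show False by simp
  qed
qed simp

text \<open>As \<open>F\<close> is closed, a test function with Hessian outside \<open>F\<close> at \<open>x\<^sub>0\<close> can be bent upwards so that it touches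
  strictly and its Hessian stays outside \<open>F\<close> near \<open>x\<^sub>0\<close>. It then contradicts the comparison principle
  for a nearby subsolution.\<close>

lemma uniform_limit_subsolution:
  assumes D: "open D" and cont: "continuous_on D v"
    and approx: "\<And>\<epsilon>. 0 < \<epsilon> \<Longrightarrow> \<exists>w. subsolution F D (\<lambda>x. ereal (w x)) \<and> (\<forall>x\<in>D. \<bar>w x - v x\<bar> \<le> \<epsilon>)"
  shows "subsolution F D (\<lambda>x. ereal (v x))"
  unfolding subsolution_def
proof (intro conjI ballI allI impI)
  show "usc_on D (\<lambda>x. ereal (v x))" by (rule usc_on_continuous[OF cont])
  fix x0 U \<phi> g H
  assume x0: "x0 \<in> D" and test: "open U \<and> x0 \<in> U \<and> U \<subseteq> D \<and> C2_with U \<phi> g H \<and>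
    (\<forall>x\<in>U. ereal (v x) \<le> ereal (\<phi> x)) \<and> ereal (v x0) = ereal (\<phi> x0)"
  then have U: "open U" "x0 \<in> U" "U \<subseteq> D" and C2: "C2_with U \<phi> g H"
    and le: "\<And>x. x \<in> U \<Longrightarrow> v x \<le> \<phi> x" and eq: "v x0 = \<phi> x0" by auto
  show "H x0 \<in> F"
  proof (rule ccontr)
    assume "H x0 \<notin> F"
    then obtain r where r: "r > 0" "ball (H x0) r \<subseteq> - F"
      using closed_F open_contains_ball[of "- F"] by (auto simp: open_Compl)
    define N where "N = norm (mat 1 :: real^'n^'n) + 1"
    have N: "N > 0" "norm (mat 1 :: real^'n^'n) < N" unfolding N_def by (simp_all add: add_nonneg_pos)
    \<comment> \<open>The added quadratic changes the Hessian by less than \<open>r / 2\<close>.\<close>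
    define \<eta> where "\<eta> = r / (4 * N)"
    have \<eta>: "\<eta> > 0" using r N unfolding \<eta>_def by simp
    have "continuous_on U H" using C2 unfolding C2_with_def by blast
    then have "isCont H x0" using U by (simp add: continuous_on_eq_continuous_at)
    then obtain d where d: "d > 0" "\<And>x. dist x x0 < d \<Longrightarrow> dist (H x) (H x0) < r / 2"
      unfolding continuous_at_eps_delta using r(1) half_gt_zero by blast
    obtain d' where d': "d' > 0" "cball x0 d' \<subseteq> U" using U open_contains_cball by blast
    define \<rho> where "\<rho> = min (d / 2) d'"
    have \<rho>: "\<rho> > 0" "\<rho> < d" "cball x0 \<rho> \<subseteq> U" "cball x0 \<rho> \<subseteq> D" using d d' U unfolding \<rho>_def by auto
    define \<epsilon> where "\<epsilon> = \<eta> * \<rho>\<^sup>2 / 3"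
    have \<epsilon>: "\<epsilon> > 0" using \<eta> \<rho> unfolding \<epsilon>_def by simp
    obtain w where w: "subsolution F D (\<lambda>x. ereal (w x))" "\<And>x. x \<in> D \<Longrightarrow> \<bar>w x - v x\<bar> \<le> \<epsilon>"
      using approx[OF \<epsilon>] by blast
    define \<psi> where "\<psi> x = (\<phi> x + \<eta> * (norm (x - x0))\<^sup>2) + (\<epsilon> - \<eta> * \<rho>\<^sup>2)" for x
    have C2\<psi>: "C2_with U \<psi> (\<lambda>x. (g x + \<eta> *\<^sub>R (2 *\<^sub>R (x - x0))) + 0)
         (\<lambda>x. (H x + \<eta> *\<^sub>R (2 *\<^sub>R mat 1)) + 0)"
      unfolding \<psi>_def[abs_def]
      by (intro C2_with_add C2 C2_with_cmult C2_with_const C2_with_subset[OF C2_with_norm_square]) simp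
    have "ereal (w x0) \<le> ereal (\<psi> x0)"
    proof (rule subsolution_comparison[OF w(1), where C = "cball x0 \<rho>" and D = "ball x0 \<rho>"])
      show "C2_with (ball x0 \<rho>) \<psi> (\<lambda>x. (g x + \<eta> *\<^sub>R (2 *\<^sub>R (x - x0))) + 0)
         (\<lambda>x. (H x + \<eta> *\<^sub>R (2 *\<^sub>R mat 1)) + 0)"
        using C2\<psi> by (rule C2_with_subset) (use \<rho> in auto)
      show "continuous_on (cball x0 \<rho>) \<psi>"
        using C2_with_continuous_on[OF C2\<psi>] by (rule continuous_on_subset) (use \<rho> in simp)
      show "(H x + \<eta> *\<^sub>R (2 *\<^sub>R mat 1)) + 0 \<notin> F" if "x \<in> ball x0 \<rho>" for x
      proof -
        have "norm (\<eta> *\<^sub>R (2 *\<^sub>R (mat 1 :: real^'n^'n))) \<le> 2 * \<eta> * N" using \<eta> N by simp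
        also have "\<dots> = r / 2" using N unfolding \<eta>_def by simp
        finally have "norm (\<eta> *\<^sub>R (2 *\<^sub>R (mat 1 :: real^'n^'n))) \<le> r / 2" .
        moreover have "norm (H x - H x0) < r / 2"
          using d(2)[of x] that \<rho>(2) by (simp add: dist_commute dist_norm[symmetric])
        moreover have "norm (H x + \<eta> *\<^sub>R (2 *\<^sub>R mat 1) - H x0)
            \<le> norm (H x - H x0) + norm (\<eta> *\<^sub>R (2 *\<^sub>R (mat 1 :: real^'n^'n)))"
          using norm_triangle_ineq[of "H x - H x0" "\<eta> *\<^sub>R (2 *\<^sub>R mat 1)"] by (simp add: algebra_simps)
        ultimately have "H x + \<eta> *\<^sub>R (2 *\<^sub>R mat 1) \<in> ball (H x0) r"
          by (simp add: dist_norm norm_minus_commute)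
        with r(2) show ?thesis by auto
      qed
      show "ereal (w x) \<le> ereal (\<psi> x)" if "x \<in> cball x0 \<rho> - ball x0 \<rho>" for x
      proof -
        have n: "norm (x - x0) = \<rho>" using that by (auto simp: dist_norm norm_minus_commute)
        have "x \<in> D" "x \<in> U" using that \<rho> by auto
        with w(2)[of x] le[of x] show ?thesis unfolding \<psi>_def n by simp
      qed
    qed (use \<rho> in auto)
    then have "w x0 \<le> \<phi> x0 + \<epsilon> - \<eta> * \<rho>\<^sup>2" unfolding \<psi>_def by simp
    moreover have "\<eta> * \<rho>\<^sup>2 = 3 * \<epsilon>" unfolding \<epsilon>_def by simp
    ultimately show False using w(2)[OF x0] eq \<epsilon> by simp
  qed
qed simp

text \<open>Continuity holds because \<open>M(u,y,\<delta>)\<close> lies between \<open>M(u,x,\<delta> - |x - y|)\<close> and \<open>M(u,x,\<delta> + |x - y|)\<close>, and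
  \<open>M(u,x,\<cdot>)\<close> is continuous. A test function for the maximum at \<open>x\<^sub>0\<close>, translated to a point of
  \<open>cball x\<^sub>0 \<delta>\<close> at which the maximum is attained, is a test function for \<open>u\<close>.\<close>

lemma max_regularization:
  assumes u: "F_subharmonic F X u" and X: "open X" and \<delta>: "0 < \<delta>" and Y: "open Y"
    and YX: "\<And>y. y \<in> Y \<Longrightarrow> cball y \<delta> \<subseteq> X"
  shows "continuous_on Y (\<lambda>y. real_of_ereal (max_avg u y \<delta>))"
    and "subsolution F Y (\<lambda>y. ereal (real_of_ereal (max_avg u y \<delta>)))"
proof -
  define m where "m y = real_of_ereal (max_avg u y \<delta>)" for y
  have sub: "subsolution F X u" using u by (rule F_subharmonic_imp_subsolution)
  have m: "max_avg u y \<delta> = ereal (m y)" if "y \<in> Y" for y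
    unfolding m_def using max_avg_finite[OF u X YX[OF that] \<delta>] .
  have cont: "continuous_on Y m"
    unfolding continuous_on_iff
  proof (intro ballI allI impI)
    fix x and \<epsilon> :: real assume x: "x \<in> Y" and \<epsilon>: "\<epsilon> > 0"
    obtain d where d: "d > 0" "(\<Union>z\<in>cball x \<delta>. ball z d) \<subseteq> X"
      using compact_subset_open_imp_ball_epsilon_subset[OF _ X YX[OF x]] by auto
    have bX: "ball x (\<delta> + d) \<subseteq> X"
    proof
      fix z assume z: "z \<in> ball x (\<delta> + d)"
      show "z \<in> X"
      proof (cases "dist x z \<le> \<delta>")
        case False
        \<comment> \<open>The point of \<open>cball x \<delta>\<close> closest to \<open>z\<close>.\<close>
        define w where "w = x + (\<delta> / dist x z) *\<^sub>R (z - x)"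
        have "z - w = (1 - \<delta> / dist x z) *\<^sub>R (z - x)" unfolding w_def by (simp add: algebra_simps)
        then have "dist w z = \<bar>1 - \<delta> / dist x z\<bar> * dist x z"
          by (metis dist_norm dist_commute norm_scaleR)
        also have "\<dots> = dist x z - \<delta>"
          using False \<delta> by (subst abs_of_nonneg) (auto simp: divide_le_eq_1 left_diff_distrib)
        finally have "dist w z < d" using z by simp
        moreover have "x \<noteq> z" using False \<delta> by auto
        then have "dist x w = \<delta>"
          unfolding w_def dist_norm using False \<delta> by (simp add: norm_minus_commute dist_norm)
        ultimately have "w \<in> cball x \<delta>" "z \<in> ball w d" by simp_all
        with d(2) show ?thesis by blast
      qed (use YX[OF x] in auto)
    qed
    define k where "k r = real_of_ereal (max_avg u x r)" for r
    have k: "max_avg u x r = ereal (k r)" if "0 < r" "r < \<delta> + d" for r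
      unfolding k_def by (rule max_avg_finite[OF u X]) (use bX that in \<open>auto simp: subset_eq\<close>)
    have "kernel_convex p (\<delta> + d) k" by (rule max_avg_kernel_convex[OF sub bX k])
    then have "isCont k \<delta>" by (rule kernel_convex_isCont) (use \<delta> d in auto)
    then obtain d1 where d1: "d1 > 0" "\<And>r. dist r \<delta> < d1 \<Longrightarrow> dist (k r) (k \<delta>) < \<epsilon>"
      unfolding continuous_at_eps_delta using \<epsilon> by blast
    define d2 where "d2 = min d1 (min d \<delta>)"
    have "d2 > 0" using d1 d \<delta> unfolding d2_def by simp
    moreover have "dist (m y) (m x) < \<epsilon>" if y: "y \<in> Y" "dist y x < d2" for y
    proof -
      define s where "s = dist y x"
      have s: "0 \<le> s" "s < d1" "s < d" "s < \<delta>" using y unfolding s_def d2_def by auto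
      have "max_avg u x (\<delta> - s) \<le> max_avg u y \<delta>" "max_avg u y \<delta> \<le> max_avg u x (\<delta> + s)"
        unfolding s_def by (intro max_avg_mono_ball; simp add: cball_subset_cball_iff dist_commute)+
      then have "k (\<delta> - s) \<le> m y" "m y \<le> k (\<delta> + s)"
        using k[of "\<delta> - s"] k[of "\<delta> + s"] m[OF y(1)] s \<delta> by simp_all
      moreover have "m x = k \<delta>" unfolding m_def k_def ..
      moreover have "\<bar>k (\<delta> - s) - k \<delta>\<bar> < \<epsilon>" "\<bar>k (\<delta> + s) - k \<delta>\<bar> < \<epsilon>"
        using d1(2)[of "\<delta> - s"] d1(2)[of "\<delta> + s"] s by (simp_all add: dist_real_def)
      ultimately show ?thesis unfolding dist_real_def by linarith
    qed
    ultimately show "\<exists>d>0. \<forall>y\<in>Y. dist y x < d \<longrightarrow> dist (m y) (m x) < \<epsilon>" by blast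
  qed
  then show "continuous_on Y (\<lambda>y. real_of_ereal (max_avg u y \<delta>))" unfolding m_def[abs_def] .
  have "subsolution F Y (\<lambda>y. ereal (m y))"
    unfolding subsolution_def
  proof (intro conjI ballI allI impI)
    show "usc_on Y (\<lambda>y. ereal (m y))" by (rule usc_on_continuous[OF cont])
    fix x0 U \<phi> g H
    assume x0: "x0 \<in> Y" and test: "open U \<and> x0 \<in> U \<and> U \<subseteq> Y \<and> C2_with U \<phi> g H \<and>
      (\<forall>x\<in>U. ereal (m x) \<le> ereal (\<phi> x)) \<and> ereal (m x0) = ereal (\<phi> x0)"
    obtain z where z: "dist x0 z \<le> \<delta>" "max_avg u x0 \<delta> = u z"
      using max_avg_attained[OF subsolution_usc[OF sub] YX[OF x0]] \<delta> by auto
    define c where "c = z - x0"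
    have nc: "norm c \<le> \<delta>" using z(1) unfolding c_def by (simp add: dist_norm norm_minus_commute)
    define V where "V = {y. y - c \<in> U}"
    have vle: "u y \<le> ereal (m (y - c))" and vX: "y \<in> X" if "y \<in> V" for y
    proof -
      have yc: "y - c \<in> Y" using that test unfolding V_def by blast
      have "dist (y - c) y \<le> \<delta>" using nc by (simp add: dist_norm)
      then show "u y \<le> ereal (m (y - c))" "y \<in> X"
        using le_max_avg[of "y - c" y \<delta> u] m[OF yc] YX[OF yc] by auto
    qed
    have "H (z - c) \<in> F"
    proof (rule subsolutionD[OF sub, where H = "\<lambda>y. H (y - c)" and ?x0.0 = z])
      show "z \<in> X" using z(1) YX[OF x0] by auto
      have "V = (\<lambda>y. y - c) -` U" unfolding V_def by auto
      then show "open V" using test by (auto intro!: open_vimage continuous_intros)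
      show "z \<in> V" unfolding V_def c_def using test by simp
      show "V \<subseteq> X" using vX by blast
      show "C2_with V (\<lambda>y. \<phi> (y - c)) (\<lambda>y. g (y - c)) (\<lambda>y. H (y - c))"
        using C2_with_affine[of U \<phi> g H "mat 1" "- c"] test unfolding V_def by (simp add: transpose_mat)
      show "u y \<le> ereal (\<phi> (y - c))" if "y \<in> V" for y
      proof -
        have "ereal (m (y - c)) \<le> ereal (\<phi> (y - c))" using that test unfolding V_def by blast
        with vle[OF that] show ?thesis by order
      qed
      show "u z = ereal (\<phi> (z - c))" using test z(2) m[OF x0] unfolding c_def by simp
    qed
    then show "H x0 \<in> F" unfolding c_def by simp
  qed simp
  then show "subsolution F Y (\<lambda>y. ereal (real_of_ereal (max_avg u y \<delta>)))" unfolding m_def .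
qed

end

section \<open>Rotation invariant measures\<close>

lemma orthogonal_matrix_norm: "orthogonal_matrix R \<Longrightarrow> norm (R *v y) = norm (y :: real^'n)"
  using orthogonal_transformation_matrix[of "(*v) R"]
  by (simp add: orthogonal_transformation_norm matrix_of_matrix_vector_mul)

lemma orthogonal_matrix_inverse_vector:
  assumes "orthogonal_matrix (R :: real^'n^'n)"
  shows "R *v (transpose R *v y) = y" "transpose R *v (R *v y) = y"
  using assms unfolding orthogonal_matrix_def by (simp_all only: matrix_vector_mul_assoc) simp_all

lemma measure_unit_ball_pos: "0 < measure lborel (cball 0 1 :: (real^'n) set)"
  using content_cball_pos[of 1 "0 :: real^'n"] by simp

lemma nn_integral_lborel_translate:
  fixes f :: "real^'n \<Rightarrow> ennreal"
  assumes [measurable]: "f \<in> borel_measurable borel"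
  shows "(\<integral>\<^sup>+y. f (a + y) \<partial>lborel) = (\<integral>\<^sup>+y. f y \<partial>lborel)"
    and "(\<integral>\<^sup>+y. f (a - y) \<partial>lborel) = (\<integral>\<^sup>+y. f y \<partial>lborel)"
proof -
  have "(\<integral>\<^sup>+y. f y \<partial>lborel) = (\<integral>\<^sup>+y. f (a + c *\<^sub>R y) \<partial>lborel)" if "\<bar>c\<bar> = 1" for c
  proof -
    have "c \<noteq> 0" using that by auto
    show ?thesis
      by (subst lborel_affine[OF \<open>c \<noteq> 0\<close>, of a])
        (simp add: nn_integral_density nn_integral_distr that)
  qed
  from this[of 1] this[of "-1"]
  show "(\<integral>\<^sup>+y. f (a + y) \<partial>lborel) = (\<integral>\<^sup>+y. f y \<partial>lborel)"
    and "(\<integral>\<^sup>+y. f (a - y) \<partial>lborel) = (\<integral>\<^sup>+y. f y \<partial>lborel)" by simp_all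
qed

text \<open>The argument by which two translation invariant measures are proportional: for the unit ball \<open>B\<close>, Tonelli's
  theorem and translation invariance give \<open>\<lambda>(R\<^sup>-\<^sup>1A) \<lambda>(B) = \<lambda>(A) \<lambda>(R\<^sup>-\<^sup>1B)\<close>, and \<open>R\<^sup>-\<^sup>1B = B\<close>.\<close>

lemma emeasure_lborel_orthogonal_preimage:
  fixes R :: "real^'n^'n"
  assumes R: "orthogonal_matrix R" and A: "A \<in> sets borel"
  shows "emeasure lborel {y. R *v y \<in> A} = emeasure lborel A"
proof -
  have R_meas [measurable]: "(*v) R \<in> borel_measurable borel"
    by (intro borel_measurable_continuous_onI matrix_vector_mult_linear_continuous_on)
  have [measurable]: "A \<in> sets borel" by (rule A)
  define B :: "(real^'n) set" where "B = cball 0 1"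
  have [measurable]: "B \<in> sets borel" unfolding B_def by simp
  have pre: "(\<integral>\<^sup>+z. indicator C (R *v z) \<partial>lborel) = emeasure lborel {y. R *v y \<in> C}" if "C \<in> sets borel" for C
  proof -
    have "{y. R *v y \<in> C} \<in> sets borel"
      using measurable_sets[OF R_meas that] by (simp add: vimage_def)
    moreover have "indicator C (R *v z) = (indicator {y. R *v y \<in> C} z :: ennreal)" for z
      by (simp add: indicator_def)
    ultimately show ?thesis by simp
  qed
  let ?f = "\<lambda>z y. indicator A (R *v z) * indicator B (R *v z + y) :: ennreal"
  let ?g = "\<lambda>z y. indicator A (R *v z - y) * indicator B (R *v z) :: ennreal"
  have "emeasure lborel {y. R *v y \<in> A} * emeasure lborel B
      = (\<integral>\<^sup>+z. indicator A (R *v z) * emeasure lborel B \<partial>lborel)"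
    by (subst nn_integral_multc) (simp_all add: pre)
  also have "\<dots> = (\<integral>\<^sup>+z. \<integral>\<^sup>+y. ?f z y \<partial>lborel \<partial>lborel)"
    by (simp add: nn_integral_cmult nn_integral_lborel_translate(1)[of "indicator B"])
  also have "\<dots> = (\<integral>\<^sup>+y. \<integral>\<^sup>+z. ?f z y \<partial>lborel \<partial>lborel)"
    by (rule lborel_pair.Fubini'[symmetric]) measurable
  also have "\<dots> = (\<integral>\<^sup>+y. \<integral>\<^sup>+z. ?g z y \<partial>lborel \<partial>lborel)"
  proof (rule nn_integral_cong)
    fix y
    \<comment> \<open>The translation by \<open>transpose R *v y\<close> turns \<open>R *v z\<close> into \<open>y + R *v z\<close>.\<close>
    have "(\<integral>\<^sup>+z. ?g z y \<partial>lborel) = (\<integral>\<^sup>+z. ?g (transpose R *v y + z) y \<partial>lborel)"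
      by (rule nn_integral_lborel_translate(1)[symmetric]) measurable
    also have "\<dots> = (\<integral>\<^sup>+z. ?f z y \<partial>lborel)"
      by (simp only: matrix_vector_right_distrib orthogonal_matrix_inverse_vector(1)[OF R])
        (simp add: add.commute)
    finally show "(\<integral>\<^sup>+z. ?f z y \<partial>lborel) = (\<integral>\<^sup>+z. ?g z y \<partial>lborel)" ..
  qed
  also have "\<dots> = (\<integral>\<^sup>+z. \<integral>\<^sup>+y. ?g z y \<partial>lborel \<partial>lborel)"
    by (rule lborel_pair.Fubini') measurable
  also have "\<dots> = (\<integral>\<^sup>+z. emeasure lborel A * indicator B (R *v z) \<partial>lborel)"
    by (simp add: nn_integral_multc nn_integral_lborel_translate(2)[of "indicator A"])
  also have "\<dots> = emeasure lborel A * emeasure lborel {y. R *v y \<in> B}"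
    by (subst nn_integral_cmult) (simp_all add: pre)
  also have "{y. R *v y \<in> B} = B" unfolding B_def by (auto simp: orthogonal_matrix_norm[OF R])
  finally have eq: "emeasure lborel {y. R *v y \<in> A} * emeasure lborel B = emeasure lborel A * emeasure lborel B" .
  have "emeasure lborel B = ennreal (measure lborel B)"
    unfolding B_def by (intro emeasure_eq_ennreal_measure) (use emeasure_compact_finite[of "cball 0 1 :: (real^'n) set"] in auto)
  moreover have "0 < measure lborel B"
    unfolding B_def by (rule measure_unit_ball_pos)
  ultimately have "emeasure lborel B \<noteq> 0" "emeasure lborel B \<noteq> \<infinity>" by simp_all
  with eq show ?thesis by (metis ennreal_mult_divide_eq infinity_ennreal_def)
qed

text \<open>Spherical and volume averages are both averages over such measures, and are treated together.\<close>

locale isotropic_measure = finite_measure M for M :: "(real^'n) measure" +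
  assumes space_subset: "space M \<subseteq> cball 0 1"
    and sets_M: "sets M = sets (restrict_space borel (space M))"
    and pos: "0 < measure M (space M)"
    and rotation_space: "\<And>R y. orthogonal_matrix R \<Longrightarrow> y \<in> space M \<Longrightarrow> R *v y \<in> space M"
    and rotation: "\<And>R. orthogonal_matrix R \<Longrightarrow> distr M M ((*v) R) = M"
begin

lemma borel_measurable_M:
  fixes f :: "real^'n \<Rightarrow> 'b::topological_space"
  assumes "continuous_on (space M) f"
  shows "f \<in> borel_measurable M"
  using borel_measurable_continuous_on_restrict[OF assms] measurable_cong_sets[OF sets_M refl] by blast

lemma continuous_on_scaled:
  assumes "continuous_on (cball 0 R) v" "0 \<le> r" "r \<le> R"
  shows "continuous_on (space M) (\<lambda>y. v (r *\<^sub>R y))"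
proof (rule continuous_on_compose2[OF assms(1)])
  show "(\<lambda>y. r *\<^sub>R y) ` space M \<subseteq> cball 0 R"
  proof
    fix z assume "z \<in> (\<lambda>y. r *\<^sub>R y) ` space M"
    then obtain y where y: "y \<in> space M" "z = r *\<^sub>R y" by blast
    have "norm y \<le> 1" using space_subset y(1) by auto
    then have "r * norm y \<le> R * 1" using assms by (intro mult_mono) auto
    then show "z \<in> cball 0 R" using y assms by simp
  qed
qed (intro continuous_intros)

lemma integrable_M:
  fixes f :: "real^'n \<Rightarrow> real"
  assumes "f \<in> borel_measurable M" "\<And>y. y \<in> space M \<Longrightarrow> \<bar>f y\<bar> \<le> C"
  shows "integrable M f"
  by (rule integrable_const_bound[of _ C]) (use assms in \<open>auto intro: AE_I2\<close>)

lemma integrable_scaled: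
  fixes v :: "real^'n \<Rightarrow> real"
  assumes v: "continuous_on (cball 0 R) v" and r: "0 \<le> r" "r \<le> R"
  shows "integrable M (\<lambda>y. v (r *\<^sub>R y))"
proof -
  have "compact (v ` cball 0 R)" using v by (intro compact_continuous_image) auto
  then obtain C where C: "\<And>z. z \<in> v ` cball 0 R \<Longrightarrow> norm z \<le> C"
    using compact_imp_bounded bounded_iff by metis
  show ?thesis
  proof (rule integrable_M)
    show "(\<lambda>y. v (r *\<^sub>R y)) \<in> borel_measurable M"
      by (rule borel_measurable_M[OF continuous_on_scaled[OF assms]])
    fix y assume "y \<in> space M"
    then have "norm y \<le> 1" using space_subset by auto
    then have "r * norm y \<le> R * 1" using r by (intro mult_mono) auto
    then show "\<bar>v (r *\<^sub>R y)\<bar> \<le> C" using C[of "v (r *\<^sub>R y)"] r by simp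
  qed
qed

lemma integral_rotate:
  fixes f :: "real^'n \<Rightarrow> real"
  assumes R: "orthogonal_matrix R" and f: "f \<in> borel_measurable M"
  shows "(\<integral>y. f (R *v y) \<partial>M) = (\<integral>y. f y \<partial>M)"
proof -
  have "continuous_on (space M) ((*v) R)" by (rule matrix_vector_mult_linear_continuous_on)
  then have "(*v) R \<in> measurable M (restrict_space borel (space M))"
    using rotation_space[OF R] by (intro measurable_restrict_space2 borel_measurable_M) auto
  then have "(*v) R \<in> measurable M M" using measurable_cong_sets[OF refl sets_M] by blast
  from integral_distr[OF this f] show ?thesis by (simp add: rotation[OF R])
qed

end

lemma sets_normalized_cone:
  fixes A :: "(real^'n) set"
  assumes "A \<in> sets borel"
  shows "{y \<in> cball 0 1 - {0}. y /\<^sub>R norm y \<in> A} \<in> sets borel"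
proof -
  have "(\<lambda>y::real^'n. y /\<^sub>R norm y) \<in> borel_measurable borel" by measurable
  then have pre: "(\<lambda>y::real^'n. y /\<^sub>R norm y) -` A \<in> sets borel"
    using assms measurable_sets[of "\<lambda>y. y /\<^sub>R norm y" borel borel A] by simp
  have ball: "cball 0 1 - {0::real^'n} \<in> sets borel" by simp
  have "{y \<in> cball 0 1 - {0}. y /\<^sub>R norm y \<in> A} = (cball 0 1 - {0}) \<inter> (\<lambda>y. y /\<^sub>R norm y) -` A" by auto
  then show ?thesis using sets.Int[OF ball pre] by (simp only:)
qed

lemma space_surface_measure: "space (surface_measure :: (real^'n) measure) = sphere 0 1"
  unfolding surface_measure_def by (simp add: space_restrict_space)

lemma sets_surface_measure: "sets (surface_measure :: (real^'n) measure) = sets (restrict_space borel (sphere 0 1))"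
  unfolding surface_measure_def by simp

lemma emeasure_surface_measure:
  fixes A :: "(real^'n) set"
  assumes "A \<in> sets borel" "A \<subseteq> sphere 0 1"
  shows "emeasure surface_measure A
    = of_nat CARD('n) * emeasure lborel {y \<in> cball 0 1 - {0}. y /\<^sub>R norm y \<in> A}"
proof -
  let ?N = "scale_measure (of_nat CARD('n)) (restrict_space lborel (cball 0 1 - {0})) :: (real^'n) measure"
  have "(\<lambda>y. y /\<^sub>R norm y) \<in> measurable (restrict_space lborel (cball 0 1 - {0})) (restrict_space borel (sphere 0 1 :: (real^'n) set))"
  proof (rule measurable_restrict_space2)
    show "(\<lambda>y. y /\<^sub>R norm y) \<in> space (restrict_space lborel (cball 0 1 - {0})) \<rightarrow> (sphere 0 1 :: (real^'n) set)"
      by (auto simp: space_restrict_space)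
    show "(\<lambda>y::real^'n. y /\<^sub>R norm y) \<in> borel_measurable (restrict_space lborel (cball 0 1 - {0}))"
      by (intro measurable_restrict_space1) simp
  qed
  then have "(\<lambda>y. y /\<^sub>R norm y) \<in> measurable ?N (restrict_space borel (sphere 0 1 :: (real^'n) set))"
    by (simp add: measurable_def space_scale_measure)
  moreover have "A \<in> sets (restrict_space borel (sphere 0 1))"
    using assms by (simp add: sets_restrict_space_iff)
  ultimately have "emeasure surface_measure A = emeasure ?N ((\<lambda>y. y /\<^sub>R norm y) -` A \<inter> space ?N)"
    unfolding surface_measure_def by (rule emeasure_distr)
  also have "(\<lambda>y. y /\<^sub>R norm y) -` A \<inter> space ?N = {y \<in> cball 0 1 - {0}. y /\<^sub>R norm y \<in> A}"
    by (auto simp: space_scale_measure space_restrict_space)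
  also have "emeasure ?N {y \<in> cball 0 1 - {0}. y /\<^sub>R norm y \<in> A} = of_nat CARD('n) *
     emeasure (restrict_space lborel (cball 0 1 - {0})) {y \<in> cball 0 1 - {0}. y /\<^sub>R norm y \<in> A}"
    by simp
  also have "emeasure (restrict_space lborel (cball 0 1 - {0})) {y \<in> cball 0 1 - {0}. y /\<^sub>R norm y \<in> A}
     = emeasure lborel {y \<in> cball 0 1 - {0}. y /\<^sub>R norm y \<in> A}"
    by (rule emeasure_restrict_space) auto
  finally show ?thesis .
qed

lemma isotropic_measureI:
  fixes M :: "(real^'n) measure"
  assumes M: "finite_measure M" "space M = S" "sets M = sets (restrict_space borel S)"
    and S: "S \<in> sets borel" "S \<subseteq> cball 0 1" and pos: "0 < measure M S"
    and rot: "\<And>R y. orthogonal_matrix R \<Longrightarrow> R *v y \<in> S \<longleftrightarrow> y \<in> S"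
    and inv: "\<And>R A. orthogonal_matrix R \<Longrightarrow> A \<in> sets borel \<Longrightarrow> A \<subseteq> S \<Longrightarrow> emeasure M {y. R *v y \<in> A} = emeasure M A"
  shows "isotropic_measure M"
proof (intro isotropic_measure.intro isotropic_measure_axioms.intro M(1))
  show "space M \<subseteq> cball 0 1" "sets M = sets (restrict_space borel (space M))" "0 < measure M (space M)"
    unfolding M(2) by (fact S(2), fact M(3), fact pos)
  show "R *v y \<in> space M" if "orthogonal_matrix R" "y \<in> space M" for R y
    using that rot M(2) by simp
  show "distr M M ((*v) R) = M" if R: "orthogonal_matrix R" for R
  proof (rule measure_eqI)
    fix A assume "A \<in> sets (distr M M ((*v) R))"
    then have A: "A \<in> sets M" "A \<in> sets borel" "A \<subseteq> S"
      using S(1) by (auto simp: M(3) sets_restrict_space_iff)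
    have "(*v) R \<in> borel_measurable borel"
      by (intro borel_measurable_continuous_onI matrix_vector_mult_linear_continuous_on)
    then have "(*v) R \<in> measurable (restrict_space borel S) (restrict_space borel S)"
      using rot[OF R] by (intro measurable_restrict_space2 measurable_restrict_space1) (auto simp: space_restrict_space)
    then have mR: "(*v) R \<in> measurable M M" using measurable_cong_sets[OF M(3) M(3)] by blast
    have "(*v) R -` A \<inter> space M = {y. R *v y \<in> A}" using A(3) rot[OF R] M(2) by auto
    then have "emeasure (distr M M ((*v) R)) A = emeasure M {y. R *v y \<in> A}"
      using A(1) by (subst emeasure_distr[OF mR]) auto
    also have "\<dots> = emeasure M A" by (rule inv[OF R A(2,3)])
    finally show "emeasure (distr M M ((*v) R)) A = emeasure M A" .
  qed simp
qed

lemma isotropic_surface_measure: "isotropic_measure (surface_measure :: (real^'n) measure)"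
proof -
  let ?S = "surface_measure :: (real^'n) measure"
  have cone: "{y \<in> cball 0 1 - {0}. y /\<^sub>R norm y \<in> sphere 0 1} = cball 0 1 - {0 :: real^'n}" by auto
  have "emeasure lborel (cball 0 1 - {0 :: real^'n}) = emeasure lborel (cball 0 1 :: (real^'n) set)"
    by (intro emeasure_Diff_null_set) (auto simp: null_sets_def)
  then have total: "emeasure ?S (sphere 0 1) = of_nat CARD('n) * emeasure lborel (cball 0 1 :: (real^'n) set)"
    using emeasure_surface_measure[of "sphere 0 1 :: (real^'n) set"] cone by simp
  have fin: "emeasure lborel (cball 0 1 :: (real^'n) set) < \<infinity>" by (intro emeasure_compact_finite) simp
  then have "emeasure lborel (cball 0 1 :: (real^'n) set) = ennreal (measure lborel (cball 0 1 :: (real^'n) set))"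
    by (intro emeasure_eq_ennreal_measure) auto
  then have posB: "0 < emeasure lborel (cball 0 1 :: (real^'n) set)" using measure_unit_ball_pos by simp
  show ?thesis
  proof (rule isotropic_measureI)
    have finS: "emeasure ?S (sphere 0 1) \<noteq> \<infinity>" using total fin by (simp add: ennreal_mult_eq_top_iff)
    then show "finite_measure ?S" by (intro finite_measureI) (simp add: space_surface_measure)
    from finS have "emeasure ?S (sphere 0 1) = ennreal (measure ?S (sphere 0 1))"
      by (intro emeasure_eq_ennreal_measure) simp
    moreover have "0 < emeasure ?S (sphere 0 1)" using total posB by (simp add: ennreal_zero_less_mult_iff)
    ultimately show "0 < measure ?S (sphere 0 1)" by simp
    fix R :: "real^'n^'n" and A :: "(real^'n) set" assume R: "orthogonal_matrix R" and A: "A \<in> sets borel" "A \<subseteq> sphere 0 1"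
    have "(*v) R \<in> borel_measurable borel"
      by (intro borel_measurable_continuous_onI matrix_vector_mult_linear_continuous_on)
    then have preb: "{y. R *v y \<in> A} \<in> sets borel"
      using measurable_sets[OF _ A(1), of "(*v) R" borel] by (simp add: vimage_def)
    have "emeasure ?S {y. R *v y \<in> A}
        = of_nat CARD('n) * emeasure lborel {y \<in> cball 0 1 - {0}. y /\<^sub>R norm y \<in> {y. R *v y \<in> A}}"
      by (rule emeasure_surface_measure[OF preb]) (use A(2) orthogonal_matrix_norm[OF R] in auto)
    also have "{y \<in> cball 0 1 - {0}. y /\<^sub>R norm y \<in> {y. R *v y \<in> A}}
        = {y. R *v y \<in> {y \<in> cball 0 1 - {0}. y /\<^sub>R norm y \<in> A}}"
    proof -
      have "R *v y = 0 \<longleftrightarrow> y = 0" for y using orthogonal_matrix_norm[OF R, of y] by (metis norm_eq_zero)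
      then show ?thesis by (simp add: orthogonal_matrix_norm[OF R] matrix_vector_mult_scaleR)
    qed
    also have "emeasure lborel \<dots> = emeasure lborel {y \<in> cball 0 1 - {0}. y /\<^sub>R norm y \<in> A}"
      by (rule emeasure_lborel_orthogonal_preimage[OF R sets_normalized_cone[OF A(1)]])
    also have "of_nat CARD('n) * \<dots> = emeasure ?S A"
      by (rule emeasure_surface_measure[OF A, symmetric])
    finally show "emeasure ?S {y. R *v y \<in> A} = emeasure ?S A" .
  qed (auto simp: space_surface_measure sets_surface_measure orthogonal_matrix_norm)
qed

lemma isotropic_unit_ball: "isotropic_measure (restrict_space lborel (cball 0 1) :: (real^'n) measure)"
proof -
  let ?B = "restrict_space lborel (cball 0 1) :: (real^'n) measure"
  have em: "emeasure ?B A = emeasure lborel A" if "A \<subseteq> cball 0 1" for A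
    by (rule emeasure_restrict_space) (use that in auto)
  have fin: "emeasure lborel (cball 0 1 :: (real^'n) set) < \<infinity>" by (intro emeasure_compact_finite) simp
  show ?thesis
  proof (rule isotropic_measureI)
    show "finite_measure ?B" by (rule finite_measureI) (use fin in \<open>simp add: space_restrict_space em\<close>)
    show "0 < measure ?B (cball 0 1)" using measure_unit_ball_pos by (simp add: measure_restrict_space)
    fix R :: "real^'n^'n" and A :: "(real^'n) set" assume R: "orthogonal_matrix R" and A: "A \<in> sets borel" "A \<subseteq> cball 0 1"
    have "emeasure ?B {y. R *v y \<in> A} = emeasure lborel {y. R *v y \<in> A}"
      by (rule em) (use A(2) orthogonal_matrix_norm[OF R] in auto)
    also have "\<dots> = emeasure lborel A" by (rule emeasure_lborel_orthogonal_preimage[OF R A(1)])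
    also have "\<dots> = emeasure ?B A" by (rule em[OF A(2), symmetric])
    finally show "emeasure ?B {y. R *v y \<in> A} = emeasure ?B A" .
  qed (auto simp: space_restrict_space sets_restrict_space orthogonal_matrix_norm)
qed

section \<open>Radial averages\<close>

lemma (in isotropic_measure) integral_diff_bound:
  fixes v v' :: "real^'n \<Rightarrow> real"
  assumes v: "continuous_on (cball 0 R) v" and v': "continuous_on (cball 0 R) v'" and r: "0 \<le> r" "r \<le> R"
    and le: "\<And>x. x \<in> cball 0 R \<Longrightarrow> \<bar>v x - v' x\<bar> \<le> \<epsilon>"
  shows "\<bar>(\<integral>y. v (r *\<^sub>R y) \<partial>M) - (\<integral>y. v' (r *\<^sub>R y) \<partial>M)\<bar> \<le> \<epsilon> * measure M (space M)"
proof -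
  note int = integrable_scaled[OF v r] integrable_scaled[OF v' r]
  have bd: "\<bar>v (r *\<^sub>R y) - v' (r *\<^sub>R y)\<bar> \<le> \<epsilon>" if "y \<in> space M" for y
  proof (rule le)
    have "norm y \<le> 1" using that space_subset by auto
    then have "r * norm y \<le> R * 1" using r by (intro mult_mono) auto
    then show "r *\<^sub>R y \<in> cball 0 R" using r by simp
  qed
  have "(\<integral>y. v (r *\<^sub>R y) \<partial>M) \<le> (\<integral>y. v' (r *\<^sub>R y) + \<epsilon> \<partial>M)"
  proof (rule integral_mono)
    show "v (r *\<^sub>R y) \<le> v' (r *\<^sub>R y) + \<epsilon>" if "y \<in> space M" for y using bd[OF that] by linarith
  qed (use int in simp_all)
  moreover have "(\<integral>y. v' (r *\<^sub>R y) \<partial>M) \<le> (\<integral>y. v (r *\<^sub>R y) + \<epsilon> \<partial>M)"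
  proof (rule integral_mono)
    show "v' (r *\<^sub>R y) \<le> v (r *\<^sub>R y) + \<epsilon>" if "y \<in> space M" for y using bd[OF that] by linarith
  qed (use int in simp_all)
  moreover have "(\<integral>y. v' (r *\<^sub>R y) + \<epsilon> \<partial>M) = (\<integral>y. v' (r *\<^sub>R y) \<partial>M) + \<epsilon> * measure M (space M)"
    "(\<integral>y. v (r *\<^sub>R y) + \<epsilon> \<partial>M) = (\<integral>y. v (r *\<^sub>R y) \<partial>M) + \<epsilon> * measure M (space M)"
    using int by (simp_all add: mult.commute)
  ultimately show ?thesis by linarith
qed

lemma unit_ball_integral_zero:
  fixes \<phi> :: "real^'n \<Rightarrow> real"
  assumes \<phi>: "continuous_on (cball 0 1) \<phi>" "\<And>x. 0 \<le> \<phi> x"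
    and zero: "(\<integral>y. \<phi> y \<partial>restrict_space lborel (cball 0 1)) = 0" and x: "x \<in> ball 0 1"
  shows "\<phi> x = 0"
proof -
  interpret B: isotropic_measure "restrict_space lborel (cball 0 1) :: (real^'n) measure"
    by (rule isotropic_unit_ball)
  have "integrable (restrict_space lborel (cball 0 1)) \<phi>"
    using B.integrable_scaled[OF \<phi>(1), of 1] by simp
  then have "AE y in restrict_space lborel (cball 0 1). \<phi> y = 0"
    using zero \<phi>(2) by (subst (asm) integral_nonneg_eq_0_iff_AE) auto
  then have ae: "AE y in lborel. y \<in> cball 0 1 \<longrightarrow> \<phi> y = 0"
    by (subst (asm) AE_restrict_space_iff) auto
  define U where "U = ball 0 1 \<inter> \<phi> -` (- {0})"
  have "continuous_on (ball 0 1) \<phi>" using \<phi>(1) by (rule continuous_on_subset) auto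
  then have U: "open U" unfolding U_def by (rule continuous_open_preimage) auto
  have "emeasure lborel U = 0"
  proof -
    have "AE y in lborel. y \<notin> U" using ae by (rule AE_mp) (auto simp: U_def)
    moreover have "U \<in> sets borel" using U by simp
    ultimately show ?thesis by (subst (asm) AE_iff_measurable[of U]) auto
  qed
  then have "negligible U"
    using U by (simp add: negligible_iff_null_sets null_sets_def)
  then have "U = {}" using open_not_negligible[OF U] by blast
  then show ?thesis using x unfolding U_def by auto
qed

context riesz_cone
begin

text \<open>The function \<open>f\<close> is the element of least \<open>L\<^sup>2\<close> norm in the set \<open>A\<close> of subsolutions with the bound, the
  modulus of continuity and the averages of \<open>w\<close>. The set \<open>A\<close> is compact in the uniform norm on the closed ball by the
  theorem of Arzela and Ascoli, is closed under midpoints, and is invariant under the group.\<close>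

lemma radial_average:
  fixes w :: "real^'n \<Rightarrow> real"
  assumes conv: "convex F" and R: "0 < R" and w: "continuous_on (cball 0 R) w"
    and sub: "subsolution F (ball 0 R) (\<lambda>x. ereal (w x))"
  obtains f where "continuous_on (cball 0 R) f" "subsolution F (ball 0 R) (\<lambda>x. ereal (f x))"
    "\<And>x y. x \<in> ball 0 R \<Longrightarrow> norm y = norm x \<Longrightarrow> f y = f x"
    "\<And>M r. isotropic_measure M \<Longrightarrow> 0 \<le> r \<Longrightarrow> r \<le> R \<Longrightarrow> (\<integral>y. f (r *\<^sub>R y) \<partial>M) = (\<integral>y. w (r *\<^sub>R y) \<partial>M)"
proof -
  let ?C = "cball 0 R :: (real^'n) set"
  obtain G where G: "orthogonal_subgroup G"
    "\<And>x y. norm x = 1 \<Longrightarrow> norm y = 1 \<Longrightarrow> \<exists>g\<in>G. g *v x = y"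
    "\<And>g A. g \<in> G \<Longrightarrow> A \<in> F \<Longrightarrow> g ** A ** transpose g \<in> F"
    using ST_invariant unfolding ST_invariant_def by auto
  have Go: "orthogonal_matrix g" if "g \<in> G" for g using G(1) that unfolding orthogonal_subgroup_def by blast
  have GF: "transpose g ** A ** g \<in> F" if "g \<in> G" "A \<in> F" for g A
  proof -
    have "matrix_inv g \<in> G" using G(1) that(1) unfolding orthogonal_subgroup_def by blast
    then have "transpose g \<in> G" using matrix_inv_orthogonal[OF Go[OF that(1)]] by simp
    from G(3)[OF this that(2)] show ?thesis by simp
  qed
  have "uniformly_continuous_on ?C w" using w by (rule compact_uniformly_continuous) simp
  then have "\<forall>\<epsilon>. \<exists>d. \<epsilon> > 0 \<longrightarrow> d > 0 \<and> (\<forall>x\<in>?C. \<forall>y\<in>?C. dist x y < d \<longrightarrow> dist (w x) (w y) < \<epsilon>)"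
    unfolding uniformly_continuous_on_def by (metis dist_commute)
  then obtain d where d: "\<And>\<epsilon>. \<epsilon> > 0 \<Longrightarrow> d \<epsilon> > 0 \<and> (\<forall>x\<in>?C. \<forall>y\<in>?C. dist x y < d \<epsilon> \<longrightarrow> dist (w x) (w y) < \<epsilon>)"
    by metis
  have "compact (w ` ?C)" using w by (intro compact_continuous_image) auto
  then obtain C where C: "\<And>z. z \<in> w ` ?C \<Longrightarrow> norm z \<le> C" using compact_imp_bounded bounded_iff by metis
  have "0 \<le> C" using C[of "w 0"] R by force
  \<comment> \<open>The modulus of continuity \<open>d\<close> of \<open>w\<close> is imposed on all competitors, which makes them equicontinuous.\<close>
  define equi where "equi v \<longleftrightarrow> (\<forall>\<epsilon>>0. \<forall>x\<in>?C. \<forall>y\<in>?C. dist x y < d \<epsilon> \<longrightarrow> \<bar>v x - v y\<bar> \<le> \<epsilon>)"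
    for v :: "real^'n \<Rightarrow> real"
  define same where "same v \<longleftrightarrow> (\<forall>M r. isotropic_measure M \<longrightarrow> 0 \<le> r \<longrightarrow> r \<le> R \<longrightarrow>
     (\<integral>y. v (r *\<^sub>R y) \<partial>M) = (\<integral>y. w (r *\<^sub>R y) \<partial>M))" for v
  define A where "A = {v. equi v \<and> (\<forall>x\<in>?C. \<bar>v x\<bar> \<le> C) \<and> subsolution F (ball 0 R) (\<lambda>x. ereal (v x)) \<and> same v}"
  have equi_cont: "continuous_on ?C v" if "equi v" for v
    unfolding continuous_on_iff
  proof (intro ballI allI impI)
    fix x and \<epsilon> :: real assume x: "x \<in> ?C" and "0 < \<epsilon>"
    then have "0 < \<epsilon> / 2" "\<epsilon> / 2 < \<epsilon>" by simp_all
    have "d (\<epsilon> / 2) > 0" using d[OF \<open>0 < \<epsilon> / 2\<close>] by blast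
    moreover have "dist (v y) (v x) < \<epsilon>" if "y \<in> ?C" "dist y x < d (\<epsilon> / 2)" for y
    proof -
      have "\<bar>v y - v x\<bar> \<le> \<epsilon> / 2"
        using \<open>equi v\<close> \<open>0 < \<epsilon> / 2\<close> x that unfolding equi_def by blast
      then show ?thesis using \<open>\<epsilon> / 2 < \<epsilon>\<close> by (simp add: dist_real_def)
    qed
    ultimately show "\<exists>d>0. \<forall>y\<in>?C. dist y x < d \<longrightarrow> dist (v y) (v x) < \<epsilon>" by blast
  qed
  have A_cont: "continuous_on ?C v" if "v \<in> A" for v using that equi_cont unfolding A_def by blast
  have A_bd: "\<bar>v x\<bar> \<le> C" if "v \<in> A" "x \<in> ?C" for v x using that unfolding A_def by blast
  have wA: "w \<in> A"
  proof -
    have "equi w" unfolding equi_def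
    proof (intro allI impI ballI)
      fix \<epsilon> :: real and x y assume "0 < \<epsilon>" "x \<in> ?C" "y \<in> ?C" "dist x y < d \<epsilon>"
      then have "dist (w x) (w y) < \<epsilon>" using d[of \<epsilon>] by blast
      then show "\<bar>w x - w y\<bar> \<le> \<epsilon>" by (simp add: dist_real_def)
    qed
    moreover have "\<forall>x\<in>?C. \<bar>w x\<bar> \<le> C" using C by auto
    ultimately show ?thesis using sub unfolding A_def same_def by simp
  qed
  have A_lim: "v \<in> A" if lim: "\<And>\<epsilon>. 0 < \<epsilon> \<Longrightarrow> \<exists>v'\<in>A. \<forall>x\<in>?C. \<bar>v' x - v x\<bar> \<le> \<epsilon>" for v
  proof -
    have eq: "equi v" unfolding equi_def
    proof (intro allI impI ballI)
      fix \<epsilon> :: real and x y assume xy: "0 < \<epsilon>" "x \<in> ?C" "y \<in> ?C" "dist x y < d \<epsilon>"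
      have "\<bar>v x - v y\<bar> \<le> \<epsilon> + \<epsilon>'" if "0 < \<epsilon>'" for \<epsilon>'
      proof -
        have "0 < \<epsilon>' / 2" using that by simp
        then obtain v' where v': "v' \<in> A" "\<forall>x\<in>?C. \<bar>v' x - v x\<bar> \<le> \<epsilon>' / 2" using lim by blast
        have "\<bar>v' x - v' y\<bar> \<le> \<epsilon>" using v'(1) xy unfolding A_def equi_def by blast
        moreover have "\<bar>v' x - v x\<bar> \<le> \<epsilon>' / 2" "\<bar>v' y - v y\<bar> \<le> \<epsilon>' / 2" using v'(2) xy by blast+
        ultimately show ?thesis by linarith
      qed
      then show "\<bar>v x - v y\<bar> \<le> \<epsilon>" by (rule field_le_epsilon)
    qed
    have bd: "\<bar>v x\<bar> \<le> C" if x: "x \<in> ?C" for x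
    proof (rule field_le_epsilon)
      fix \<epsilon> :: real assume "0 < \<epsilon>"
      then obtain v' where v': "v' \<in> A" "\<forall>x\<in>?C. \<bar>v' x - v x\<bar> \<le> \<epsilon>" using lim by blast
      then have "\<bar>v' x - v x\<bar> \<le> \<epsilon>" using x by blast
      then show "\<bar>v x\<bar> \<le> C + \<epsilon>" using A_bd[OF v'(1) x] by linarith
    qed
    have sb: "subsolution F (ball 0 R) (\<lambda>x. ereal (v x))"
    proof (rule uniform_limit_subsolution)
      show "continuous_on (ball 0 R) v" using equi_cont[OF eq] by (rule continuous_on_subset) auto
      fix \<epsilon> :: real assume "0 < \<epsilon>"
      then obtain v' where v': "v' \<in> A" "\<forall>x\<in>?C. \<bar>v' x - v x\<bar> \<le> \<epsilon>" using lim by blast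
      then have "subsolution F (ball 0 R) (\<lambda>x. ereal (v' x))" unfolding A_def by blast
      with v'(2) show "\<exists>w. subsolution F (ball 0 R) (\<lambda>x. ereal (w x)) \<and> (\<forall>x\<in>ball 0 R. \<bar>w x - v x\<bar> \<le> \<epsilon>)"
        by (intro exI[of _ v']) auto
    qed simp
    have sm: "same v" unfolding same_def
    proof (intro allI impI)
      fix M :: "(real^'n) measure" and r assume M: "isotropic_measure M" and r: "0 \<le> r" "r \<le> R"
      interpret isotropic_measure M by (rule M)
      have "\<bar>(\<integral>y. v (r *\<^sub>R y) \<partial>M) - (\<integral>y. w (r *\<^sub>R y) \<partial>M)\<bar> \<le> 0 + \<epsilon>" if "0 < \<epsilon>" for \<epsilon>
      proof -
        define \<epsilon>' where "\<epsilon>' = \<epsilon> / measure M (space M)"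
        have "0 < \<epsilon>'" using that pos unfolding \<epsilon>'_def by simp
        then obtain v' where v': "v' \<in> A" "\<forall>x\<in>?C. \<bar>v' x - v x\<bar> \<le> \<epsilon>'" using lim by blast
        have "\<bar>(\<integral>y. v' (r *\<^sub>R y) \<partial>M) - (\<integral>y. v (r *\<^sub>R y) \<partial>M)\<bar> \<le> \<epsilon>' * measure M (space M)"
          by (rule integral_diff_bound[OF A_cont[OF v'(1)] equi_cont[OF eq] r]) (use v'(2) in blast)
        moreover have "(\<integral>y. v' (r *\<^sub>R y) \<partial>M) = (\<integral>y. w (r *\<^sub>R y) \<partial>M)"
          using v'(1) M r unfolding A_def same_def by blast
        moreover have "\<epsilon>' * measure M (space M) = \<epsilon>" using pos unfolding \<epsilon>'_def by simp
        ultimately show ?thesis by linarith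
      qed
      then have "\<bar>(\<integral>y. v (r *\<^sub>R y) \<partial>M) - (\<integral>y. w (r *\<^sub>R y) \<partial>M)\<bar> \<le> 0" by (rule field_le_epsilon)
      then show "(\<integral>y. v (r *\<^sub>R y) \<partial>M) = (\<integral>y. w (r *\<^sub>R y) \<partial>M)" by simp
    qed
    show ?thesis unfolding A_def using eq bd sb sm by blast
  qed
  have A_rot: "(\<lambda>x. v (g *v x)) \<in> A" if v: "v \<in> A" and g: "g \<in> G" for v g
  proof -
    note o = orthogonal_matrix_norm[OF Go[OF g]]
    have "equi (\<lambda>x. v (g *v x))" unfolding equi_def
    proof (intro allI impI ballI)
      fix \<epsilon> :: real and x y assume xy: "0 < \<epsilon>" "x \<in> ?C" "y \<in> ?C" "dist x y < d \<epsilon>"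
      have "dist (g *v x) (g *v y) < d \<epsilon>"
        using xy(4) o[of "x - y"] by (simp add: dist_norm matrix_vector_mult_diff_distrib)
      moreover have "g *v x \<in> ?C" "g *v y \<in> ?C" using xy o by simp_all
      ultimately show "\<bar>v (g *v x) - v (g *v y)\<bar> \<le> \<epsilon>"
        using v xy(1) unfolding A_def equi_def by blast
    qed
    moreover have "\<forall>x\<in>?C. \<bar>v (g *v x)\<bar> \<le> C" using A_bd[OF v] o by simp
    moreover have "subsolution F (ball 0 R) (\<lambda>x. ereal (v (g *v x)))"
    proof -
      have "subsolution F (ball 0 R) (\<lambda>x. ereal (v x))" using v unfolding A_def by blast
      from subsolution_isometry[OF this Go[OF g], of 0] GF[OF g]
      have "subsolution F {x. g *v x \<in> ball 0 R} (\<lambda>x. ereal (v (g *v x)))" by simp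
      moreover have "{x. g *v x \<in> ball 0 R} = ball 0 R" using o by auto
      ultimately show ?thesis by simp
    qed
    moreover have "same (\<lambda>x. v (g *v x))" unfolding same_def
    proof (intro allI impI)
      fix M :: "(real^'n) measure" and r assume M: "isotropic_measure M" and r: "0 \<le> r" "r \<le> R"
      interpret isotropic_measure M by (rule M)
      have "(\<integral>y. v (g *v (r *\<^sub>R y)) \<partial>M) = (\<integral>y. v (r *\<^sub>R (g *v y)) \<partial>M)"
        by (simp add: matrix_vector_mult_scaleR)
      also have "\<dots> = (\<integral>y. v (r *\<^sub>R y) \<partial>M)"
        by (rule integral_rotate[OF Go[OF g] borel_measurable_M[OF continuous_on_scaled[OF A_cont[OF v] r]]])
      also have "\<dots> = (\<integral>y. w (r *\<^sub>R y) \<partial>M)" using v M r unfolding A_def same_def by blast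
      finally show "(\<integral>y. v (g *v (r *\<^sub>R y)) \<partial>M) = (\<integral>y. w (r *\<^sub>R y) \<partial>M)" .
    qed
    ultimately show ?thesis unfolding A_def by blast
  qed
  have A_mid: "(\<lambda>x. (v1 x + v2 x) / 2) \<in> A" if v: "v1 \<in> A" "v2 \<in> A" for v1 v2
  proof -
    have "equi (\<lambda>x. (v1 x + v2 x) / 2)" unfolding equi_def
    proof (intro allI impI ballI)
      fix \<epsilon> :: real and x y assume xy: "0 < \<epsilon>" "x \<in> ?C" "y \<in> ?C" "dist x y < d \<epsilon>"
      have "\<bar>v1 x - v1 y\<bar> \<le> \<epsilon>" "\<bar>v2 x - v2 y\<bar> \<le> \<epsilon>"
        using v xy unfolding A_def equi_def by blast+
      then have le: "\<bar>(v1 x - v1 y) + (v2 x - v2 y)\<bar> \<le> 2 * \<epsilon>" by linarith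
      have eq: "(v1 x + v2 x) / 2 - (v1 y + v2 y) / 2 = ((v1 x - v1 y) + (v2 x - v2 y)) / 2"
        by (simp add: field_simps)
      show "\<bar>(v1 x + v2 x) / 2 - (v1 y + v2 y) / 2\<bar> \<le> \<epsilon>"
        unfolding eq using le by simp
    qed
    moreover have "\<bar>(v1 x + v2 x) / 2\<bar> \<le> C" if "x \<in> ?C" for x
    proof -
      have "\<bar>v1 x + v2 x\<bar> \<le> 2 * C" using A_bd[OF v(1) that] A_bd[OF v(2) that] by linarith
      then show ?thesis by simp
    qed
    moreover have "subsolution F (ball 0 R) (\<lambda>x. ereal ((v1 x + v2 x) / 2))"
    proof (rule midpoint_subsolution[OF conv])
      show "continuous_on (ball 0 R) v1" "continuous_on (ball 0 R) v2"
        using A_cont[OF v(1)] A_cont[OF v(2)] by (auto intro: continuous_on_subset)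
    qed (use v in \<open>simp_all add: A_def\<close>)
    moreover have "same (\<lambda>x. (v1 x + v2 x) / 2)" unfolding same_def
    proof (intro allI impI)
      fix M :: "(real^'n) measure" and r assume M: "isotropic_measure M" and r: "0 \<le> r" "r \<le> R"
      interpret isotropic_measure M by (rule M)
      have "(\<integral>y. v1 (r *\<^sub>R y) \<partial>M) = (\<integral>y. w (r *\<^sub>R y) \<partial>M)" "(\<integral>y. v2 (r *\<^sub>R y) \<partial>M) = (\<integral>y. w (r *\<^sub>R y) \<partial>M)"
        using v M r unfolding A_def same_def by blast+
      moreover have "(\<integral>y. (v1 (r *\<^sub>R y) + v2 (r *\<^sub>R y)) / 2 \<partial>M)
          = ((\<integral>y. v1 (r *\<^sub>R y) \<partial>M) + (\<integral>y. v2 (r *\<^sub>R y) \<partial>M)) / 2"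
        using integrable_scaled[OF A_cont[OF v(1)] r] integrable_scaled[OF A_cont[OF v(2)] r] by simp
      ultimately show "(\<integral>y. (v1 (r *\<^sub>R y) + v2 (r *\<^sub>R y)) / 2 \<partial>M) = (\<integral>y. w (r *\<^sub>R y) \<partial>M)" by simp
    qed
    ultimately show ?thesis unfolding A_def by blast
  qed
  let ?B = "restrict_space lborel (cball 0 1) :: (real^'n) measure"
  interpret B: isotropic_measure ?B by (rule isotropic_unit_ball)
  \<comment> \<open>The square of the \<open>L\<^sup>2\<close> norm over \<open>cball 0 R\<close>, up to a constant factor.\<close>
  define J where "J v = (\<integral>y. (v (R *\<^sub>R y))\<^sup>2 \<partial>?B)" for v :: "real^'n \<Rightarrow> real"
  have RR: "0 \<le> R" "R \<le> R" using R by simp_all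
  have J_nonneg: "0 \<le> J v" for v unfolding J_def by simp
  have J_int: "integrable ?B (\<lambda>y. (v (R *\<^sub>R y))\<^sup>2)" if "continuous_on ?C v" for v :: "real^'n \<Rightarrow> real"
    using B.integrable_scaled[of R "\<lambda>x. (v x)\<^sup>2" R] that RR by (simp add: continuous_on_power)
  have bdd: "bdd_below (J ` A)" using J_nonneg by (intro bdd_belowI[of _ 0]) auto
  define J0 where "J0 = Inf (J ` A)"
  have J0_le: "J0 \<le> J v" if "v \<in> A" for v unfolding J0_def using that bdd by (intro cInf_lower) auto
  have "\<exists>v\<in>A. J v < J0 + 1 / real (Suc n)" for n
  proof -
    have "Inf (J ` A) < J0 + 1 / real (Suc n)" unfolding J0_def by simp
    then show ?thesis using wA bdd by (subst (asm) cInf_less_iff) auto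
  qed
  then obtain v where v: "\<And>n. v n \<in> A" "\<And>n. J (v n) < J0 + 1 / real (Suc n)" by metis
  obtain f k where f: "continuous_on ?C f" and k: "strict_mono (k :: nat \<Rightarrow> nat)"
    and conv_f: "\<And>\<epsilon>. 0 < \<epsilon> \<Longrightarrow> \<exists>N. \<forall>n x. n \<ge> N \<and> x \<in> ?C \<longrightarrow> norm (v (k n) x - f x) < \<epsilon>"
  proof (rule Arzela_Ascoli[of ?C v C])
    show "norm (v n x) \<le> C" if "x \<in> ?C" for n x using A_bd[OF v(1) that] by simp
    show "\<exists>\<delta>>0. \<forall>n y. y \<in> ?C \<and> norm (x - y) < \<delta> \<longrightarrow> norm (v n x - v n y) < \<epsilon>"
      if x: "x \<in> ?C" and "0 < \<epsilon>" for x \<epsilon>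
    proof -
      have e: "0 < \<epsilon> / 2" "\<epsilon> / 2 < \<epsilon>" using \<open>0 < \<epsilon>\<close> by simp_all
      have "d (\<epsilon> / 2) > 0" using d[OF e(1)] by blast
      moreover have "norm (v n x - v n y) < \<epsilon>" if "y \<in> ?C" "norm (x - y) < d (\<epsilon> / 2)" for n y
      proof -
        have "\<bar>v n x - v n y\<bar> \<le> \<epsilon> / 2"
          using v(1)[of n] x that e(1) unfolding A_def equi_def dist_norm by blast
        then show ?thesis using e(2) by simp
      qed
      ultimately show ?thesis by blast
    qed
  qed auto
  have close: "\<exists>n\<ge>N. \<forall>x\<in>?C. \<bar>v (k n) x - f x\<bar> \<le> \<epsilon>" if \<epsilon>: "0 < \<epsilon>" for \<epsilon> N
  proof -
    obtain N' where "\<forall>n x. n \<ge> N' \<and> x \<in> ?C \<longrightarrow> norm (v (k n) x - f x) < \<epsilon>" using conv_f[OF \<epsilon>] by blast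
    then have "\<forall>x\<in>?C. \<bar>v (k (max N N')) x - f x\<bar> \<le> \<epsilon>" by (simp add: less_imp_le)
    then show ?thesis by (intro exI[of _ "max N N'"]) simp
  qed
  have fA: "f \<in> A"
  proof (rule A_lim)
    fix \<epsilon> :: real assume "0 < \<epsilon>"
    then obtain n where "\<forall>x\<in>?C. \<bar>v (k n) x - f x\<bar> \<le> \<epsilon>" using close by blast
    then show "\<exists>v'\<in>A. \<forall>x\<in>?C. \<bar>v' x - f x\<bar> \<le> \<epsilon>" using v(1) by blast
  qed
  have Jf: "J f \<le> J0"
  proof (rule field_le_epsilon)
    fix \<epsilon> :: real assume \<epsilon>: "0 < \<epsilon>"
    define m where "m = measure ?B (space ?B)"
    have m: "m > 0" using B.pos unfolding m_def .
    define \<epsilon>' where "\<epsilon>' = \<epsilon> / (4 * (C + 1) * m)"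
    have \<epsilon>': "\<epsilon>' > 0" using \<epsilon> m \<open>0 \<le> C\<close> unfolding \<epsilon>'_def by simp
    obtain N where N: "1 / real (Suc N) < \<epsilon> / 2" using nat_approx_posE[of "\<epsilon> / 2"] \<epsilon> by auto
    obtain n where n: "n \<ge> N" "\<forall>x\<in>?C. \<bar>v (k n) x - f x\<bar> \<le> \<epsilon>'" using close[OF \<epsilon>'] by blast
    have "N \<le> k n" using n(1) k strict_mono_imp_increasing by (meson le_trans)
    then have "1 / real (Suc (k n)) \<le> 1 / real (Suc N)" by (simp add: frac_le)
    then have J1: "J (v (k n)) < J0 + \<epsilon> / 2" using v(2)[of "k n"] N by linarith
    have sq: "\<bar>(f x)\<^sup>2 - (v (k n) x)\<^sup>2\<bar> \<le> \<epsilon>' * (2 * (C + 1))" if x: "x \<in> ?C" for x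
    proof -
      have "(f x)\<^sup>2 - (v (k n) x)\<^sup>2 = (f x - v (k n) x) * (f x + v (k n) x)"
        by (simp add: power2_eq_square algebra_simps)
      moreover have "\<bar>f x - v (k n) x\<bar> \<le> \<epsilon>'" using n(2) x by (simp add: abs_minus_commute)
      moreover have "\<bar>f x + v (k n) x\<bar> \<le> 2 * (C + 1)"
        using A_bd[OF fA x] A_bd[OF v(1) x, of "k n"] abs_triangle_ineq[of "f x" "v (k n) x"]
        unfolding distrib_left by linarith
      ultimately show ?thesis using \<epsilon>' by (simp add: abs_mult mult_mono)
    qed
    have "\<bar>J f - J (v (k n))\<bar> \<le> \<epsilon>' * (2 * (C + 1)) * m"
      unfolding J_def m_def
      by (rule B.integral_diff_bound[of R "\<lambda>x. (f x)\<^sup>2" "\<lambda>x. (v (k n) x)\<^sup>2" R])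
        (use sq RR A_cont[OF fA] A_cont[OF v(1)] in \<open>auto intro: continuous_on_power\<close>)
    also have "\<dots> = \<epsilon> / 2"
    proof -
      have "\<epsilon> / (4 * q * m) * (2 * q) * m = \<epsilon> / 2" if "0 < q" for q
        using that m by (simp add: field_simps)
      from this[of "C + 1"] show ?thesis using \<open>0 \<le> C\<close> unfolding \<epsilon>'_def by simp
    qed
    finally show "J f \<le> J0 + \<epsilon>" using J1 by linarith
  qed
  have inv: "f (g *v x) = f x" if g: "g \<in> G" and x: "x \<in> ball 0 R" for g x
  proof -
    define h where "h x = f (g *v x)" for x
    have hA: "h \<in> A" unfolding h_def[abs_def] by (rule A_rot[OF fA g])
    have hf: "continuous_on ?C (\<lambda>x. (f x - h x)\<^sup>2)"
      using A_cont[OF fA] A_cont[OF hA] by (intro continuous_intros)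
    have "J h = J f"
    proof -
      have "J h = (\<integral>y. (\<lambda>y. (f (R *\<^sub>R y))\<^sup>2) (g *v y) \<partial>?B)"
        unfolding J_def h_def by (simp add: matrix_vector_mult_scaleR)
      also have "\<dots> = J f" unfolding J_def
        by (rule B.integral_rotate[OF Go[OF g]])
          (use J_int[OF A_cont[OF fA]] in simp)
      finally show ?thesis .
    qed
    \<comment> \<open>The parallelogram identity.\<close>
    have "J (\<lambda>x. (f x + h x) / 2) = (\<integral>y. ((f (R *\<^sub>R y))\<^sup>2 + (h (R *\<^sub>R y))\<^sup>2) / 2 - (f (R *\<^sub>R y) - h (R *\<^sub>R y))\<^sup>2 / 4 \<partial>?B)"
      unfolding J_def by (rule Bochner_Integration.integral_cong) (auto simp: power2_eq_square field_simps)
    also have "\<dots> = (J f + J h) / 2 - (\<integral>y. (f (R *\<^sub>R y) - h (R *\<^sub>R y))\<^sup>2 \<partial>?B) / 4"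
      unfolding J_def using J_int[OF A_cont[OF fA]] J_int[OF A_cont[OF hA]] B.integrable_scaled[OF hf RR] by simp
    finally have "(\<integral>y. (f (R *\<^sub>R y) - h (R *\<^sub>R y))\<^sup>2 \<partial>?B) \<le> 0"
      using J0_le[OF A_mid[OF fA hA]] Jf \<open>J h = J f\<close> by simp
    moreover have "0 \<le> (\<integral>y. (f (R *\<^sub>R y) - h (R *\<^sub>R y))\<^sup>2 \<partial>?B)" by simp
    ultimately have zero: "(\<integral>y. (f (R *\<^sub>R y) - h (R *\<^sub>R y))\<^sup>2 \<partial>?B) = 0" by linarith
    have "continuous_on (cball 0 1) (\<lambda>y. (f (R *\<^sub>R y) - h (R *\<^sub>R y))\<^sup>2)"
      using B.continuous_on_scaled[OF hf RR] by (simp add: space_restrict_space)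
    then have "(f (R *\<^sub>R (x /\<^sub>R R)) - h (R *\<^sub>R (x /\<^sub>R R)))\<^sup>2 = 0"
      by (rule unit_ball_integral_zero)
        (use zero x R in \<open>auto simp: field_simps divide_less_eq_1\<close>)
    then show ?thesis using R unfolding h_def by simp
  qed
  show thesis
  proof (rule that[of f])
    show "continuous_on ?C f" by (rule f)
    show "subsolution F (ball 0 R) (\<lambda>x. ereal (f x))" using fA unfolding A_def by blast
    show "f y = f x" if "x \<in> ball 0 R" "norm y = norm x" for x y
    proof (cases "x = 0")
      case False
      then have "norm (x /\<^sub>R norm x) = 1" "norm (y /\<^sub>R norm x) = 1" using that(2) by simp_all
      then obtain g where g: "g \<in> G" "g *v (x /\<^sub>R norm x) = y /\<^sub>R norm x" using G(2) by blast
      then have "g *v x = y" using False by (simp add: matrix_vector_mult_scaleR)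
      then show ?thesis using inv[OF g(1) that(1)] by simp
    qed (use that in simp)
    show "(\<integral>y. f (r *\<^sub>R y) \<partial>M) = (\<integral>y. w (r *\<^sub>R y) \<partial>M)"
      if "isotropic_measure M" "0 \<le> r" "r \<le> R" for M r
      using fA that unfolding A_def same_def by blast
  qed
qed

text \<open>The comparison functions are a constant minus a small multiple of \<open>|y|\<^sup>2\<close>, whose Hessian is a negative
  multiple of the identity.\<close>

lemma radial_subsolution_increasing:
  fixes f :: "real^'n \<Rightarrow> real"
  assumes f: "continuous_on (cball 0 R) f" "subsolution F (ball 0 R) (\<lambda>x. ereal (f x))"
    and rad: "\<And>x y. x \<in> ball 0 R \<Longrightarrow> norm y = norm x \<Longrightarrow> f y = f x"
    and x: "norm x \<le> r" "0 < r" "r < R"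
  shows "f x \<le> f (r *\<^sub>R e)"
proof -
  have "f x \<le> f (r *\<^sub>R e) + \<epsilon>" if "0 < \<epsilon>" for \<epsilon>
  proof -
    define \<delta> where "\<delta> = \<epsilon> / r\<^sup>2"
    have \<delta>: "\<delta> > 0" "\<delta> * r\<^sup>2 = \<epsilon>" using that x unfolding \<delta>_def by simp_all
    define \<psi> where "\<psi> y = (f (r *\<^sub>R e) + \<epsilon>) + (- \<delta>) * (norm (y - 0))\<^sup>2" for y :: "real^'n"
    have C2: "C2_with UNIV \<psi> (\<lambda>y. 0 + (- \<delta>) *\<^sub>R (2 *\<^sub>R (y - 0))) (\<lambda>y. 0 + (- \<delta>) *\<^sub>R (2 *\<^sub>R mat 1))"
      unfolding \<psi>_def[abs_def] by (intro C2_with_add C2_with_cmult C2_with_norm_square C2_with_const)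
    have "ereal (f x) \<le> ereal (\<psi> x)"
    proof (rule subsolution_comparison[OF f(2), where C = "cball 0 r" and D = "ball 0 r"])
      show "C2_with (ball 0 r) \<psi> (\<lambda>y. 0 + (- \<delta>) *\<^sub>R (2 *\<^sub>R (y - 0))) (\<lambda>y. 0 + (- \<delta>) *\<^sub>R (2 *\<^sub>R mat 1))"
        using C2 by (rule C2_with_subset) simp
      show "continuous_on (cball 0 r) \<psi>" using C2_with_continuous_on[OF C2] by (rule continuous_on_subset) simp
      show "0 + (- \<delta>) *\<^sub>R (2 *\<^sub>R mat 1) \<notin> F"
        using negative_identity_notin_F[of "- (2 * \<delta>)"] \<delta> by (simp add: mult.commute)
      show "ereal (f y) \<le> ereal (\<psi> y)" if "y \<in> cball 0 r - ball 0 r" for y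
      proof -
        have "norm y = r" using that by auto
        moreover from this have "f y = f (r *\<^sub>R e)" using x norm_e by (intro rad) auto
        ultimately show ?thesis unfolding \<psi>_def using \<delta> by simp
      qed
    qed (use x in auto)
    moreover have "\<psi> x \<le> f (r *\<^sub>R e) + \<epsilon>" unfolding \<psi>_def using \<delta> by simp
    ultimately show ?thesis by simp
  qed
  then show ?thesis by (rule field_le_epsilon)
qed

text \<open>For the radial average \<open>f\<close> of \<open>w\<close>, the maximum over a ball is the value on its boundary, so the results on
  maxima apply to the profile \<open>S\<close> of \<open>f\<close>. For the surface measure \<open>|y| = 1\<close>, so that \<open>S r\<close> is a spherical average of \<open>w\<close>.\<close>

lemma radial_profile:
  fixes w :: "real^'n \<Rightarrow> real"
  assumes conv: "convex F" and R: "0 < R" and w: "continuous_on (cball 0 R) w"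
    and sub: "subsolution F (ball 0 R) (\<lambda>x. ereal (w x))"
  obtains S where "kernel_convex p R S" "continuous_on {0..R} S" "\<And>r. 0 \<le> r \<Longrightarrow> r < R \<Longrightarrow> w 0 \<le> S r"
    "\<And>M r. isotropic_measure M \<Longrightarrow> 0 \<le> r \<Longrightarrow> r < R \<Longrightarrow>
       (\<integral>y. w (r *\<^sub>R y) \<partial>M) = (\<integral>y. S (r * norm y) \<partial>M)"
proof -
  obtain f where f: "continuous_on (cball 0 R) f" "subsolution F (ball 0 R) (\<lambda>x. ereal (f x))"
    and rad: "\<And>x y. x \<in> ball 0 R \<Longrightarrow> norm y = norm x \<Longrightarrow> f y = f x"
    and same: "\<And>M r. isotropic_measure M \<Longrightarrow> 0 \<le> r \<Longrightarrow> r \<le> R \<Longrightarrow>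
       (\<integral>y. f (r *\<^sub>R y) \<partial>M) = (\<integral>y. w (r *\<^sub>R y) \<partial>M)"
    by (rule radial_average[OF conv R w sub]) blast
  define S where "S r = f (r *\<^sub>R e)" for r
  have "max_avg (\<lambda>x. ereal (f x)) 0 r = ereal (S r)" if r: "0 < r" "r < R" for r
  proof (rule antisym)
    show "max_avg (\<lambda>x. ereal (f x)) 0 r \<le> ereal (S r)"
      unfolding max_avg_le_iff S_def using radial_subsolution_increasing[OF f rad _ r] by simp
    show "ereal (S r) \<le> max_avg (\<lambda>x. ereal (f x)) 0 r"
      unfolding S_def by (rule le_max_avg) (use r norm_e in simp)
  qed
  then have kc: "kernel_convex p R S" by (intro max_avg_kernel_convex[OF f(2)]) auto
  have cont: "continuous_on {0..R} S" unfolding S_def[abs_def]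
    by (rule continuous_on_compose2[OF f(1)]) (use norm_e in \<open>auto intro!: continuous_intros\<close>)
  have eq: "(\<integral>y. w (r *\<^sub>R y) \<partial>M) = (\<integral>y. S (r * norm y) \<partial>M)"
    if M: "isotropic_measure M" and r: "0 \<le> r" "r < R" for M r
  proof -
    interpret isotropic_measure M by (rule M)
    have "(\<integral>y. w (r *\<^sub>R y) \<partial>M) = (\<integral>y. f (r *\<^sub>R y) \<partial>M)" using same[OF M] r by simp
    also have "\<dots> = (\<integral>y. S (r * norm y) \<partial>M)"
    proof (rule Bochner_Integration.integral_cong)
      fix y assume "y \<in> space M"
      then have "norm y \<le> 1" using space_subset by auto
      then have "r * norm y \<le> r * 1" using r by (intro mult_left_mono) auto
      then show "f (r *\<^sub>R y) = S (r * norm y)"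
        unfolding S_def using r norm_e by (intro rad) auto
    qed simp
    finally show ?thesis .
  qed
  have ge: "w 0 \<le> S r" if r: "0 \<le> r" "r < R" for r
  proof -
    interpret isotropic_measure "surface_measure :: (real^'n) measure" by (rule isotropic_surface_measure)
    have "w 0 = f 0" using same[OF isotropic_surface_measure, of 0] R pos by simp
    also have "f 0 \<le> S r"
      using radial_subsolution_increasing[OF f rad, of 0 r] r unfolding S_def by (cases "r = 0") auto
    finally show ?thesis .
  qed
  show thesis using that[OF kc cont ge eq] .
qed

end

section \<open>Averages of extended real functions\<close>

lemma ext_integral_ereal:
  fixes v :: "'a \<Rightarrow> real"
  assumes "integrable M v"
  shows "ext_integral M (\<lambda>x. ereal (v x)) = ereal (\<integral>x. v x \<partial>M)"
proof -
  obtain r q where "0 \<le> r" "0 \<le> q" "(\<integral>\<^sup>+x. ennreal (v x) \<partial>M) = ennreal r"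
    "(\<integral>\<^sup>+x. ennreal (- v x) \<partial>M) = ennreal q" "(\<integral>x. v x \<partial>M) = r - q"
    using integrableE[OF assms] by metis
  then show ?thesis unfolding ext_integral_def by simp
qed

lemma ext_integral_finite_imp_integrable:
  fixes v :: "'a \<Rightarrow> real"
  assumes "finite_measure M" and v: "v \<in> borel_measurable M" "\<And>x. x \<in> space M \<Longrightarrow> v x \<le> C"
    and fin: "ext_integral M (\<lambda>x. ereal (v x)) \<noteq> -\<infinity>"
  shows "integrable M v"
proof -
  interpret finite_measure M by fact
  have "(\<integral>\<^sup>+x. ennreal (v x) \<partial>M) \<le> (\<integral>\<^sup>+x. ennreal C \<partial>M)"
    by (intro nn_integral_mono ennreal_leI v(2))
  also have "\<dots> < \<infinity>" by (simp add: ennreal_mult_less_top emeasure_eq_measure)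
  finally have P: "(\<integral>\<^sup>+x. ennreal (v x) \<partial>M) < \<infinity>" .
  have "(\<integral>\<^sup>+x. ennreal (- v x) \<partial>M) \<noteq> \<infinity>"
  proof
    assume "(\<integral>\<^sup>+x. ennreal (- v x) \<partial>M) = \<infinity>"
    moreover obtain r where "(\<integral>\<^sup>+x. ennreal (v x) \<partial>M) = ennreal r" "0 \<le> r"
      using P by (cases "\<integral>\<^sup>+x. ennreal (v x) \<partial>M") auto
    ultimately have "ext_integral M (\<lambda>x. ereal (v x)) = -\<infinity>" unfolding ext_integral_def by simp
    with fin show False by blast
  qed
  with P v(1) show ?thesis unfolding real_integrable_def by auto
qed

lemma tendsto_e2ennreal': "(f \<longlongrightarrow> l) F \<Longrightarrow> ((\<lambda>x. e2ennreal (f x)) \<longlongrightarrow> e2ennreal l) F"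
  using continuous_on_tendsto_compose[OF continuous_on_e2ennreal[of UNIV]] by simp

lemma tendsto_enn2ereal': "(f \<longlongrightarrow> l) F \<Longrightarrow> ((\<lambda>x. enn2ereal (f x)) \<longlongrightarrow> enn2ereal l) F"
  using continuous_on_tendsto_compose[OF continuous_on_enn2ereal] by simp

lemma tendsto_divide_real_ereal:
  fixes f :: "'a \<Rightarrow> ereal"
  assumes "(f \<longlongrightarrow> l) F" "m \<noteq> 0"
  shows "((\<lambda>x. f x / ereal m) \<longlongrightarrow> l / ereal m) F"
  using tendsto_cmult_ereal[OF _ assms(1), of "inverse (ereal m)"] assms(2)
  by (simp add: divide_ereal_def mult.commute[of _ "ereal (inverse m)"])

text \<open>The positive parts converge by domination and the negative parts by monotonicity, possibly to \<open>\<infinity>\<close>.\<close>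

lemma ext_integral_decreasing_limit:
  fixes f :: "nat \<Rightarrow> 'a \<Rightarrow> ereal"
  assumes "finite_measure M" and f: "\<And>k. f k \<in> borel_measurable M"
    and dec: "\<And>k x. x \<in> space M \<Longrightarrow> f (Suc k) x \<le> f k x" and C: "\<And>x. x \<in> space M \<Longrightarrow> f 0 x \<le> ereal C"
    and lim: "\<And>x. x \<in> space M \<Longrightarrow> (\<lambda>k. f k x) \<longlonglongrightarrow> g x"
  shows "(\<lambda>k. ext_integral M (f k)) \<longlonglongrightarrow> ext_integral M g" and "g \<in> borel_measurable M"
proof -
  interpret finite_measure M by fact
  have decs: "decseq (\<lambda>k. f k x)" if "x \<in> space M" for x
    using dec[OF that] by (rule decseq_SucI)
  have fC: "f k x \<le> ereal C" if "x \<in> space M" for k x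
    using decs[OF that] C[OF that] unfolding decseq_def by (meson le0 order_trans)
  have gINF: "g x = (INF k. f k x)" if "x \<in> space M" for x
    using LIMSEQ_unique[OF lim[OF that] LIMSEQ_INF[OF decs[OF that]]] .
  have "(\<lambda>x. INF k. f k x) \<in> borel_measurable M" using f by (intro borel_measurable_INF) auto
  then show g: "g \<in> borel_measurable M" using gINF by (simp cong: measurable_cong)
  note [measurable] = f g
  have em: "(\<lambda>x. e2ennreal (h x)) \<in> borel_measurable M" if "h \<in> borel_measurable M" for h :: "'a \<Rightarrow> ereal"
    by (rule borel_measurable_continuous_on[OF continuous_on_e2ennreal that])
  have P: "(\<lambda>k. \<integral>\<^sup>+x. e2ennreal (f k x) \<partial>M) \<longlonglongrightarrow> (\<integral>\<^sup>+x. e2ennreal (g x) \<partial>M)"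
  proof (rule nn_integral_dominated_convergence[where w = "\<lambda>x. ennreal C"])
    show "(\<integral>\<^sup>+x. ennreal C \<partial>M) < \<infinity>"
      by (simp add: ennreal_mult_less_top emeasure_eq_measure)
    show "AE x in M. e2ennreal (f j x) \<le> ennreal C" for j
      using e2ennreal_mono[OF fC] by (intro AE_I2) simp
    show "AE x in M. (\<lambda>i. e2ennreal (f i x)) \<longlonglongrightarrow> e2ennreal (g x)"
      by (intro AE_I2 tendsto_e2ennreal' lim)
  qed (simp_all add: em f g)
  have Pfin: "enn2ereal (\<integral>\<^sup>+x. e2ennreal (g x) \<partial>M) < \<infinity>"
  proof -
    have "g x \<le> ereal C" if "x \<in> space M" for x
      using gINF[OF that] fC[OF that, of 0] INF_lower[of 0 UNIV "\<lambda>k. f k x"] by (metis UNIV_I order_trans)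
    then have "(\<integral>\<^sup>+x. e2ennreal (g x) \<partial>M) \<le> (\<integral>\<^sup>+x. ennreal C \<partial>M)"
      using e2ennreal_mono[of "g _" "ereal C"] by (intro nn_integral_mono) simp
    also have "\<dots> < \<infinity>" by (simp add: ennreal_mult_less_top emeasure_eq_measure)
    finally have "(\<integral>\<^sup>+x. e2ennreal (g x) \<partial>M) < \<infinity>" .
    then show ?thesis by (cases "\<integral>\<^sup>+x. e2ennreal (g x) \<partial>M") auto
  qed
  have N: "(\<lambda>k. \<integral>\<^sup>+x. e2ennreal (- f k x) \<partial>M) \<longlonglongrightarrow> (\<integral>\<^sup>+x. e2ennreal (- g x) \<partial>M)"
  proof -
    have mN: "e2ennreal (- f k x) \<le> e2ennreal (- f (Suc k) x)" if "x \<in> space M" for k x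
      using dec[OF that] by (intro e2ennreal_mono) simp
    have "(\<integral>\<^sup>+x. (SUP k. e2ennreal (- f k x)) \<partial>M) = (SUP k. \<integral>\<^sup>+x. e2ennreal (- f k x) \<partial>M)"
      by (rule nn_integral_monotone_convergence_SUP_AE) (use mN in \<open>auto intro!: em AE_I2\<close>)
    moreover have "(SUP k. e2ennreal (- f k x)) = e2ennreal (- g x)" if x: "x \<in> space M" for x
    proof (rule LIMSEQ_unique)
      show "(\<lambda>k. e2ennreal (- f k x)) \<longlonglongrightarrow> (SUP k. e2ennreal (- f k x))"
        using mN[OF x] by (intro LIMSEQ_SUP incseq_SucI)
      show "(\<lambda>k. e2ennreal (- f k x)) \<longlonglongrightarrow> e2ennreal (- g x)"
        using lim[OF x] by (intro tendsto_e2ennreal') (simp add: ereal_Lim_uminus[symmetric])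
    qed
    then have "(\<integral>\<^sup>+x. (SUP k. e2ennreal (- f k x)) \<partial>M) = (\<integral>\<^sup>+x. e2ennreal (- g x) \<partial>M)"
      by (intro nn_integral_cong)
    moreover have "(\<lambda>k. \<integral>\<^sup>+x. e2ennreal (- f k x) \<partial>M) \<longlonglongrightarrow> (SUP k. \<integral>\<^sup>+x. e2ennreal (- f k x) \<partial>M)"
      using mN by (intro LIMSEQ_SUP incseq_SucI nn_integral_mono)
    ultimately show ?thesis by simp
  qed
  show "(\<lambda>k. ext_integral M (f k)) \<longlonglongrightarrow> ext_integral M g"
    unfolding ext_integral_def
    by (intro tendsto_diff_ereal_general tendsto_enn2ereal' P N)
      (use Pfin enn2ereal_nonneg[of "\<integral>\<^sup>+x. e2ennreal (g x) \<partial>M"] in auto)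
qed

definition measure_avg :: "(real^'n) measure \<Rightarrow> (real^'n \<Rightarrow> ereal) \<Rightarrow> real^'n \<Rightarrow> real \<Rightarrow> ereal" where
  "measure_avg M u x r = ext_integral M (\<lambda>y. u (x + r *\<^sub>R y)) / ereal (measure M (space M))"

lemma sphere_avg_eq: "sphere_avg = measure_avg surface_measure"
  by (simp add: fun_eq_iff sphere_avg_def measure_avg_def space_surface_measure)

lemma vol_avg_eq: "vol_avg = measure_avg (restrict_space lborel (cball 0 1))"
  by (simp add: fun_eq_iff vol_avg_def measure_avg_def space_restrict_space measure_restrict_space)

text \<open>Dilations act on differences of the kernel by a factor, so they preserve convexity with respect to the
  kernel.\<close>

lemma kernel_scaling:
  assumes "0 < \<rho>" "0 < r" "0 < s"
  shows "riesz_kernel p (r * \<rho>) - riesz_kernel p (s * \<rho>) = \<rho> powr (2 - p) * (riesz_kernel p r - riesz_kernel p s)"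
  using assms by (auto simp: riesz_kernel_def powr_mult ln_mult right_diff_distrib mult_ac)

lemma kernel_convex_scaled:
  assumes S: "kernel_convex p R S" and \<rho>: "0 < \<rho>" "\<rho> \<le> 1"
  shows "kernel_convex p R (\<lambda>r. S (r * \<rho>))"
proof (rule kernel_convexI)
  have less: "r * \<rho> < R" if "0 < r" "r < R" for r
  proof -
    have "r * \<rho> \<le> r * 1" using that \<rho> by (intro mult_left_mono) auto
    then show ?thesis using that by linarith
  qed
  show "S (s * \<rho>) \<le> S (t * \<rho>)" if "0 < s" "s \<le> t" "t < R" for s t
    by (rule kernel_convex_mono[OF S]) (use that \<rho> less[of t] in auto)
  show "(S (t * \<rho>) - S (s * \<rho>)) * (riesz_kernel p r - riesz_kernel p s)
      \<le> (S (r * \<rho>) - S (s * \<rho>)) * (riesz_kernel p t - riesz_kernel p s)"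
    if str: "0 < s" "s < t" "t < r" "r < R" for s t r
  proof -
    have "(S (t * \<rho>) - S (s * \<rho>)) * (riesz_kernel p (r * \<rho>) - riesz_kernel p (s * \<rho>))
      \<le> (S (r * \<rho>) - S (s * \<rho>)) * (riesz_kernel p (t * \<rho>) - riesz_kernel p (s * \<rho>))"
      by (rule kernel_convexD[OF S]) (use str \<rho> less[of r] in auto)
    moreover have "riesz_kernel p (r * \<rho>) - riesz_kernel p (s * \<rho>) = \<rho> powr (2 - p) * (riesz_kernel p r - riesz_kernel p s)"
      "riesz_kernel p (t * \<rho>) - riesz_kernel p (s * \<rho>) = \<rho> powr (2 - p) * (riesz_kernel p t - riesz_kernel p s)"
      using kernel_scaling[OF \<rho>(1)] str by simp_all
    ultimately have "\<rho> powr (2 - p) * ((S (t * \<rho>) - S (s * \<rho>)) * (riesz_kernel p r - riesz_kernel p s))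
      \<le> \<rho> powr (2 - p) * ((S (r * \<rho>) - S (s * \<rho>)) * (riesz_kernel p t - riesz_kernel p s))"
      by (simp add: mult_ac)
    then show ?thesis using \<rho> by (simp add: mult_le_cancel_left_pos)
  qed
qed

lemma kernel_convex_limit:
  assumes S: "\<And>k. kernel_convex p R (S k)" and lim: "\<And>r. 0 < r \<Longrightarrow> r < R \<Longrightarrow> (\<lambda>k::nat. S k r) \<longlonglongrightarrow> s r"
  shows "kernel_convex p R s"
proof (rule kernel_convexI)
  show "s a \<le> s b" if "0 < a" "a \<le> b" "b < R" for a b
    by (rule LIMSEQ_le[OF lim[of a] lim[of b]]) (use that kernel_convex_mono[OF S] in auto)
  show "(s b - s a) * (riesz_kernel p c - riesz_kernel p a) \<le> (s c - s a) * (riesz_kernel p b - riesz_kernel p a)"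
    if abc: "0 < a" "a < b" "b < c" "c < R" for a b c
  proof (rule LIMSEQ_le)
    show "(\<lambda>k. (S k b - S k a) * (riesz_kernel p c - riesz_kernel p a)) \<longlonglongrightarrow>
       (s b - s a) * (riesz_kernel p c - riesz_kernel p a)"
      using abc by (intro tendsto_intros lim) auto
    show "(\<lambda>k. (S k c - S k a) * (riesz_kernel p b - riesz_kernel p a)) \<longlonglongrightarrow>
       (s c - s a) * (riesz_kernel p b - riesz_kernel p a)"
      using abc by (intro tendsto_intros lim) auto
  qed (use kernel_convexD[OF S abc] in blast)
qed

context isotropic_measure
begin

lemma integrable_radial:
  fixes S :: "real \<Rightarrow> real"
  assumes "continuous_on {0..R} S" "0 \<le> r" "r \<le> R"
  shows "integrable M (\<lambda>y. S (r * norm y))"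
proof -
  have "continuous_on (cball 0 R) (\<lambda>z::real^'n. S (norm z))"
    by (rule continuous_on_compose2[OF assms(1)]) (auto intro!: continuous_intros)
  from integrable_scaled[OF this assms(2,3)] show ?thesis using assms(2) by simp
qed

lemma kernel_convex_average:
  fixes S :: "real \<Rightarrow> real"
  assumes S: "kernel_convex p R S" and cont: "continuous_on {0..R} S"
  shows "kernel_convex p R (\<lambda>r. (\<integral>y. S (r * norm y) \<partial>M) / measure M (space M))"
proof (rule kernel_convexI)
  let ?K = "riesz_kernel p"
  have int: "integrable M (\<lambda>y. S (r * norm y))" if "0 < r" "r < R" for r
    using integrable_radial[OF cont] that by simp
  have n1: "norm y \<le> 1" if "y \<in> space M" for y using that space_subset by auto
  show "(\<integral>y. S (s * norm y) \<partial>M) / measure M (space M) \<le> (\<integral>y. S (t * norm y) \<partial>M) / measure M (space M)"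
    if st: "0 < s" "s \<le> t" "t < R" for s t
  proof (rule divide_right_mono)
    show "(\<integral>y. S (s * norm y) \<partial>M) \<le> (\<integral>y. S (t * norm y) \<partial>M)"
    proof (rule integral_mono)
      fix y assume "y \<in> space M"
      then show "S (s * norm y) \<le> S (t * norm y)"
        using kernel_convex_mono[OF kernel_convex_scaled[OF S, of "norm y"] st] n1
        by (cases "y = 0") auto
    qed (use int st in auto)
  qed (use pos in simp)
  show "((\<integral>y. S (t * norm y) \<partial>M) / measure M (space M) - (\<integral>y. S (s * norm y) \<partial>M) / measure M (space M)) * (?K r - ?K s)
    \<le> ((\<integral>y. S (r * norm y) \<partial>M) / measure M (space M) - (\<integral>y. S (s * norm y) \<partial>M) / measure M (space M)) * (?K t - ?K s)"
    if str: "0 < s" "s < t" "t < r" "r < R" for s t r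
  proof -
    note ints = int[of s] int[of t] int[of r]
    have "(\<integral>y. (S (t * norm y) - S (s * norm y)) * (?K r - ?K s) \<partial>M)
       \<le> (\<integral>y. (S (r * norm y) - S (s * norm y)) * (?K t - ?K s) \<partial>M)"
    proof (rule integral_mono)
      fix y assume "y \<in> space M"
      then show "(S (t * norm y) - S (s * norm y)) * (?K r - ?K s) \<le> (S (r * norm y) - S (s * norm y)) * (?K t - ?K s)"
        using kernel_convexD[OF kernel_convex_scaled[OF S, of "norm y"] str] n1
        by (cases "y = 0") auto
    qed (use ints str in auto)
    then have "((\<integral>y. S (t * norm y) \<partial>M) - (\<integral>y. S (s * norm y) \<partial>M)) * (?K r - ?K s)
       \<le> ((\<integral>y. S (r * norm y) \<partial>M) - (\<integral>y. S (s * norm y) \<partial>M)) * (?K t - ?K s)"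
      using ints str by simp
    from divide_right_mono[OF this, of "measure M (space M)"] pos show ?thesis
      by (simp add: diff_divide_distrib[symmetric])
  qed
qed

end

lemma max_avg_tendsto:
  assumes usc: "usc_on X u" and "open X" "x \<in> X" and \<delta>: "\<delta> \<longlonglongrightarrow> 0" "\<And>k::nat. 0 < \<delta> k"
  shows "(\<lambda>k. max_avg u x (\<delta> k)) \<longlonglongrightarrow> u x"
proof (rule order_tendstoI)
  fix c assume "c < u x"
  moreover have "u x \<le> max_avg u x (\<delta> k)" for k using \<delta>(2)[of k] by (intro le_max_avg) simp
  ultimately show "\<forall>\<^sub>F k in sequentially. c < max_avg u x (\<delta> k)" by (intro always_eventually) (auto intro: less_le_trans)
next
  fix c assume "u x < c"
  then obtain c' where c': "u x < c'" "c' < c" using dense by blast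
  obtain T where T: "open T" "x \<in> T" "\<And>y. y \<in> T \<inter> X \<Longrightarrow> u y < c'"
    using usc_on_open_nhd[OF usc \<open>x \<in> X\<close> c'(1)] by blast
  have "open (T \<inter> X)" "x \<in> T \<inter> X" using T \<open>open X\<close> \<open>x \<in> X\<close> by auto
  then obtain d where d: "d > 0" "ball x d \<subseteq> T \<inter> X"
    using open_contains_ball by meson
  have "\<forall>\<^sub>F k in sequentially. \<delta> k < d" using order_tendstoD(2)[OF \<delta>(1) d(1)] .
  then show "\<forall>\<^sub>F k in sequentially. max_avg u x (\<delta> k) < c"
  proof (rule eventually_mono)
    fix k assume "\<delta> k < d"
    have "u z \<le> c'" if "z \<in> cball x (\<delta> k)" for z
    proof -
      have "z \<in> ball x d" using that \<open>\<delta> k < d\<close> by simp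
      then have "u z < c'" using d(2) T(3) by blast
      then show ?thesis by simp
    qed
    then have "max_avg u x (\<delta> k) \<le> c'" unfolding max_avg_le_iff by blast
    with c'(2) show "max_avg u x (\<delta> k) < c" by order
  qed
qed

context riesz_cone
begin

text \<open>The functions \<open>S k\<close> are the radial profiles of the regularisations \<open>M(u,\<cdot>,\<delta>)\<close> with
  \<open>\<delta> = R / (k + 1)\<close>. The ball of radius \<open>3 R\<close> leaves room for \<open>\<delta> \<le> R\<close> around the open ball of radius
  \<open>2 R\<close>.\<close>

lemma averages_approximation:
  assumes conv: "convex F" and u: "F_subharmonic F X u" and X: "open X" and R: "0 < R" "cball x (3 * R) \<subseteq> X"
  obtains S :: "nat \<Rightarrow> real \<Rightarrow> real" where "\<And>k. kernel_convex p R (S k)" "\<And>k. continuous_on {0..R} (S k)"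
    "\<And>k r. 0 \<le> r \<Longrightarrow> r < R \<Longrightarrow> u x \<le> ereal (S k r)"
    "\<And>k r. 0 \<le> r \<Longrightarrow> r < R \<Longrightarrow> S (Suc k) r \<le> S k r"
    "\<And>M r. isotropic_measure M \<Longrightarrow> 0 \<le> r \<Longrightarrow> r < R \<Longrightarrow>
      (\<lambda>k. ereal ((\<integral>y. S k (r * norm y) \<partial>M) / measure M (space M))) \<longlonglongrightarrow> measure_avg M u x r"
proof -
  define \<delta> where "\<delta> k = R / real (Suc k)" for k
  have \<delta>: "0 < \<delta> k" "\<delta> k \<le> R" "\<delta> (Suc k) \<le> \<delta> k" for k
  proof -
    show "0 < \<delta> k" using R(1) unfolding \<delta>_def by simp
    have "R / real (Suc k) \<le> R / 1" using R(1) by (intro divide_left_mono) auto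
    then show "\<delta> k \<le> R" unfolding \<delta>_def by simp
    show "\<delta> (Suc k) \<le> \<delta> k" using R(1) unfolding \<delta>_def by (intro divide_left_mono) auto
  qed
  have \<delta>0: "\<delta> \<longlonglongrightarrow> 0" unfolding \<delta>_def
    using LIMSEQ_Suc[OF lim_const_over_n[of R]] by simp
  define w where "w k z = real_of_ereal (max_avg u (x + z) (\<delta> k))" for k z
  have cb: "cball (x + z) (\<delta> k) \<subseteq> X" if "norm z \<le> 2 * R" for z k
  proof
    fix y assume y: "y \<in> cball (x + z) (\<delta> k)"
    have "dist x y \<le> dist x (x + z) + dist (x + z) y" by (rule dist_triangle)
    also have "\<dots> \<le> 3 * R" using y that \<delta>(2)[of k] by (simp add: dist_norm)
    finally show "y \<in> X" using R(2) by auto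
  qed
  have w_eq: "max_avg u (x + z) (\<delta> k) = ereal (w k z)" if "norm z \<le> 2 * R" for z k
    unfolding w_def by (rule max_avg_finite[OF u X cb[OF that] \<delta>(1)])
  have Y: "cball y (\<delta> k) \<subseteq> X" if "y \<in> ball x (2 * R)" for y k
    using cb[of "y - x" k] that by (simp add: dist_norm norm_minus_commute)
  have w_cont: "continuous_on (cball 0 R) (w k)" for k
  proof -
    have "continuous_on (ball x (2 * R)) (\<lambda>y. real_of_ereal (max_avg u y (\<delta> k)))"
      by (rule max_regularization(1)[OF u X \<delta>(1) open_ball Y])
    then show ?thesis unfolding w_def[abs_def]
      by (rule continuous_on_compose2) (use R in \<open>auto intro!: continuous_intros simp: dist_norm\<close>)
  qed
  have w_sub: "subsolution F (ball 0 R) (\<lambda>z. ereal (w k z))" for k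
  proof -
    have "subsolution F (ball x (2 * R)) (\<lambda>y. ereal (real_of_ereal (max_avg u y (\<delta> k))))"
      by (rule max_regularization(2)[OF u X \<delta>(1) open_ball Y])
    moreover have "ball 0 R \<subseteq> {z. x + z \<in> ball x (2 * R)}" using R(1) by (auto simp: dist_norm)
    ultimately show ?thesis
      unfolding w_def[abs_def] using subsolution_subset[OF subsolution_translate] by blast
  qed
  have "\<forall>k. \<exists>S. kernel_convex p R S \<and> continuous_on {0..R} S \<and> (\<forall>r. 0 \<le> r \<and> r < R \<longrightarrow> w k 0 \<le> S r) \<and>
    (\<forall>M r. isotropic_measure M \<and> 0 \<le> r \<and> r < R \<longrightarrow> (\<integral>y. w k (r *\<^sub>R y) \<partial>M) = (\<integral>y. S (r * norm y) \<partial>M))"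
  proof
    fix k
    obtain S where "kernel_convex p R S" "continuous_on {0..R} S" "\<And>r. 0 \<le> r \<Longrightarrow> r < R \<Longrightarrow> w k 0 \<le> S r"
      "\<And>M r. isotropic_measure M \<Longrightarrow> 0 \<le> r \<Longrightarrow> r < R \<Longrightarrow> (\<integral>y. w k (r *\<^sub>R y) \<partial>M) = (\<integral>y. S (r * norm y) \<partial>M)"
      using radial_profile[OF conv R(1) w_cont w_sub, of k] by blast
    then show "\<exists>S. kernel_convex p R S \<and> continuous_on {0..R} S \<and> (\<forall>r. 0 \<le> r \<and> r < R \<longrightarrow> w k 0 \<le> S r) \<and>
    (\<forall>M r. isotropic_measure M \<and> 0 \<le> r \<and> r < R \<longrightarrow> (\<integral>y. w k (r *\<^sub>R y) \<partial>M) = (\<integral>y. S (r * norm y) \<partial>M))"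
      by (intro exI[of _ S]) simp
  qed
  from choice[OF this] obtain S :: "nat \<Rightarrow> real \<Rightarrow> real" where S0:
    "\<forall>k. kernel_convex p R (S k) \<and> continuous_on {0..R} (S k) \<and> (\<forall>r. 0 \<le> r \<and> r < R \<longrightarrow> w k 0 \<le> S k r) \<and>
    (\<forall>M r. isotropic_measure M \<and> 0 \<le> r \<and> r < R \<longrightarrow> (\<integral>y. w k (r *\<^sub>R y) \<partial>M) = (\<integral>y. S k (r * norm y) \<partial>M))"
    by (rule exE)
  have S: "kernel_convex p R (S k)" "continuous_on {0..R} (S k)"
    "\<And>r. 0 \<le> r \<Longrightarrow> r < R \<Longrightarrow> w k 0 \<le> S k r" for k
    using S0[rule_format, of k] by simp_all
  have S_eq: "(\<integral>y. w k (r *\<^sub>R y) \<partial>M) = (\<integral>y. S k (r * norm y) \<partial>M)"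
    if "isotropic_measure M" "0 \<le> r" "r < R" for k M r
    using S0[rule_format, of k] that by simp
  have w_dec: "w (Suc k) z \<le> w k z" if "norm z \<le> 2 * R" for k z
    using max_avg_mono[OF \<delta>(3), of u "x + z" k] w_eq[OF that] by simp
  have scaled: "norm (r *\<^sub>R y) \<le> 2 * R" if "norm y \<le> 1" "0 \<le> r" "r < R" for r and y :: "real^'n"
  proof -
    have "r * norm y \<le> R * 1" using that by (intro mult_mono) auto
    then show ?thesis using that by simp
  qed
  show thesis
  proof (rule that[OF S(1,2)])
    show "u x \<le> ereal (S k r)" if r: "0 \<le> r" "r < R" for k r
    proof -
      have "u x \<le> max_avg u x (\<delta> k)" using \<delta>(1)[of k] by (intro le_max_avg) simp
      also have "\<dots> = ereal (w k 0)" using w_eq[of 0 k] R by simp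
      also have "\<dots> \<le> ereal (S k r)" using S(3)[OF r] by simp
      finally show ?thesis .
    qed
    show "S (Suc k) r \<le> S k r" if r: "0 \<le> r" "r < R" for k r
    proof -
      interpret isotropic_measure "surface_measure :: (real^'n) measure" by (rule isotropic_surface_measure)
      let ?M = "surface_measure :: (real^'n) measure"
      have eq: "(\<integral>y. w k (r *\<^sub>R y) \<partial>?M) = measure ?M (space ?M) * S k r" for k
      proof -
        have "(\<integral>y. w k (r *\<^sub>R y) \<partial>?M) = (\<integral>y. S k (r * norm y) \<partial>?M)"
          by (rule S_eq[OF isotropic_surface_measure r])
        also have "\<dots> = (\<integral>y. S k r \<partial>?M)"
          by (rule Bochner_Integration.integral_cong) (simp_all add: space_surface_measure)
        finally show ?thesis by simp
      qed
      have "(\<integral>y. w (Suc k) (r *\<^sub>R y) \<partial>?M) \<le> (\<integral>y. w k (r *\<^sub>R y) \<partial>?M)"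
      proof (rule integral_mono)
        show "w (Suc k) (r *\<^sub>R y) \<le> w k (r *\<^sub>R y)" if "y \<in> space ?M" for y
          by (rule w_dec[OF scaled]) (use that r space_subset in auto)
      qed (use integrable_scaled[OF w_cont, of r] r in auto)
      then show ?thesis using pos unfolding eq by simp
    qed
    show "(\<lambda>k. ereal ((\<integral>y. S k (r * norm y) \<partial>M) / measure M (space M))) \<longlonglongrightarrow> measure_avg M u x r"
      if M: "isotropic_measure M" and r: "0 \<le> r" "r < R" for M r
    proof -
      interpret isotropic_measure M by (rule M)
      have n1: "norm (r *\<^sub>R y) \<le> 2 * R" if "y \<in> space M" for y
        using that space_subset r by (intro scaled) auto
      have "compact (w 0 ` cball 0 R)" using w_cont by (intro compact_continuous_image) auto
      then obtain C where C: "\<And>z. z \<in> w 0 ` cball 0 R \<Longrightarrow> norm z \<le> C"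
        using compact_imp_bounded bounded_iff by metis
      have int: "integrable M (\<lambda>y. w k (r *\<^sub>R y))" for k by (rule integrable_scaled[OF w_cont]) (use r in auto)
      have "(\<lambda>k. ext_integral M (\<lambda>y. ereal (w k (r *\<^sub>R y)))) \<longlonglongrightarrow> ext_integral M (\<lambda>y. u (x + r *\<^sub>R y))"
      proof (rule ext_integral_decreasing_limit)
        show "finite_measure M" by unfold_locales
        show "(\<lambda>y. ereal (w k (r *\<^sub>R y))) \<in> borel_measurable M" for k
          using borel_measurable_integrable[OF int[of k]] by simp
        show "ereal (w (Suc k) (r *\<^sub>R y)) \<le> ereal (w k (r *\<^sub>R y))" if "y \<in> space M" for k y
          using w_dec[OF n1[OF that]] by simp
        show "ereal (w 0 (r *\<^sub>R y)) \<le> ereal C" if "y \<in> space M" for y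
        proof -
          have "norm y \<le> 1" using that space_subset by auto
          then have "r * norm y \<le> R * 1" using r by (intro mult_mono) auto
          then show ?thesis using C[of "w 0 (r *\<^sub>R y)"] r by force
        qed
        show "(\<lambda>k. ereal (w k (r *\<^sub>R y))) \<longlonglongrightarrow> u (x + r *\<^sub>R y)" if "y \<in> space M" for y
        proof -
          have "x + r *\<^sub>R y \<in> X"
            using cb[OF n1[OF that], of 0] \<delta>(1)[of 0] by (meson centre_in_cball less_imp_le subsetD)
          from max_avg_tendsto[OF subsolution_usc[OF F_subharmonic_imp_subsolution[OF u]] X this \<delta>0 \<delta>(1)]
          show ?thesis by (simp add: w_eq[OF n1[OF that]])
        qed
      qed
      then have "(\<lambda>k. ereal (\<integral>y. S k (r * norm y) \<partial>M)) \<longlonglongrightarrow> ext_integral M (\<lambda>y. u (x + r *\<^sub>R y))"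
        unfolding ext_integral_ereal[OF int] S_eq[OF M r] .
      from tendsto_divide_real_ereal[OF this, of "measure M (space M)"] pos
      show ?thesis unfolding measure_avg_def by simp
    qed
  qed
qed

end

section \<open>Local integrability\<close>

lemma usc_measurable_extension:
  fixes u :: "real^'n \<Rightarrow> ereal"
  assumes usc: "usc_on X u" and X: "open X"
  shows "(\<lambda>w. if w \<in> X then u w else 0) \<in> borel_measurable borel"
proof (rule borel_measurableI_less)
  fix c :: ereal
  have "open {w \<in> X. u w < c}" by (rule usc_on_open_sublevel[OF usc X])
  moreover have "{w \<in> space borel. (if w \<in> X then u w else 0) < c}
      = {w \<in> X. u w < c} \<union> (if 0 < c then - X else {})" by auto
  moreover have "- X \<in> sets borel" using X by simp
  ultimately show "{w \<in> space borel. (if w \<in> X then u w else 0) < c} \<in> sets borel" by auto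
qed

lemma borel_measurable_times_indicator_cball:
  fixes g :: "'a::real_normed_vector \<Rightarrow> ennreal"
  assumes "g \<in> borel_measurable borel"
  shows "(\<lambda>w. g w * indicator (cball x r) w) \<in> borel_measurable borel"
  by (intro borel_measurable_times_ennreal assms borel_measurable_indicator) simp

lemma nn_integral_cball_scale:
  fixes g :: "real^'n \<Rightarrow> ennreal"
  assumes [measurable]: "g \<in> borel_measurable borel" and r: "0 < r"
  shows "(\<integral>\<^sup>+y. g (x + r *\<^sub>R y) \<partial>restrict_space lborel (cball 0 1))
    = ennreal ((1 / r) ^ CARD('n)) * (\<integral>\<^sup>+w. g w * indicator (cball x r) w \<partial>lborel)"
proof -
  define G where "G w = g w * indicator (cball x r) w" for w
  have [measurable]: "G \<in> borel_measurable borel" 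
    unfolding G_def by (rule borel_measurable_times_indicator_cball) measurable
  have "(\<integral>\<^sup>+w. G w \<partial>lborel) = (\<integral>\<^sup>+y. ennreal (r ^ CARD('n)) * G (x + r *\<^sub>R y) \<partial>lborel)"
    using r by (subst lborel_affine[of r x]) (simp_all add: nn_integral_density nn_integral_distr)
  also have "\<dots> = ennreal (r ^ CARD('n)) * (\<integral>\<^sup>+y. G (x + r *\<^sub>R y) \<partial>lborel)"
    by (rule nn_integral_cmult) measurable
  also have "(\<integral>\<^sup>+y. G (x + r *\<^sub>R y) \<partial>lborel) = (\<integral>\<^sup>+y. g (x + r *\<^sub>R y) \<partial>restrict_space lborel (cball 0 1))"
  proof -
    have "indicator (cball x r) (x + r *\<^sub>R y) = (indicator (cball 0 1) y :: ennreal)" for y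
      using r by (auto simp: indicator_def dist_norm)
    then show ?thesis unfolding G_def by (subst nn_integral_restrict_space) simp_all
  qed
  finally have "ennreal ((1 / r) ^ CARD('n)) * (\<integral>\<^sup>+w. G w \<partial>lborel)
    = (ennreal ((1 / r) ^ CARD('n)) * ennreal (r ^ CARD('n))) * (\<integral>\<^sup>+y. g (x + r *\<^sub>R y) \<partial>restrict_space lborel (cball 0 1))"
    by (simp add: mult.assoc)
  also have "ennreal ((1 / r) ^ CARD('n)) * ennreal (r ^ CARD('n)) = 1"
    using r by (simp add: ennreal_mult[symmetric] power_mult_distrib[symmetric])
  finally show ?thesis unfolding G_def by simp
qed

text \<open>Indicators of the balls converge away from the sphere, which is a null set.\<close>

lemma nn_integral_cball_continuous:
  fixes g :: "real^'n \<Rightarrow> ennreal"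
  assumes [measurable]: "g \<in> borel_measurable borel"
    and fin: "(\<integral>\<^sup>+w. g w * indicator (cball x0 \<rho>) w \<partial>lborel) < \<infinity>" and r: "0 < r" "r < \<rho>"
  shows "((\<lambda>x. \<integral>\<^sup>+w. g w * indicator (cball x r) w \<partial>lborel) \<longlongrightarrow>
     (\<integral>\<^sup>+w. g w * indicator (cball x0 r) w \<partial>lborel)) (at x0)"
  unfolding tendsto_at_iff_sequentially
proof (intro allI impI)
  fix Z :: "nat \<Rightarrow> real^'n" assume Z: "Z \<longlonglongrightarrow> x0"
  have "\<forall>\<^sub>F i in sequentially. dist (Z i) x0 < \<rho> - r" using tendstoD[OF Z] r by simp
  then obtain N where N: "\<And>i. i \<ge> N \<Longrightarrow> dist (Z i) x0 < \<rho> - r" unfolding eventually_sequentially by blast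
  have ZN: "(\<lambda>i. Z (i + N)) \<longlonglongrightarrow> x0" using Z by (rule LIMSEQ_ignore_initial_segment)
  have "(\<lambda>i. \<integral>\<^sup>+w. g w * indicator (cball (Z (i + N)) r) w \<partial>lborel) \<longlonglongrightarrow>
     (\<integral>\<^sup>+w. g w * indicator (cball x0 r) w \<partial>lborel)"
  proof (rule nn_integral_dominated_convergence[where w = "\<lambda>w. g w * indicator (cball x0 \<rho>) w"])
    show "AE w in lborel. g w * indicator (cball (Z (j + N)) r) w \<le> g w * indicator (cball x0 \<rho>) w" for j
    proof (rule AE_I2)
      fix w
      have "w \<in> cball x0 \<rho>" if "w \<in> cball (Z (j + N)) r"
        using that N[of "j + N"] dist_triangle[of x0 w "Z (j + N)"] by (simp add: dist_commute)
      then show "g w * indicator (cball (Z (j + N)) r) w \<le> g w * indicator (cball x0 \<rho>) w"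
        by (auto simp: indicator_def)
    qed
    have "sphere x0 r \<in> null_sets lborel"
      using negligible_sphere[of x0 r] by (simp add: negligible_iff_null_sets null_sets_def)
    then have "AE w in lborel. w \<notin> sphere x0 r" by (rule AE_not_in)
    then show "AE w in lborel. (\<lambda>i. g w * indicator (cball (Z (i + N)) r) w) \<longlonglongrightarrow> g w * indicator (cball x0 r) w"
    proof (rule AE_mp, intro AE_I2 impI)
      fix w assume w: "w \<notin> sphere x0 r"
      have lim: "(\<lambda>i. dist (Z (i + N)) w) \<longlonglongrightarrow> dist x0 w" by (intro tendsto_intros ZN)
      have "\<forall>\<^sub>F i in sequentially. (indicator (cball (Z (i + N)) r) w :: ennreal) = indicator (cball x0 r) w"
      proof (cases "dist x0 w < r")
        case True
        from order_tendstoD(2)[OF lim this] show ?thesis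
          by (rule eventually_mono) (use True in \<open>simp add: indicator_def\<close>)
      next
        case False
        then have "r < dist x0 w" using w by simp
        from order_tendstoD(1)[OF lim this] show ?thesis
          by (rule eventually_mono) (use \<open>r < dist x0 w\<close> in \<open>simp add: indicator_def\<close>)
      qed
      then have "\<forall>\<^sub>F i in sequentially. g w * indicator (cball (Z (i + N)) r) w = g w * indicator (cball x0 r) w"
        by (rule eventually_mono) simp
      then show "(\<lambda>i. g w * indicator (cball (Z (i + N)) r) w) \<longlonglongrightarrow> g w * indicator (cball x0 r) w"
        by (rule tendsto_eventually)
    qed
  qed (use fin in \<open>simp_all add: borel_measurable_times_indicator_cball\<close>)
  then show "((\<lambda>x. \<integral>\<^sup>+w. g w * indicator (cball x r) w \<partial>lborel) \<circ> Z) \<longlonglongrightarrow>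
     (\<integral>\<^sup>+w. g w * indicator (cball x0 r) w \<partial>lborel)"
    unfolding comp_def by (rule LIMSEQ_offset[where k = N])
qed

text \<open>The integrals of the positive and of the negative part of \<open>u\<close> over a ball. The value \<open>0\<close> outside \<open>X\<close> makes
  the integrands measurable on the whole space.\<close>

definition upper_mass :: "(real^'n) set \<Rightarrow> (real^'n \<Rightarrow> ereal) \<Rightarrow> real^'n \<Rightarrow> real \<Rightarrow> ennreal" where
  "upper_mass X u x r = (\<integral>\<^sup>+w. e2ennreal (if w \<in> X then u w else 0) * indicator (cball x r) w \<partial>lborel)"

definition lower_mass :: "(real^'n) set \<Rightarrow> (real^'n \<Rightarrow> ereal) \<Rightarrow> real^'n \<Rightarrow> real \<Rightarrow> ennreal" where
  "lower_mass X u x r = (\<integral>\<^sup>+w. e2ennreal (- (if w \<in> X then u w else 0)) * indicator (cball x r) w \<partial>lborel)"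

lemma borel_measurable_e2ennreal:
  fixes f :: "'a \<Rightarrow> ereal"
  shows "f \<in> borel_measurable M \<Longrightarrow> (\<lambda>x. e2ennreal (f x)) \<in> borel_measurable M"
  by (rule borel_measurable_continuous_on[OF continuous_on_e2ennreal])

lemma vol_avg_eq_masses:
  fixes u :: "real^'n \<Rightarrow> ereal"
  assumes u: "usc_on X u" "open X" and r: "0 < r" "cball x r \<subseteq> X"
  shows "vol_avg u x r = (enn2ereal (ennreal ((1 / r) ^ CARD('n)) * upper_mass X u x r)
     - enn2ereal (ennreal ((1 / r) ^ CARD('n)) * lower_mass X u x r)) / ereal (measure lborel (cball 0 1 :: (real^'n) set))"
proof -
  have mem: "x + r *\<^sub>R y \<in> X" if "y \<in> space (restrict_space lborel (cball 0 1))" for y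
  proof -
    have "norm y \<le> 1" using that by (simp add: space_restrict_space)
    then have "x + r *\<^sub>R y \<in> cball x r" using r by (simp add: dist_norm)
    then show ?thesis using r(2) by blast
  qed
  have m: "(\<lambda>w. if w \<in> X then u w else 0) \<in> borel_measurable borel"
    by (rule usc_measurable_extension[OF u])
  then have m': "(\<lambda>w. - (if w \<in> X then u w else 0)) \<in> borel_measurable borel"
    by (rule borel_measurable_uminus_ereal)
  have "(\<integral>\<^sup>+y. e2ennreal (u (x + r *\<^sub>R y)) \<partial>restrict_space lborel (cball 0 1))
      = ennreal ((1 / r) ^ CARD('n)) * upper_mass X u x r"
    unfolding upper_mass_def nn_integral_cball_scale[OF borel_measurable_e2ennreal[OF m] r(1), symmetric]
    by (rule nn_integral_cong) (use mem in simp)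
  moreover have "(\<integral>\<^sup>+y. e2ennreal (- u (x + r *\<^sub>R y)) \<partial>restrict_space lborel (cball 0 1))
      = ennreal ((1 / r) ^ CARD('n)) * lower_mass X u x r"
    unfolding lower_mass_def nn_integral_cball_scale[OF borel_measurable_e2ennreal[OF m'] r(1), symmetric]
    by (rule nn_integral_cong) (use mem in simp)
  ultimately show ?thesis unfolding vol_avg_def ext_integral_def by simp
qed

lemma kernel_convex_mono_closed:
  assumes S: "kernel_convex p R S" and cont: "continuous_on {0..R} S" and st: "0 \<le> s" "s \<le> t" "t < R"
  shows "S s \<le> S t"
proof (cases "s = 0")
  case True
  show ?thesis
  proof (cases "t = 0")
    case False
    then have t: "0 < t" using st by simp
    have "(\<lambda>j. t / real (Suc j)) \<longlonglongrightarrow> 0" using LIMSEQ_Suc[OF lim_const_over_n[of t]] by simp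
    moreover have pos: "0 < t / real (Suc j)" "t / real (Suc j) \<le> t" for j
      using t by (auto simp: divide_le_eq)
    ultimately have "(\<lambda>j. S (t / real (Suc j))) \<longlonglongrightarrow> S 0"
    proof (intro continuous_on_tendsto_compose[OF cont])
      show "\<forall>\<^sub>F j in sequentially. t / real (Suc j) \<in> {0..R}"
      proof (intro always_eventually allI)
        fix j show "t / real (Suc j) \<in> {0..R}" using pos[of j] st by simp
      qed
    qed (use st in auto)
    moreover have "S (t / real (Suc j)) \<le> S t" for j
      by (rule kernel_convex_mono[OF S pos st(3)])
    ultimately have "S 0 \<le> S t" by (intro LIMSEQ_le_const2) auto
    then show ?thesis using True by simp
  qed (use True in simp)
qed (use kernel_convex_mono[OF S] st in simp)

context riesz_cone
begin

lemma subharmonic_le_average: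
  assumes conv: "convex F" and u: "F_subharmonic F X u" and X: "open X" and R: "0 < R" "cball x (3 * R) \<subseteq> X"
    and M: "isotropic_measure M" and r: "0 \<le> r" "r < R"
  shows "u x \<le> measure_avg M u x r"
proof -
  interpret isotropic_measure M by (rule M)
  obtain S :: "nat \<Rightarrow> real \<Rightarrow> real" where S: "\<And>k. continuous_on {0..R} (S k)"
    "\<And>k r. 0 \<le> r \<Longrightarrow> r < R \<Longrightarrow> u x \<le> ereal (S k r)"
    "(\<lambda>k. ereal ((\<integral>y. S k (r * norm y) \<partial>M) / measure M (space M))) \<longlonglongrightarrow> measure_avg M u x r"
    using averages_approximation[OF conv u X R] M r by metis
  have "u x \<le> ereal ((\<integral>y. S k (r * norm y) \<partial>M) / measure M (space M))" for k
  proof (cases "u x")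
    case (real c)
    have "measure M (space M) * c \<le> (\<integral>y. S k (r * norm y) \<partial>M)"
    proof -
      have "(\<integral>y. c \<partial>M) \<le> (\<integral>y. S k (r * norm y) \<partial>M)"
      proof (rule integral_mono)
        show "integrable M (\<lambda>y. S k (r * norm y))" by (rule integrable_radial[OF S(1)]) (use r in auto)
        show "c \<le> S k (r * norm y)" if "y \<in> space M" for y
        proof -
          have "norm y \<le> 1" using that space_subset by auto
          then have "r * norm y \<le> r * 1" using r by (intro mult_left_mono) auto
          then show ?thesis using S(2)[of "r * norm y" k] r real by simp
        qed
      qed simp
      then show ?thesis by simp
    qed
    then show ?thesis using pos real by (simp add: pos_le_divide_eq mult.commute)
  next
    case PInf
    then show ?thesis using S(2)[of 0 k] R by simp
  qed simp
  then show ?thesis using S(3) by (intro LIMSEQ_le_const[OF S(3)]) auto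
qed

text \<open>Near \<open>x\<close> there is a point \<open>y\<close> with \<open>u y > -\<infinity>\<close>. Volume averages of \<open>u\<close> at \<open>y\<close> are at least \<open>u y\<close>, so \<open>u\<close> is
  integrable over a ball about \<open>y\<close> that contains a neighbourhood of \<open>x\<close>.\<close>

lemma subharmonic_locally_integrable:
  assumes conv: "convex F" and u: "F_subharmonic F X u" and X: "open X" and x: "x \<in> X"
  shows "\<exists>\<rho>>0. cball x \<rho> \<subseteq> X \<and> upper_mass X u x \<rho> < \<infinity> \<and> lower_mass X u x \<rho> < \<infinity>"
proof -
  note sub = F_subharmonic_imp_subsolution[OF u]
  obtain d where d: "d > 0" "cball x d \<subseteq> X" using X x open_contains_cball by blast
  \<comment> \<open>For \<open>y\<close> in \<open>ball x \<rho>\<close> the lower bound by \<open>u y\<close> holds for the average over \<open>cball y (2 * \<rho>)\<close>, which contains \<open>cball x \<rho>\<close>; it needs \<open>cball y (9 * \<rho>) \<subseteq> X\<close>.\<close>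
  define \<rho> where "\<rho> = d / 10"
  have \<rho>: "\<rho> > 0" "d = 10 * \<rho>" using d unfolding \<rho>_def by auto
  have upper: "upper_mass X u y r < \<infinity>" if yr: "cball y r \<subseteq> X" "0 \<le> r" for y r
  proof -
    have "max_avg u y r < \<infinity>" by (rule max_avg_less_top[OF sub yr])
    then obtain C where C: "max_avg u y r \<le> ereal C" by (cases "max_avg u y r") auto
    have "upper_mass X u y r \<le> (\<integral>\<^sup>+w. ennreal C * indicator (cball y r) w \<partial>lborel)"
      unfolding upper_mass_def
    proof (intro nn_integral_mono)
      fix w
      show "e2ennreal (if w \<in> X then u w else 0) * indicator (cball y r) w \<le> ennreal C * indicator (cball y r) w"
      proof (cases "w \<in> cball y r")
        case True
        then have "u w \<le> ereal C" using C le_max_avg[of y w r u] by (simp add: order_trans)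
        from e2ennreal_mono[OF this] show ?thesis using True yr by auto
      qed simp
    qed
    also have "\<dots> = ennreal C * emeasure lborel (cball y r)" by (simp add: nn_integral_cmult_indicator)
    also have "\<dots> < \<infinity>" using emeasure_compact_finite[of "cball y r"] by (simp add: ennreal_mult_less_top)
    finally show ?thesis .
  qed
  obtain y where y: "y \<in> ball x \<rho>" "u y \<noteq> -\<infinity>"
    using subharmonic_finite_dense[OF u X x \<rho>(1)] by blast
  have yX: "cball y (3 * (3 * \<rho>)) \<subseteq> X"
  proof
    fix z assume "z \<in> cball y (3 * (3 * \<rho>))"
    then have "dist x z \<le> d" using dist_triangle[of x z y] y(1) \<rho> by simp
    then show "z \<in> X" using d by auto
  qed
  have "u y \<le> vol_avg u y (2 * \<rho>)"
    unfolding vol_avg_eq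
    by (rule subharmonic_le_average[OF conv u X _ yX isotropic_unit_ball]) (use \<rho> in auto)
  then have vol: "vol_avg u y (2 * \<rho>) \<noteq> -\<infinity>" using y(2) by auto
  have y2: "cball y (2 * \<rho>) \<subseteq> X" using yX \<rho> by (auto simp: subset_eq)
  have lower: "lower_mass X u y (2 * \<rho>) < \<infinity>"
  proof (rule ccontr)
    assume "\<not> lower_mass X u y (2 * \<rho>) < \<infinity>"
    then have top: "lower_mass X u y (2 * \<rho>) = \<infinity>" by (metis top.not_eq_extremum infinity_ennreal_def)
    obtain C where C: "upper_mass X u y (2 * \<rho>) = ennreal C" "0 \<le> C"
      using upper[OF y2] \<rho> by (cases "upper_mass X u y (2 * \<rho>)") auto
    have "0 < measure lborel (cball 0 1 :: (real^'n) set)"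
      by (rule measure_unit_ball_pos)
    moreover have "(1 / (2 * \<rho>)) ^ CARD('n) > 0" using \<rho> by simp
    ultimately have "vol_avg u y (2 * \<rho>) = -\<infinity>"
      using vol_avg_eq_masses[OF subsolution_usc[OF sub] X _ y2] \<rho> top C
      by (simp add: ennreal_mult_top ennreal_mult[symmetric] divide_ereal_def)
    with vol show False by blast
  qed
  have "lower_mass X u x \<rho> \<le> lower_mass X u y (2 * \<rho>)"
    unfolding lower_mass_def
  proof (intro nn_integral_mono mult_left_mono)
    fix w
    have "w \<in> cball y (2 * \<rho>)" if "w \<in> cball x \<rho>"
      using that y(1) dist_triangle[of y w x] by (simp add: dist_commute)
    then show "indicator (cball x \<rho>) w \<le> (indicator (cball y (2 * \<rho>)) w :: ennreal)"
      by (auto simp: indicator_def)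
  qed simp
  moreover have x2: "cball x \<rho> \<subseteq> X" using d \<rho> by (auto simp: subset_eq)
  ultimately show ?thesis using lower upper[OF x2] \<rho> by (intro exI[of _ \<rho>]) auto
qed

lemma vol_avg_continuous:
  assumes conv: "convex F" and u: "F_subharmonic F X u" and X: "open X" and x0: "x0 \<in> X"
  shows "\<exists>\<rho>>0. \<forall>r. 0 < r \<longrightarrow> r < \<rho> \<longrightarrow>
    (\<exists>c. vol_avg u x0 r = ereal c \<and> ((\<lambda>x. vol_avg u x r) \<longlongrightarrow> ereal c) (at x0))"
proof -
  note usc = subsolution_usc[OF F_subharmonic_imp_subsolution[OF u]]
  obtain \<rho> where \<rho>: "\<rho> > 0" "cball x0 \<rho> \<subseteq> X" "upper_mass X u x0 \<rho> < \<infinity>" "lower_mass X u x0 \<rho> < \<infinity>"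
    using subharmonic_locally_integrable[OF conv u X x0] by blast
  have m: "(\<lambda>w. if w \<in> X then u w else 0) \<in> borel_measurable borel"
    by (rule usc_measurable_extension[OF usc X])
  then have m': "(\<lambda>w. - (if w \<in> X then u w else 0)) \<in> borel_measurable borel"
    by (rule borel_measurable_uminus_ereal)
  have "\<exists>c. vol_avg u x0 r = ereal c \<and> ((\<lambda>x. vol_avg u x r) \<longlongrightarrow> ereal c) (at x0)" if r: "0 < r" "r < \<rho>" for r
  proof -
    define \<omega> where "\<omega> = measure lborel (cball 0 1 :: (real^'n) set)"
    have \<omega>: "\<omega> > 0" unfolding \<omega>_def by (rule measure_unit_ball_pos)
    define q where "q = (1 / r) ^ CARD('n)"
    have U: "((\<lambda>x. upper_mass X u x r) \<longlongrightarrow> upper_mass X u x0 r) (at x0)"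
      unfolding upper_mass_def
      by (rule nn_integral_cball_continuous[OF borel_measurable_e2ennreal[OF m] \<rho>(3)[unfolded upper_mass_def] r])
    have L: "((\<lambda>x. lower_mass X u x r) \<longlongrightarrow> lower_mass X u x0 r) (at x0)"
      unfolding lower_mass_def
      by (rule nn_integral_cball_continuous[OF borel_measurable_e2ennreal[OF m'] \<rho>(4)[unfolded lower_mass_def] r])
    have ind: "indicator (cball x0 r) w \<le> (indicator (cball x0 \<rho>) w :: ennreal)" for w
      using r by (auto simp: indicator_def)
    have "upper_mass X u x0 r \<le> upper_mass X u x0 \<rho>" "lower_mass X u x0 r \<le> lower_mass X u x0 \<rho>"
      unfolding upper_mass_def lower_mass_def by (intro nn_integral_mono mult_left_mono ind; simp)+
    then have "upper_mass X u x0 r < \<infinity>" "lower_mass X u x0 r < \<infinity>" using \<rho> by order+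
    then obtain a b where ab: "upper_mass X u x0 r = ennreal a" "0 \<le> a" "lower_mass X u x0 r = ennreal b" "0 \<le> b"
      by (cases "upper_mass X u x0 r"; cases "lower_mass X u x0 r") auto
    have q: "0 \<le> q" using r unfolding q_def by simp
    have ev: "\<forall>\<^sub>F x in at x0. vol_avg u x r = (enn2ereal (ennreal q * upper_mass X u x r)
     - enn2ereal (ennreal q * lower_mass X u x r)) / ereal \<omega>"
    proof -
      have "\<forall>\<^sub>F x in at x0. dist x x0 < \<rho> - r" 
        unfolding eventually_at using r by (intro exI[of _ "\<rho> - r"]) auto
      then show ?thesis
      proof (rule eventually_mono)
        fix x assume x: "dist x x0 < \<rho> - r"
        have "cball x r \<subseteq> X"
        proof
          fix z assume "z \<in> cball x r"
          then have "dist x0 z \<le> \<rho>" using dist_triangle[of x0 z x] x by (simp add: dist_commute)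
          then show "z \<in> X" using \<rho>(2) by auto
        qed
        then show "vol_avg u x r = (enn2ereal (ennreal q * upper_mass X u x r)
          - enn2ereal (ennreal q * lower_mass X u x r)) / ereal \<omega>"
          unfolding q_def \<omega>_def by (rule vol_avg_eq_masses[OF usc X r(1)])
      qed
    qed
    have x0r: "cball x0 r \<subseteq> X" using \<rho>(2) r by (auto simp: subset_eq)
    have qa: "ennreal q * ennreal a = ennreal (q * a)" "ennreal q * ennreal b = ennreal (q * b)"
      using q ab by (simp_all add: ennreal_mult)
    have val: "vol_avg u x0 r = (enn2ereal (ennreal q * upper_mass X u x0 r)
          - enn2ereal (ennreal q * lower_mass X u x0 r)) / ereal \<omega>"
      unfolding q_def \<omega>_def by (rule vol_avg_eq_masses[OF usc X r(1) x0r])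
    also have "\<dots> = ereal ((q * a - q * b) / \<omega>)"
      using \<omega> q ab qa by simp
    finally have fin: "vol_avg u x0 r = ereal ((q * a - q * b) / \<omega>)" .
    have "((\<lambda>x. (enn2ereal (ennreal q * upper_mass X u x r)
     - enn2ereal (ennreal q * lower_mass X u x r)) / ereal \<omega>) \<longlongrightarrow> vol_avg u x0 r) (at x0)"
      unfolding val
    proof (intro tendsto_divide_real_ereal tendsto_diff_ereal_general tendsto_enn2ereal' ennreal_tendsto_cmult U L)
      show "\<not> (enn2ereal (ennreal q * upper_mass X u x0 r) = \<infinity> \<and> enn2ereal (ennreal q * lower_mass X u x0 r) = \<infinity> \<or>
        enn2ereal (ennreal q * upper_mass X u x0 r) = - \<infinity> \<and> enn2ereal (ennreal q * lower_mass X u x0 r) = - \<infinity>)"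
        using q ab qa by simp
    qed (use \<omega> in simp_all)
    then have "((\<lambda>x. vol_avg u x r) \<longlongrightarrow> vol_avg u x0 r) (at x0)"
      using ev by (simp cong: tendsto_cong)
    with fin show ?thesis by auto
  qed
  with \<rho>(1) show ?thesis by blast
qed

section \<open>Kernel convexity of spherical and volume averages\<close>

text \<open>Pass to the limit in \<open>averages_approximation\<close>. By monotonicity a spherical average equal to \<open>-\<infinity>\<close> would
  make all spherical averages of smaller radius, and hence the volume average, equal to \<open>-\<infinity>\<close>.\<close>

lemma averages_kernel_convex:
  assumes conv: "convex F" and u: "F_subharmonic F X u" and X: "open X" and R: "0 < R" "cball x (3 * R) \<subseteq> X"
  obtains s v where "kernel_convex p R s" "kernel_convex p R v"
    "\<And>r. 0 < r \<Longrightarrow> r < R \<Longrightarrow> sphere_avg u x r = ereal (s r)"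
    "\<And>r. 0 < r \<Longrightarrow> r < R \<Longrightarrow> vol_avg u x r = ereal (v r)"
    "\<And>r. 0 < r \<Longrightarrow> r < R \<Longrightarrow> integrable (restrict_space lborel (cball 0 1)) (\<lambda>y::real^'n. s (r * norm y))"
    "\<And>r. 0 < r \<Longrightarrow> r < R \<Longrightarrow> v r * measure lborel (cball 0 1 :: (real^'n) set)
        = integral\<^sup>L (restrict_space lborel (cball 0 1)) (\<lambda>y::real^'n. s (r * norm y))"
proof -
  let ?B = "restrict_space lborel (cball 0 1) :: (real^'n) measure"
  let ?S = "surface_measure :: (real^'n) measure"
  interpret B: isotropic_measure ?B by (rule isotropic_unit_ball)
  interpret S: isotropic_measure ?S by (rule isotropic_surface_measure)
  define \<omega> where "\<omega> = measure ?B (space ?B)"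
  have \<omega>: "\<omega> > 0" using B.pos unfolding \<omega>_def .
  have \<omega>_eq: "measure lborel (cball 0 1 :: (real^'n) set) = \<omega>"
    unfolding \<omega>_def by (simp add: space_restrict_space measure_restrict_space)
  have xX: "x \<in> X" using R by (auto simp: subset_eq)
  obtain S :: "nat \<Rightarrow> real \<Rightarrow> real" where S01: "\<And>k. kernel_convex p R (S k)" "\<And>k. continuous_on {0..R} (S k)"
    and "\<And>k r. 0 \<le> r \<Longrightarrow> r < R \<Longrightarrow> u x \<le> ereal (S k r)"
    and S3: "\<And>k r. 0 \<le> r \<Longrightarrow> r < R \<Longrightarrow> S (Suc k) r \<le> S k r"
    and S_lim: "\<And>M r. isotropic_measure M \<Longrightarrow> 0 \<le> r \<Longrightarrow> r < R \<Longrightarrow>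
      (\<lambda>k. ereal ((\<integral>y. S k (r * norm y) \<partial>M) / measure M (space M))) \<longlonglongrightarrow> measure_avg M u x r"
  proof (rule averages_approximation[OF conv u X R], goal_cases)
    case (1 S)
    from 1(2-6) show ?case by (rule 1(1))
  qed
  note S = S01 S3
  define a where "a k r = (\<integral>y. S k (r * norm y) \<partial>?B) / \<omega>" for k r
  have a_kc: "kernel_convex p R (a k)" for k
    unfolding a_def[abs_def] \<omega>_def by (rule B.kernel_convex_average[OF S(1,2)])
  have a_lim: "(\<lambda>k. ereal (a k r)) \<longlonglongrightarrow> vol_avg u x r" if "0 \<le> r" "r < R" for r
    unfolding a_def \<omega>_def vol_avg_eq by (rule S_lim[OF isotropic_unit_ball that])
  have S_sph: "(\<lambda>k. ereal (S k r)) \<longlonglongrightarrow> sphere_avg u x r" if r: "0 \<le> r" "r < R" for r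
  proof -
    have "(\<integral>y. S k (r * norm y) \<partial>?S) / measure ?S (space ?S) = S k r" for k
    proof -
      have "(\<integral>y. S k (r * norm y) \<partial>?S) = (\<integral>y. S k r \<partial>?S)"
        by (rule Bochner_Integration.integral_cong) (simp_all add: space_surface_measure)
      then show ?thesis using S.pos by simp
    qed
    then show ?thesis using S_lim[OF isotropic_surface_measure r] by (simp add: sphere_avg_eq)
  qed
  have dec: "S k r \<le> S 0 r" if "0 \<le> r" "r < R" for k r
    using decseq_SucI[of "\<lambda>k. S k r"] S(3)[OF that] unfolding decseq_def by blast
  have unit: "r * norm y \<le> r" "0 \<le> r * norm y" "r < R \<Longrightarrow> r * norm y < R" if "y \<in> space ?B" "0 \<le> r" for r and y :: "real^'n"
  proof -
    have "norm y \<le> 1" using that(1) by (simp add: space_restrict_space)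
    then have "r * norm y \<le> r * 1" using that(2) by (intro mult_left_mono) auto
    then show "r * norm y \<le> r" "r < R \<Longrightarrow> r * norm y < R" by linarith+
    show "0 \<le> r * norm y" using that(2) by simp
  qed
  have sph_mono: "sphere_avg u x s \<le> sphere_avg u x t" if "0 \<le> s" "s \<le> t" "t < R" for s t
    by (rule LIMSEQ_le[OF S_sph[of s] S_sph[of t]])
      (use that kernel_convex_mono_closed[OF S(1,2)] in auto)
  have vol_mono: "vol_avg u x s \<le> vol_avg u x t" if "0 < s" "s \<le> t" "t < R" for s t
    by (rule LIMSEQ_le[OF a_lim[of s] a_lim[of t]]) (use that kernel_convex_mono[OF a_kc] in auto)
  have g_lim: "(\<lambda>k. ext_integral ?B (\<lambda>y. ereal (S k (r * norm y)))) \<longlonglongrightarrow> ext_integral ?B (\<lambda>y. sphere_avg u x (r * norm y))"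
    and g_meas: "(\<lambda>y. sphere_avg u x (r * norm y)) \<in> borel_measurable ?B" if r: "0 \<le> r" "r < R" for r
  proof -
    have int: "integrable ?B (\<lambda>y. S k (r * norm y))" for k
      by (rule B.integrable_radial[OF S(2)]) (use r in auto)
    have 1: "finite_measure ?B" by unfold_locales
    have 2: "(\<lambda>y. ereal (S k (r * norm y))) \<in> borel_measurable ?B" for k
      using borel_measurable_integrable[OF int[of k]] by simp
    have 3: "ereal (S (Suc k) (r * norm y)) \<le> ereal (S k (r * norm y))" if "y \<in> space ?B" for k y
      using S(3)[of "r * norm y" k] unit[OF that r(1)] r by simp
    have 4: "ereal (S 0 (r * norm y)) \<le> ereal (S 0 r)" if "y \<in> space ?B" for y
      using kernel_convex_mono_closed[OF S(1,2), of "r * norm y" r] unit[OF that r(1)] r by simp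
    have 5: "(\<lambda>k. ereal (S k (r * norm y))) \<longlonglongrightarrow> sphere_avg u x (r * norm y)" if "y \<in> space ?B" for y
      using S_sph[of "r * norm y"] unit[OF that r(1)] r by simp
    from ext_integral_decreasing_limit[OF 1 2 3 4 5]
    show "(\<lambda>k. ext_integral ?B (\<lambda>y. ereal (S k (r * norm y)))) \<longlonglongrightarrow> ext_integral ?B (\<lambda>y. sphere_avg u x (r * norm y))"
      "(\<lambda>y. sphere_avg u x (r * norm y)) \<in> borel_measurable ?B" by blast+
  qed
  have vol_sph: "vol_avg u x r = ext_integral ?B (\<lambda>y. sphere_avg u x (r * norm y)) / ereal \<omega>"
    if r: "0 \<le> r" "r < R" for r
  proof (rule LIMSEQ_unique[OF a_lim[OF r]])
    have int: "integrable ?B (\<lambda>y. S k (r * norm y))" for k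
      by (rule B.integrable_radial[OF S(2)]) (use r in auto)
    have "(\<lambda>k. ereal (\<integral>y. S k (r * norm y) \<partial>?B)) \<longlonglongrightarrow> ext_integral ?B (\<lambda>y. sphere_avg u x (r * norm y))"
      using g_lim[OF r] unfolding ext_integral_ereal[OF int] .
    from tendsto_divide_real_ereal[OF this, of \<omega>] \<omega>
    show "(\<lambda>k. ereal (a k r)) \<longlonglongrightarrow> ext_integral ?B (\<lambda>y. sphere_avg u x (r * norm y)) / ereal \<omega>"
      unfolding a_def by simp
  qed
  obtain \<rho> where \<rho>: "\<rho> > 0" "\<And>r. 0 < r \<Longrightarrow> r < \<rho> \<Longrightarrow> \<exists>c. vol_avg u x r = ereal c"
    using vol_avg_continuous[OF conv u X xX] by blast
  have vol_fin: "\<exists>c. vol_avg u x r = ereal c" if r: "0 < r" "r < R" for r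
  proof -
    define t where "t = min r (\<rho> / 2)"
    have t: "0 < t" "t \<le> r" "t < \<rho>" using r \<rho> unfolding t_def by auto
    obtain c where "vol_avg u x t = ereal c" using \<rho>(2)[OF t(1,3)] by blast
    then have "vol_avg u x r \<noteq> -\<infinity>" using vol_mono[OF t(1,2) r(2)] by auto
    moreover have "a k r \<le> a 0 r" for k
      unfolding a_def
    proof (intro divide_right_mono integral_mono)
      show "S k (r * norm y) \<le> S 0 (r * norm y)" if "y \<in> space ?B" for y
      proof -
        have "r * norm y < R" using unit(1)[OF that, of r] r by linarith
        then show ?thesis using dec[of "r * norm y" k] r by simp
      qed
    qed (use B.integrable_radial[OF S(2), of r] r \<omega> in auto)
    then have "vol_avg u x r \<le> ereal (a 0 r)"
      using r by (intro LIMSEQ_le_const2[OF a_lim]) auto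
    ultimately show ?thesis by (cases "vol_avg u x r") auto
  qed
  have sph_fin: "\<exists>c. sphere_avg u x r = ereal c" if r: "0 < r" "r < R" for r
  proof -
    have "sphere_avg u x r \<le> ereal (S 0 r)"
      using r dec[of r] by (intro LIMSEQ_le_const2[OF S_sph]) auto
    moreover have "sphere_avg u x r \<noteq> -\<infinity>"
    proof
      assume inf: "sphere_avg u x r = -\<infinity>"
      have g: "sphere_avg u x (r * norm y) = -\<infinity>" if "y \<in> space ?B" for y
        using sph_mono[of "r * norm y" r] unit[OF that, of r] r inf by simp
      have "ext_integral ?B (\<lambda>y. sphere_avg u x (r * norm y)) = ext_integral ?B (\<lambda>y. -\<infinity>)"
        unfolding ext_integral_def
        by (intro arg_cong2[where f = "(-)"] arg_cong[where f = enn2ereal] nn_integral_cong) (simp_all only: g)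
      also have "\<dots> = -\<infinity>"
      proof -
        have "emeasure ?B (space ?B) \<noteq> 0" using \<omega> unfolding \<omega>_def by (auto simp: measure_def)
        moreover have "e2ennreal \<infinity> = top" by (metis e2ennreal_enn2ereal enn2ereal_top infinity_ereal_def)
        ultimately show ?thesis unfolding ext_integral_def
          by (simp add: e2ennreal_neg ennreal_top_mult zero_ennreal.rep_eq)
      qed
      finally have "vol_avg u x r = -\<infinity>" using vol_sph[of r] r \<omega> by (simp add: divide_ereal_def)
      with vol_fin[OF r] show False by auto
    qed
    ultimately show ?thesis by (cases "sphere_avg u x r") auto
  qed
  define s where "s r = real_of_ereal (sphere_avg u x r)" for r
  define v where "v r = real_of_ereal (vol_avg u x r)" for r
  have s: "sphere_avg u x r = ereal (s r)" if "0 < r" "r < R" for r using sph_fin[OF that] unfolding s_def by auto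
  have v: "vol_avg u x r = ereal (v r)" if "0 < r" "r < R" for r using vol_fin[OF that] unfolding v_def by auto
  have "kernel_convex p R s"
  proof (rule kernel_convex_limit[OF S(1)])
    show "(\<lambda>k. S k r) \<longlonglongrightarrow> s r" if "0 < r" "r < R" for r
      using S_sph[of r] s[of r] that by simp
  qed
  moreover have "kernel_convex p R v"
  proof (rule kernel_convex_limit[OF a_kc])
    show "(\<lambda>k. a k r) \<longlonglongrightarrow> v r" if "0 < r" "r < R" for r
      using a_lim[of r] v[of r] that by simp
  qed
  moreover have "integrable ?B (\<lambda>y. s (r * norm y)) \<and> v r * \<omega> = (\<integral>y. s (r * norm y) \<partial>?B)" if r: "0 < r" "r < R" for r
  proof -
    \<comment> \<open>At \<open>y = 0\<close> the average is \<open>u x\<close>, which may be \<open>-\<infinity>\<close>.\<close>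
    have ae: "AE y in ?B. sphere_avg u x (r * norm y) = ereal (s (r * norm y))"
    proof -
      have "AE y in lborel. y \<noteq> (0 :: real^'n)" by (rule AE_lborel_singleton)
      then have "AE y in ?B. y \<noteq> 0" by (subst AE_restrict_space_iff) auto
      then show ?thesis
      proof (rule AE_mp, intro AE_I2 impI)
        fix y :: "real^'n" assume "y \<in> space ?B" "y \<noteq> 0"
        then show "sphere_avg u x (r * norm y) = ereal (s (r * norm y))"
          using s[of "r * norm y"] unit[of y r] r by simp
      qed
    qed
    have eq: "ext_integral ?B (\<lambda>y. sphere_avg u x (r * norm y)) = ext_integral ?B (\<lambda>y. ereal (s (r * norm y)))"
      unfolding ext_integral_def using ae
      by (intro arg_cong2[where f = "(-)"] arg_cong[where f = enn2ereal] nn_integral_cong_AE) auto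
    have val: "ext_integral ?B (\<lambda>y. ereal (s (r * norm y))) / ereal \<omega> = ereal (v r)"
      using vol_sph[of r] v[OF r] r eq by simp
    have int: "integrable ?B (\<lambda>y. s (r * norm y))"
    proof (rule ext_integral_finite_imp_integrable[where C = "max (s r) (s 0)"])
      show "finite_measure ?B" by unfold_locales
      show "(\<lambda>y. s (r * norm y)) \<in> borel_measurable ?B"
        unfolding s_def using g_meas[of r] r by simp
      show "s (r * norm y) \<le> max (s r) (s 0)" if "y \<in> space ?B" for y
      proof (cases "y = 0")
        case False
        then have "0 < r * norm y" "r * norm y \<le> r" using unit[OF that, of r] r by simp_all
        moreover have "r * norm y < R" using unit(3)[OF that, of r] r by simp
        ultimately have "s (r * norm y) \<le> s r"
          using sph_mono[of "r * norm y" r] s[of "r * norm y"] s[OF r] r by simp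
        then show ?thesis by simp
      qed simp
      show "ext_integral ?B (\<lambda>y. ereal (s (r * norm y))) \<noteq> -\<infinity>"
      proof
        assume "ext_integral ?B (\<lambda>y. ereal (s (r * norm y))) = -\<infinity>"
        then show False using val \<omega> by (simp add: divide_ereal_def)
      qed
    qed
    have "ereal ((\<integral>y. s (r * norm y) \<partial>?B) / \<omega>) = ereal (v r)"
      using val \<omega> unfolding ext_integral_ereal[OF int] by simp
    then have "v r * \<omega> = (\<integral>y. s (r * norm y) \<partial>?B)" using \<omega> by (simp add: field_simps)
    with int show ?thesis by blast
  qed
  ultimately show thesis using s v that[of s v] unfolding \<omega>_eq by blast
qed

end

section \<open>Densities\<close>

definition kernel_slope :: "real \<Rightarrow> (real \<Rightarrow> real) \<Rightarrow> real \<Rightarrow> real \<Rightarrow> real" where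
  "kernel_slope p m s r = (m r - m s) / (riesz_kernel p r - riesz_kernel p s)"

lemma kernel_slope_mono:
  assumes m: "kernel_convex p R m" and r: "0 < s" "s < r" "s \<le> s'" "s' < r'" "r \<le> r'" "r' < R"
  shows "kernel_slope p m s r \<le> kernel_slope p m s' r'"
proof -
  let ?K = "riesz_kernel p"
  have "kernel_slope p m s r \<le> kernel_slope p m s r'"
  proof (cases "r = r'")
    case False
    then have "r < r'" using r by simp
    have "?K s < ?K r" "?K s < ?K r'" using r \<open>r < r'\<close> by (auto intro: riesz_kernel_strict_mono)
    moreover have "(m r - m s) * (?K r' - ?K s) \<le> (m r' - m s) * (?K r - ?K s)"
      by (rule kernel_convexD[OF m]) (use r \<open>r < r'\<close> in auto)
    ultimately show ?thesis unfolding kernel_slope_def by (simp add: frac_le_eq divide_le_0_iff)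
  qed simp
  also have "\<dots> \<le> kernel_slope p m s' r'"
  proof (cases "s = s'")
    case False
    then have "s < s'" using r by simp
    have K: "?K s < ?K r'" "?K s' < ?K r'" using r \<open>s < s'\<close> by (auto intro: riesz_kernel_strict_mono)
    have "(m s' - m s) * (?K r' - ?K s) \<le> (m r' - m s) * (?K s' - ?K s)"
      by (rule kernel_convexD[OF m]) (use r \<open>s < s'\<close> in auto)
    then have "(m r' - m s) * (?K r' - ?K s') \<le> (m r' - m s') * (?K r' - ?K s)"
      by (simp add: algebra_simps)
    with K show ?thesis unfolding kernel_slope_def by (simp add: frac_le_eq divide_le_0_iff)
  qed simp
  finally show ?thesis .
qed

lemma kernel_slope_nonneg:
  assumes m: "kernel_convex p R m" and r: "0 < s" "s < r" "r < R"
  shows "0 \<le> kernel_slope p m s r"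
  unfolding kernel_slope_def
  using kernel_convex_mono[OF m, of s r] riesz_kernel_strict_mono[of s r p] r by simp

lemma joint_filter_nontrivial: "at (0::real, 0::real) within {(s, r). 0 < s \<and> s < r} \<noteq> bot"
proof -
  have "(0::real, 0::real) islimpt {(s, r). 0 < s \<and> s < r}"
    unfolding islimpt_approachable
  proof (intro allI impI)
    fix e :: real assume "0 < e"
    have "dist (e / 4, e / 2) (0, 0) \<le> \<bar>e / 4\<bar> + \<bar>e / 2\<bar>"
      unfolding dist_Pair_Pair dist_real_def diff_zero power2_abs by (rule sqrt_sum_squares_le_sum_abs)
    also have "\<dots> < e" using \<open>0 < e\<close> by simp
    finally show "\<exists>x'\<in>{(s :: real, r :: real). 0 < s \<and> s < r}. x' \<noteq> (0, 0) \<and> dist x' (0, 0) < e"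
      using \<open>0 < e\<close> by (intro bexI[of _ "(e / 4, e / 2)"]) auto
  qed
  then show ?thesis by (simp add: trivial_limit_within)
qed

text \<open>As the slopes increase in both radii, their joint limit is their infimum over all pairs of radii below \<open>R\<close>.\<close>

lemma avg_density_eq:
  fixes u :: "real^'n \<Rightarrow> ereal"
  assumes m: "kernel_convex p R m" and R: "0 < R"
    and \<Psi>: "\<And>r. 0 < r \<Longrightarrow> r < R \<Longrightarrow> \<Psi> u x r = ereal (m r)"
  obtains L where "avg_density (riesz_kernel p) \<Psi> u x = ereal L" "0 \<le> L"
    "\<And>s r. 0 < s \<Longrightarrow> s < r \<Longrightarrow> r < R \<Longrightarrow> L \<le> kernel_slope p m s r"
    "\<And>c. L < c \<Longrightarrow> \<exists>r0>0. r0 \<le> R \<and> (\<forall>s r. 0 < s \<longrightarrow> s < r \<longrightarrow> r < r0 \<longrightarrow> kernel_slope p m s r < c)"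
proof -
  define V where "V = {kernel_slope p m s r | s r. 0 < s \<and> s < r \<and> r < R}"
  define L where "L = Inf V"
  have ne: "V \<noteq> {}"
  proof -
    have "kernel_slope p m (R / 3) (R / 2) \<in> V" unfolding V_def using R
      by (intro CollectI exI[of _ "R / 3"] exI[of _ "R / 2"]) auto
    then show ?thesis by blast
  qed
  have nonneg: "0 \<le> d" if "d \<in> V" for d using that kernel_slope_nonneg[OF m] unfolding V_def by blast
  have bdd: "bdd_below V" using nonneg by (rule bdd_belowI)
  have L0: "0 \<le> L" unfolding L_def using ne nonneg by (rule cInf_greatest)
  have lower: "L \<le> kernel_slope p m s r" if "0 < s" "s < r" "r < R" for s r
    unfolding L_def using bdd by (rule cInf_lower[rotated]) (use that in \<open>auto simp: V_def\<close>)
  have upper: "\<exists>r0>0. r0 \<le> R \<and> (\<forall>s r. 0 < s \<longrightarrow> s < r \<longrightarrow> r < r0 \<longrightarrow> kernel_slope p m s r < c)" if lt: "L < c" for c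
  proof -
    obtain d where "d \<in> V" "d < c" using lt cInf_lessD[OF ne] unfolding L_def by blast
    then obtain s0 r0 where sr: "0 < s0" "s0 < r0" "r0 < R" "kernel_slope p m s0 r0 < c"
      unfolding V_def by blast
    have "kernel_slope p m s r < c" if "0 < s" "s < r" "r < s0" for s r
    proof -
      have "kernel_slope p m s r \<le> kernel_slope p m s0 r0"
        by (rule kernel_slope_mono[OF m]) (use that sr in auto)
      with sr(4) show ?thesis by simp
    qed
    then show ?thesis using sr by (intro exI[of _ s0]) auto
  qed
  let ?F = "at (0, 0) within {(s, r). 0 < s \<and> s < (r :: real)}"
  have near: "\<forall>\<^sub>F z in ?F. 0 < fst z \<and> fst z < snd z \<and> snd z < \<rho>" if "0 < \<rho>" for \<rho>
    unfolding eventually_at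
  proof (intro exI[of _ \<rho>] conjI that ballI impI)
    fix z :: "real \<times> real" assume z: "z \<in> {(s, r). 0 < s \<and> s < r}" "z \<noteq> (0, 0) \<and> dist z (0, 0) < \<rho>"
    have "dist (snd z) (snd (0::real, 0::real)) \<le> dist z (0, 0)" by (rule dist_snd_le)
    then show "0 < fst z" "fst z < snd z" "snd z < \<rho>" using z by (auto simp: dist_real_def split_beta)
  qed
  have lim: "((\<lambda>z. kernel_slope p m (fst z) (snd z)) \<longlongrightarrow> L) ?F"
  proof (rule order_tendstoI)
    fix c assume "c < L"
    from near[OF R] show "\<forall>\<^sub>F z in ?F. c < kernel_slope p m (fst z) (snd z)"
      by (rule eventually_mono) (use \<open>c < L\<close> lower in \<open>auto intro: less_le_trans\<close>)
  next
    fix c assume "L < c"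
    then obtain r0 where r0: "r0 > 0" "\<forall>s r. 0 < s \<longrightarrow> s < r \<longrightarrow> r < r0 \<longrightarrow> kernel_slope p m s r < c"
      using upper by blast
    from near[OF r0(1)] show "\<forall>\<^sub>F z in ?F. kernel_slope p m (fst z) (snd z) < c"
      by (rule eventually_mono) (use r0(2) in auto)
  qed
  have "((\<lambda>(s, r). (\<Psi> u x r - \<Psi> u x s) / ereal (riesz_kernel p r - riesz_kernel p s)) \<longlongrightarrow> ereal L) ?F"
  proof (rule Lim_transform_eventually[OF tendsto_ereal[OF lim]])
    from near[OF R] show "\<forall>\<^sub>F z in ?F. ereal (kernel_slope p m (fst z) (snd z))
       = (case z of (s, r) \<Rightarrow> (\<Psi> u x r - \<Psi> u x s) / ereal (riesz_kernel p r - riesz_kernel p s))"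
    proof (rule eventually_mono)
      fix z :: "real \<times> real" assume z: "0 < fst z \<and> fst z < snd z \<and> snd z < R"
      then have "riesz_kernel p (fst z) < riesz_kernel p (snd z)" by (intro riesz_kernel_strict_mono) auto
      then show "ereal (kernel_slope p m (fst z) (snd z))
       = (case z of (s, r) \<Rightarrow> (\<Psi> u x r - \<Psi> u x s) / ereal (riesz_kernel p r - riesz_kernel p s))"
        using z \<Psi>[of "fst z"] \<Psi>[of "snd z"] by (simp add: split_beta kernel_slope_def)
    qed
  qed
  then have "avg_density (riesz_kernel p) \<Psi> u x = ereal L"
    unfolding avg_density_def by (rule tendsto_Lim[OF joint_filter_nontrivial])
  from that[OF this L0 lower upper] show thesis .
qed

lemma closedin_superlevel_set:
  fixes \<Theta> :: "'a::topological_space \<Rightarrow> ereal"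
  assumes usc: "usc_on X \<Theta>" and X: "open X"
  shows "closedin (top_of_set X) {x \<in> X. c \<le> \<Theta> x}"
proof -
  have "open {x \<in> X. \<Theta> x < c}" by (rule usc_on_open_sublevel[OF usc X])
  then have "openin (top_of_set X) {x \<in> X. \<Theta> x < c}"
    by (intro open_openin_trans X) auto
  moreover have "X - {x \<in> X. c \<le> \<Theta> x} = {x \<in> X. \<Theta> x < c}" by (auto simp: not_le)
  ultimately show ?thesis unfolding closedin_def by auto
qed

context riesz_cone
begin

text \<open>For \<open>d = |x - x\<^sub>0|\<close> the slope at \<open>x\<close> for radii \<open>s < r\<close> is at most
  \<open>(M(u,x\<^sub>0,r + d) - M(u,x\<^sub>0,s - d)) / (K(r) - K(s))\<close>, and this is continuous at \<open>d = 0\<close>.\<close>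

lemma max_density_usc:
  assumes u: "F_subharmonic F X u" and X: "open X"
  shows "usc_on X (avg_density (riesz_kernel p) max_avg u)"
  unfolding usc_on_def
proof (intro ballI allI impI)
  note sub = F_subharmonic_imp_subsolution[OF u]
  let ?K = "riesz_kernel p"
  define m where "m x r = real_of_ereal (max_avg u x r)" for x r
  have m: "max_avg u x r = ereal (m x r)" if "ball x R \<subseteq> X" "0 < r" "r < R" for x r R
    unfolding m_def by (rule max_avg_finite[OF u X]) (use that in \<open>auto simp: subset_eq\<close>)
  have kc: "kernel_convex p R (m x)" if "ball x R \<subseteq> X" for x R
    by (rule max_avg_kernel_convex[OF sub that m[OF that]])
  fix x0 c assume x0: "x0 \<in> X" and c: "avg_density ?K max_avg u x0 < c"
  obtain R where R: "R > 0" "ball x0 R \<subseteq> X" using X x0 open_contains_ball by blast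
  obtain L where L: "avg_density ?K max_avg u x0 = ereal L"
    "\<And>c. L < c \<Longrightarrow> \<exists>r0>0. r0 \<le> R \<and> (\<forall>s r. 0 < s \<longrightarrow> s < r \<longrightarrow> r < r0 \<longrightarrow> kernel_slope p (m x0) s r < c)"
    by (rule avg_density_eq[OF kc[OF R(2)] R(1), of max_avg u x0]) (use m[OF R(2)] in blast)+
  obtain c' where c': "L < c'" "ereal c' < c" using c L(1) ereal_dense2[of "ereal L" c] by auto
  obtain r0 where r0: "r0 > 0" "r0 \<le> R" "\<And>s r. 0 < s \<Longrightarrow> s < r \<Longrightarrow> r < r0 \<Longrightarrow> kernel_slope p (m x0) s r < c'"
    using L(2)[OF c'(1)] by blast
  define s where "s = r0 / 3"
  define r where "r = r0 / 2"
  have sr: "0 < s" "s < r" "r < r0" "r < R" using r0 unfolding s_def r_def by auto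
  have K: "?K s < ?K r" using sr by (intro riesz_kernel_strict_mono) auto
  have cont: "isCont (m x0) r" "isCont (m x0) s"
    using kernel_convex_isCont[OF kc[OF R(2)]] sr by auto
  define G where "G d = (m x0 (r + d) - m x0 (s - d)) / (?K r - ?K s)" for d
  have "isCont (\<lambda>d. m x0 (r + d)) 0"
    by (rule isCont_o2[where f = "\<lambda>d. r + d" and g = "m x0"]) (use cont in simp_all)
  moreover have "isCont (\<lambda>d. m x0 (s - d)) 0"
    by (rule isCont_o2[where f = "\<lambda>d. s - d" and g = "m x0"]) (use cont in simp_all)
  ultimately have "isCont G 0"
    unfolding G_def using K by (intro isCont_divide isCont_diff continuous_const) simp_all
  then have "(G \<longlongrightarrow> G 0) (at 0)" unfolding isCont_def .
  moreover have "G 0 < c'" using r0(3)[OF sr(1-3)] unfolding G_def kernel_slope_def by simp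
  ultimately have "\<forall>\<^sub>F d in at 0. G d < c'" by (rule order_tendstoD(2))
  then obtain e where e: "e > 0" "\<And>d. d \<noteq> 0 \<Longrightarrow> \<bar>d\<bar> < e \<Longrightarrow> G d < c'"
    unfolding eventually_at by (auto simp: dist_real_def)
  define \<rho> where "\<rho> = min e (min s (R - r))"
  have \<rho>: "\<rho> > 0" using e sr unfolding \<rho>_def by simp
  have "avg_density ?K max_avg u x < c" if x: "x \<noteq> x0" "dist x x0 < \<rho>" for x
  proof -
    define d where "d = dist x x0"
    have d: "0 < d" "d < e" "d < s" "d < R - r" using x unfolding d_def \<rho>_def by auto
    have bx: "ball x (R - d) \<subseteq> X"
    proof
      fix z assume "z \<in> ball x (R - d)"
      then have "dist x0 z < R" using dist_triangle[of x0 z x] unfolding d_def by (simp add: dist_commute)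
      then show "z \<in> X" using R(2) by auto
    qed
    have "0 < R - d" using d sr by simp
    then obtain L' where L': "avg_density ?K max_avg u x = ereal L'"
      "\<And>s r. 0 < s \<Longrightarrow> s < r \<Longrightarrow> r < R - d \<Longrightarrow> L' \<le> kernel_slope p (m x) s r"
      by (rule avg_density_eq[OF kc[OF bx], of max_avg u x]) (use m[OF bx] in blast)+
    have "L' \<le> kernel_slope p (m x) s r" by (rule L'(2)) (use sr d in auto)
    also have "\<dots> \<le> G d"
    proof -
      have "max_avg u x r \<le> max_avg u x0 (r + d)" "max_avg u x0 (s - d) \<le> max_avg u x s"
        unfolding d_def by (intro max_avg_mono_ball; simp add: cball_subset_cball_iff dist_commute)+
      then have "m x r \<le> m x0 (r + d)" "m x0 (s - d) \<le> m x s"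
        using m[OF bx, of r] m[OF bx, of s] m[OF R(2), of "r + d"] m[OF R(2), of "s - d"] sr d by auto
      then show ?thesis unfolding kernel_slope_def G_def using K by (intro divide_right_mono) auto
    qed
    also have "G d < c'" using e(2)[of d] d by simp
    finally have "ereal L' < ereal c'" by simp
    also have "\<dots> < c" by (rule c'(2))
    finally show ?thesis unfolding L'(1) .
  qed
  then show "\<forall>\<^sub>F x in at x0 within X. avg_density ?K max_avg u x < c"
    unfolding eventually_at using \<rho> by blast
qed

text \<open>For fixed small radii the slope of the volume averages is continuous in the centre.\<close>

lemma vol_density_usc:
  assumes conv: "convex F" and u: "F_subharmonic F X u" and X: "open X"
  shows "usc_on X (avg_density (riesz_kernel p) vol_avg u)"
  unfolding usc_on_def
proof (intro ballI allI impI)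
  let ?K = "riesz_kernel p"
  fix x0 c assume x0: "x0 \<in> X" and c: "avg_density ?K vol_avg u x0 < c"
  obtain d where d: "d > 0" "cball x0 d \<subseteq> X" using X x0 open_contains_cball by blast
  define R where "R = d / 4"
  have R: "0 < R" "d = 4 * R" using d unfolding R_def by auto
  have cb: "cball x (3 * R) \<subseteq> X" if "dist x x0 \<le> R" for x
  proof
    fix z assume "z \<in> cball x (3 * R)"
    then have "dist x0 z \<le> d" using that dist_triangle[of x0 z x] R by (simp add: dist_commute)
    then show "z \<in> X" using d by auto
  qed
  have dens: "\<exists>L v. avg_density ?K vol_avg u x = ereal L \<and> (\<forall>r. 0 < r \<and> r < R \<longrightarrow> vol_avg u x r = ereal (v r)) \<and>
    (\<forall>s r. 0 < s \<and> s < r \<and> r < R \<longrightarrow> L \<le> kernel_slope p v s r) \<and>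
    (\<forall>c. L < c \<longrightarrow> (\<exists>r0>0. r0 \<le> R \<and> (\<forall>s r. 0 < s \<longrightarrow> s < r \<longrightarrow> r < r0 \<longrightarrow> kernel_slope p v s r < c)))"
    if x: "dist x x0 \<le> R" for x
  proof -
    obtain v where v: "kernel_convex p R v" "\<And>r. 0 < r \<Longrightarrow> r < R \<Longrightarrow> vol_avg u x r = ereal (v r)"
    proof (rule averages_kernel_convex[OF conv u X R(1) cb[OF x]], goal_cases)
      case (1 s v)
      from 1(3) 1(5) show ?case by (rule 1(1))
    qed
    obtain L where "avg_density ?K vol_avg u x = ereal L"
      "\<And>s r. 0 < s \<Longrightarrow> s < r \<Longrightarrow> r < R \<Longrightarrow> L \<le> kernel_slope p v s r"
      "\<And>c. L < c \<Longrightarrow> \<exists>r0>0. r0 \<le> R \<and> (\<forall>s r. 0 < s \<longrightarrow> s < r \<longrightarrow> r < r0 \<longrightarrow> kernel_slope p v s r < c)"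
      by (rule avg_density_eq[OF v(1) R(1), of vol_avg u x]) (use v(2) in blast)+
    with v show ?thesis by (intro exI[of _ L] exI[of _ v]) simp
  qed
  obtain L v where L: "avg_density ?K vol_avg u x0 = ereal L"
    and v: "\<And>r. 0 < r \<Longrightarrow> r < R \<Longrightarrow> vol_avg u x0 r = ereal (v r)"
    and L2: "\<And>c. L < c \<Longrightarrow> \<exists>r0>0. r0 \<le> R \<and> (\<forall>s r. 0 < s \<longrightarrow> s < r \<longrightarrow> r < r0 \<longrightarrow> kernel_slope p v s r < c)"
    using dens[of x0] R by auto
  obtain c' where c': "L < c'" "ereal c' < c" using c L ereal_dense2[of "ereal L" c] by auto
  obtain r0 where r0: "r0 > 0" "r0 \<le> R" "\<And>s r. 0 < s \<Longrightarrow> s < r \<Longrightarrow> r < r0 \<Longrightarrow> kernel_slope p v s r < c'"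
    using L2[OF c'(1)] by blast
  obtain \<rho> where \<rho>: "\<rho> > 0" "\<And>r. 0 < r \<Longrightarrow> r < \<rho> \<Longrightarrow>
    \<exists>c. vol_avg u x0 r = ereal c \<and> ((\<lambda>x. vol_avg u x r) \<longlongrightarrow> ereal c) (at x0)"
    using vol_avg_continuous[OF conv u X x0] by blast
  define t where "t = min r0 \<rho>"
  define s where "s = t / 3"
  define r where "r = t / 2"
  have t: "t > 0" using r0 \<rho> unfolding t_def by simp
  have sr: "0 < s" "s < r" "r < r0" "r < \<rho>" "s < \<rho>" "r < R"
    using t r0(1,2) unfolding s_def r_def t_def by auto
  have K: "?K s < ?K r" using sr by (intro riesz_kernel_strict_mono) auto
  have lim: "((\<lambda>x. vol_avg u x r) \<longlongrightarrow> ereal (v r)) (at x0)" "((\<lambda>x. vol_avg u x s) \<longlongrightarrow> ereal (v s)) (at x0)"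
    using \<rho>(2)[of r] \<rho>(2)[of s] v[of r] v[of s] sr by auto
  have "((\<lambda>x. (vol_avg u x r - vol_avg u x s) / ereal (?K r - ?K s)) \<longlongrightarrow>
     (ereal (v r) - ereal (v s)) / ereal (?K r - ?K s)) (at x0)"
    using K by (intro tendsto_divide_real_ereal tendsto_diff_ereal_general lim) auto
  moreover have "(ereal (v r) - ereal (v s)) / ereal (?K r - ?K s) < ereal c'"
    using r0(3)[OF sr(1-3)] K unfolding kernel_slope_def by simp
  ultimately have ev: "\<forall>\<^sub>F x in at x0. (vol_avg u x r - vol_avg u x s) / ereal (?K r - ?K s) < ereal c'"
    by (rule order_tendstoD(2))
  have "\<forall>\<^sub>F x in at x0. dist x x0 < R"
    unfolding eventually_at using R by (intro exI[of _ R]) auto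
  with ev have "\<forall>\<^sub>F x in at x0. avg_density ?K vol_avg u x < c"
  proof eventually_elim
    case (elim x)
    obtain L' v' where L': "avg_density ?K vol_avg u x = ereal L'"
      and v': "\<And>r. 0 < r \<Longrightarrow> r < R \<Longrightarrow> vol_avg u x r = ereal (v' r)"
      and le: "\<And>s r. 0 < s \<Longrightarrow> s < r \<Longrightarrow> r < R \<Longrightarrow> L' \<le> kernel_slope p v' s r"
      using dens[of x] elim by auto
    have "ereal L' \<le> ereal (kernel_slope p v' s r)" using le[of s r] sr by simp
    also have "\<dots> = (vol_avg u x r - vol_avg u x s) / ereal (?K r - ?K s)"
      using v'[of s] v'[of r] sr K unfolding kernel_slope_def by simp
    also have "\<dots> < ereal c'" using elim by simp
    also have "\<dots> < c" by (rule c'(2))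
    finally show ?case unfolding L' .
  qed
  then show "\<forall>\<^sub>F x in at x0 within X. avg_density ?K vol_avg u x < c"
    by (rule filter_leD[OF at_le, rotated]) simp
qed

text \<open>Let \<open>L\<close> be the density of \<open>S\<close>. For small radii \<open>S(r |y|) - S(s |y|)\<close> lies between \<open>L\<close> and \<open>L + \<epsilon>\<close> times
  \<open>K(r |y|) - K(s |y|) = |y|\<^bsup>2-p\<^esup> (K(r) - K(s))\<close>. Integrating over the unit ball compares the slopes of the
  volume averages with \<open>L\<close>. If \<open>|y|\<^bsup>2-p\<^esup>\<close> is not integrable, the lower bound and the integrability of
  \<open>S(r |y|)\<close> leave only \<open>L = 0\<close>.\<close>

lemma sphere_density_vol_density:
  assumes conv: "convex F" and u: "F_subharmonic F X u" and X: "open X" and x: "x \<in> X"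
  defines "\<kappa> \<equiv> \<lambda>y::real^'n. norm y powr (2 - p)"
  obtains L where "avg_density (riesz_kernel p) sphere_avg u x = ereal L"
    "\<not> integrable (restrict_space lborel (cball 0 1)) \<kappa> \<Longrightarrow> L = 0"
    "integrable (restrict_space lborel (cball 0 1)) \<kappa> \<Longrightarrow> avg_density (riesz_kernel p) vol_avg u x
       = ereal (L * (integral\<^sup>L (restrict_space lborel (cball 0 1)) \<kappa> / measure lborel (cball 0 1 :: (real^'n) set)))"
proof -
  let ?B = "restrict_space lborel (cball 0 1) :: (real^'n) measure"
  let ?K = "riesz_kernel p"
  interpret B: isotropic_measure ?B by (rule isotropic_unit_ball)
  define \<omega> where "\<omega> = measure lborel (cball 0 1 :: (real^'n) set)"
  have \<omega>: "\<omega> > 0" unfolding \<omega>_def by (rule measure_unit_ball_pos)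
  obtain d where d: "d > 0" "cball x d \<subseteq> X" using X x open_contains_cball by blast
  define R where "R = d / 3"
  have R: "0 < R" "cball x (3 * R) \<subseteq> X" using d unfolding R_def by auto
  obtain S V where S: "kernel_convex p R S" and V: "kernel_convex p R V"
    and S_eq: "\<And>r. 0 < r \<Longrightarrow> r < R \<Longrightarrow> sphere_avg u x r = ereal (S r)"
    and V_eq: "\<And>r. 0 < r \<Longrightarrow> r < R \<Longrightarrow> vol_avg u x r = ereal (V r)"
    and int: "\<And>r. 0 < r \<Longrightarrow> r < R \<Longrightarrow> integrable ?B (\<lambda>y. S (r * norm y))"
    and VS: "\<And>r. 0 < r \<Longrightarrow> r < R \<Longrightarrow> V r * \<omega> = integral\<^sup>L ?B (\<lambda>y. S (r * norm y))"
    unfolding \<omega>_def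
  proof (rule averages_kernel_convex[OF conv u X R], goal_cases)
    case (1 s v)
    from 1(2-7) show ?case by (rule 1(1))
  qed
  obtain L where L: "avg_density ?K sphere_avg u x = ereal L" "0 \<le> L"
    and L_le: "\<And>s r. 0 < s \<Longrightarrow> s < r \<Longrightarrow> r < R \<Longrightarrow> L \<le> kernel_slope p S s r"
    and L_up: "\<And>c. L < c \<Longrightarrow> \<exists>r0>0. r0 \<le> R \<and> (\<forall>s r. 0 < s \<longrightarrow> s < r \<longrightarrow> r < r0 \<longrightarrow> kernel_slope p S s r < c)"
    by (rule avg_density_eq[OF S R(1), of sphere_avg u x]) (use S_eq in blast)+
  obtain L' where L': "avg_density ?K vol_avg u x = ereal L'" "0 \<le> L'"
    and L'_le: "\<And>s r. 0 < s \<Longrightarrow> s < r \<Longrightarrow> r < R \<Longrightarrow> L' \<le> kernel_slope p V s r"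
    and L'_up: "\<And>c. L' < c \<Longrightarrow> \<exists>r0>0. r0 \<le> R \<and> (\<forall>s r. 0 < s \<longrightarrow> s < r \<longrightarrow> r < r0 \<longrightarrow> kernel_slope p V s r < c)"
    by (rule avg_density_eq[OF V R(1), of vol_avg u x]) (use V_eq in blast)+
  have norm1: "norm y \<le> 1" if "y \<in> space ?B" for y using that by (simp add: space_restrict_space)
  have diff: "S (r * norm y) - S (s * norm y) = kernel_slope p S (s * norm y) (r * norm y) * (\<kappa> y * (?K r - ?K s))"
    if "y \<noteq> 0" "0 < s" "s < r" for s r y
  proof -
    have "?K (s * norm y) < ?K (r * norm y)" using that by (intro riesz_kernel_strict_mono) auto
    moreover have eq: "?K (r * norm y) - ?K (s * norm y) = \<kappa> y * (?K r - ?K s)"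
      unfolding \<kappa>_def using that by (intro kernel_scaling) auto
    ultimately show ?thesis unfolding kernel_slope_def eq[symmetric] by simp
  qed
  have \<kappa>_meas: "\<kappa> \<in> borel_measurable ?B" unfolding \<kappa>_def by (intro measurable_restrict_space1) measurable
  have \<kappa>_nonneg: "0 \<le> \<kappa> y" for y unfolding \<kappa>_def by simp
  have \<kappa>0: "\<kappa> 0 = 0" unfolding \<kappa>_def by simp
  have lower: "L * (\<kappa> y * (?K r - ?K s)) \<le> S (r * norm y) - S (s * norm y)"
    if y: "y \<in> space ?B" and sr: "0 < s" "s < r" "r < R" for s r y
  proof (cases "y = 0")
    case False
    have "r * norm y \<le> r * 1" using norm1[OF y] sr by (intro mult_left_mono) auto
    then have "r * norm y < R" using sr by linarith
    then have "L \<le> kernel_slope p S (s * norm y) (r * norm y)"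
      using False sr by (intro L_le) auto
    moreover have "0 \<le> \<kappa> y * (?K r - ?K s)"
      using \<kappa>_nonneg riesz_kernel_strict_mono[OF sr(1,2), of p] by simp
    ultimately show ?thesis unfolding diff[OF False sr(1,2)] by (intro mult_right_mono)
  qed (simp add: \<kappa>0)
  have Vdiff: "(V r - V s) * \<omega> = integral\<^sup>L ?B (\<lambda>y. S (r * norm y) - S (s * norm y))"
    if "0 < s" "s < r" "r < R" for s r
    using VS[of r] VS[of s] int[of r] int[of s] that by (simp add: left_diff_distrib)
  have not_int: "L = 0" if "\<not> integrable ?B \<kappa>"
  proof (rule ccontr)
    assume "L \<noteq> 0"
    then have "L > 0" using L(2) by simp
    define s where "s = R / 3"
    define r where "r = R / 2"
    have sr: "0 < s" "s < r" "r < R" using R unfolding s_def r_def by auto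
    \<comment> \<open>The function \<open>q \<kappa>\<close> is dominated by the integrable function \<open>S (r |y|) - S (s |y|)\<close>.\<close>
    define q where "q = L * (?K r - ?K s)"
    have q: "q > 0" unfolding q_def using \<open>L > 0\<close> riesz_kernel_strict_mono[OF sr(1,2), of p] by simp
    have "integrable ?B (\<lambda>y. q * \<kappa> y)"
    proof (rule Bochner_Integration.integrable_bound)
      show "integrable ?B (\<lambda>y. S (r * norm y) - S (s * norm y))"
        using int[of r] int[of s] sr by simp
      show "(\<lambda>y. q * \<kappa> y) \<in> borel_measurable ?B" using \<kappa>_meas by simp
      show "AE y in ?B. norm (q * \<kappa> y) \<le> norm (S (r * norm y) - S (s * norm y))"
      proof (rule AE_I2)
        fix y assume "y \<in> space ?B"
        from lower[OF this sr] have "q * \<kappa> y \<le> S (r * norm y) - S (s * norm y)"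
          unfolding q_def by (simp add: mult_ac)
        moreover have "0 \<le> q * \<kappa> y" using q \<kappa>_nonneg by simp
        ultimately show "norm (q * \<kappa> y) \<le> norm (S (r * norm y) - S (s * norm y))" by simp
      qed
    qed
    from integrable_mult_right[OF this, of "1 / q"] q have "integrable ?B \<kappa>" by simp
    with that show False by blast
  qed
  have vol: "L' = L * (integral\<^sup>L ?B \<kappa> / \<omega>)" if \<kappa>_int: "integrable ?B \<kappa>"
  proof (rule antisym)
    define I where "I = integral\<^sup>L ?B \<kappa>"
    have I: "0 \<le> I" unfolding I_def using \<kappa>_nonneg by (intro Bochner_Integration.integral_nonneg) auto
    have slope_lower: "L * (I / \<omega>) \<le> kernel_slope p V s r" if sr: "0 < s" "s < r" "r < R" for s r
    proof -
      have K: "?K s < ?K r" using riesz_kernel_strict_mono sr by simp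
      have "integral\<^sup>L ?B (\<lambda>y. L * (\<kappa> y * (?K r - ?K s))) \<le> integral\<^sup>L ?B (\<lambda>y. S (r * norm y) - S (s * norm y))"
        by (rule integral_mono) (use lower[OF _ sr] int[of r] int[of s] sr \<kappa>_int in auto)
      then have "L * I * (?K r - ?K s) \<le> (V r - V s) * \<omega>"
        unfolding Vdiff[OF sr] I_def by (simp add: mult_ac)
      then show ?thesis using K \<omega> unfolding kernel_slope_def by (simp add: field_simps)
    qed
    show "L * (integral\<^sup>L ?B \<kappa> / \<omega>) \<le> L'"
    proof (rule field_le_epsilon)
      fix \<epsilon> :: real assume "0 < \<epsilon>"
      then obtain r0 where r0: "r0 > 0" "r0 \<le> R" "\<And>s r. 0 < s \<Longrightarrow> s < r \<Longrightarrow> r < r0 \<Longrightarrow> kernel_slope p V s r < L' + \<epsilon>"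
        using L'_up[of "L' + \<epsilon>"] by auto
      have "L * (I / \<omega>) \<le> kernel_slope p V (r0 / 3) (r0 / 2)" by (rule slope_lower) (use r0 in auto)
      also have "\<dots> < L' + \<epsilon>" by (rule r0(3)) (use r0 in auto)
      finally show "L * (integral\<^sup>L ?B \<kappa> / \<omega>) \<le> L' + \<epsilon>" unfolding I_def by simp
    qed
    show "L' \<le> L * (integral\<^sup>L ?B \<kappa> / \<omega>)"
    proof (rule field_le_epsilon)
      fix \<epsilon> :: real assume \<epsilon>: "0 < \<epsilon>"
      define \<epsilon>' where "\<epsilon>' = \<epsilon> / (I / \<omega> + 1)"
      have pos: "0 < I / \<omega> + 1" using I \<omega> by (simp add: add_nonneg_pos)
      have \<epsilon>': "\<epsilon>' > 0" "\<epsilon>' * (I / \<omega>) \<le> \<epsilon>"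
        using \<epsilon> pos I \<omega> unfolding \<epsilon>'_def by (simp_all add: field_simps)
      obtain r0 where r0: "r0 > 0" "r0 \<le> R" "\<And>s r. 0 < s \<Longrightarrow> s < r \<Longrightarrow> r < r0 \<Longrightarrow> kernel_slope p S s r < L + \<epsilon>'"
        using L_up[of "L + \<epsilon>'"] \<epsilon>' by auto
      define s where "s = r0 / 3"
      define r where "r = r0 / 2"
      have sr: "0 < s" "s < r" "r < r0" "r < R" using r0(1,2) unfolding s_def r_def by auto
      have K: "?K s < ?K r" using riesz_kernel_strict_mono sr by simp
      have upper: "S (r * norm y) - S (s * norm y) \<le> (L + \<epsilon>') * (\<kappa> y * (?K r - ?K s))" if y: "y \<in> space ?B" for y
      proof (cases "y = 0")
        case False
        have "r * norm y \<le> r * 1" using norm1[OF y] sr by (intro mult_left_mono) auto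
        then have "r * norm y < r0" using sr by linarith
        then have "kernel_slope p S (s * norm y) (r * norm y) < L + \<epsilon>'"
          using False sr by (intro r0(3)) auto
        moreover have "0 \<le> \<kappa> y * (?K r - ?K s)" using \<kappa>_nonneg K by simp
        ultimately show ?thesis unfolding diff[OF False sr(1,2)] by (intro mult_right_mono) auto
      qed (simp add: \<kappa>0)
      have "integral\<^sup>L ?B (\<lambda>y. S (r * norm y) - S (s * norm y)) \<le> integral\<^sup>L ?B (\<lambda>y. (L + \<epsilon>') * (\<kappa> y * (?K r - ?K s)))"
        by (rule integral_mono) (use upper int[of r] int[of s] sr \<kappa>_int in auto)
      then have "(V r - V s) * \<omega> \<le> (L + \<epsilon>') * I * (?K r - ?K s)"
        unfolding Vdiff[OF sr(1,2,4)] I_def by (simp add: mult_ac)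
      then have "kernel_slope p V s r \<le> (L + \<epsilon>') * (I / \<omega>)"
        using K \<omega> unfolding kernel_slope_def by (simp add: field_simps)
      moreover have "L' \<le> kernel_slope p V s r" using L'_le[OF sr(1,2,4)] .
      ultimately show "L' \<le> L * (integral\<^sup>L ?B \<kappa> / \<omega>) + \<epsilon>"
        using \<epsilon>'(2) unfolding I_def[symmetric] distrib_right by linarith
    qed
  qed
  show thesis
    by (rule that[OF L(1)]) (use not_int vol L'(1) in \<open>simp_all add: \<omega>_def\<close>)
qed

lemma sphere_density_usc:
  assumes conv: "convex F" and u: "F_subharmonic F X u" and X: "open X"
  shows "usc_on X (avg_density (riesz_kernel p) sphere_avg u)"
  unfolding usc_on_def
proof (intro ballI allI impI)
  let ?B = "restrict_space lborel (cball 0 1) :: (real^'n) measure"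
  let ?\<kappa> = "\<lambda>y::real^'n. norm y powr (2 - p)"
  let ?\<Theta> = "avg_density (riesz_kernel p) sphere_avg u"
  let ?\<Theta>' = "avg_density (riesz_kernel p) vol_avg u"
  interpret B: isotropic_measure ?B by (rule isotropic_unit_ball)
  fix x0 c assume x0: "x0 \<in> X" and c: "?\<Theta> x0 < c"
  have near: "\<forall>\<^sub>F x in at x0 within X. x \<in> X"
    by (simp add: eventually_at_filter)
  show "\<forall>\<^sub>F x in at x0 within X. ?\<Theta> x < c"
  proof (cases "integrable ?B ?\<kappa>")
    case False
    have "?\<Theta> x = 0" if "x \<in> X" for x
      using sphere_density_vol_density[OF conv u X that] False by (metis zero_ereal_def)
    then show ?thesis using near c x0 by (auto elim: eventually_mono)
  next
    case True
    define a where "a = integral\<^sup>L ?B ?\<kappa> / measure lborel (cball 0 1 :: (real^'n) set)"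
    have a: "a > 0"
    proof -
      have "integral\<^sup>L ?B ?\<kappa> \<noteq> 0"
      proof
        assume "integral\<^sup>L ?B ?\<kappa> = 0"
        then have "AE y in ?B. ?\<kappa> y = 0"
          using integral_nonneg_eq_0_iff_AE[OF True] by simp
        then have "AE y in ?B. y = 0" by (rule AE_mp) (intro AE_I2, simp)
        moreover have "AE y in ?B. y \<noteq> 0"
          using AE_lborel_singleton[of 0] by (subst AE_restrict_space_iff) auto
        ultimately have "AE y in ?B. False" by eventually_elim blast
        then have "emeasure ?B (space ?B) = 0" by (simp add: eventually_False ae_filter_eq_bot_iff)
        then show False using B.pos by (simp add: measure_def)
      qed
      moreover have "0 \<le> integral\<^sup>L ?B ?\<kappa>" by (intro Bochner_Integration.integral_nonneg) auto
      ultimately have "0 < integral\<^sup>L ?B ?\<kappa>" by linarith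
      moreover have "0 < measure lborel (cball 0 1 :: (real^'n) set)"
        by (rule measure_unit_ball_pos)
      ultimately show ?thesis unfolding a_def by (rule divide_pos_pos)
    qed
    have eq: "\<exists>L. ?\<Theta> x = ereal L \<and> ?\<Theta>' x = ereal (L * a)" if "x \<in> X" for x
      using sphere_density_vol_density[OF conv u X that] True unfolding a_def by metis
    obtain L0 where L0: "?\<Theta> x0 = ereal L0" "?\<Theta>' x0 = ereal (L0 * a)" using eq[OF x0] by blast
    obtain c' where c': "L0 < c'" "ereal c' < c" using c L0 ereal_dense2[of "ereal L0" c] by auto
    have "?\<Theta>' x0 < ereal (c' * a)" using L0 c' a by simp
    then have "\<forall>\<^sub>F x in at x0 within X. ?\<Theta>' x < ereal (c' * a)"
      using vol_density_usc[OF conv u X] x0 unfolding usc_on_def by blast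
    with near show ?thesis
    proof eventually_elim
      case (elim x)
      obtain L where L: "?\<Theta> x = ereal L" "?\<Theta>' x = ereal (L * a)" using eq[OF elim(1)] by blast
      then have "L < c'" using elim(2) a by simp
      then have "?\<Theta> x < ereal c'" using L by simp
      with c'(2) show ?case by order
    qed
  qed
qed

end

theorem theorem1p8:
  fixes F :: "(real^'n^'n) set" and X :: "(real^'n) set" and u :: "real^'n \<Rightarrow> ereal"
    and e :: "real^'n" and p :: real
  assumes "CARD('n) \<ge> 2"
    and "subequation F" and "cone F" and "ST_invariant F"
    and "norm e = 1" and "riesz_characteristic F e = ereal p"
    and "open X" and "F_subharmonic F X u"
  shows "\<forall>\<Psi>. \<Psi> = max_avg \<or> convex F \<and> (\<Psi> = sphere_avg \<or> \<Psi> = vol_avg) \<longrightarrow>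
           usc_on X (avg_density (riesz_kernel p) \<Psi> u) \<and>
           (\<forall>c::real. c \<ge> 0 \<longrightarrow>
              closedin (top_of_set X) {x \<in> X. ereal c \<le> avg_density (riesz_kernel p) \<Psi> u x})"
proof -
  interpret riesz_cone F e p
    using assms(2-6) by unfold_locales
  have "usc_on X (avg_density (riesz_kernel p) \<Psi> u)"
    if "\<Psi> = max_avg \<or> convex F \<and> (\<Psi> = sphere_avg \<or> \<Psi> = vol_avg)" for \<Psi>
    using that max_density_usc[OF assms(8,7)] vol_density_usc[OF _ assms(8,7)]
      sphere_density_usc[OF _ assms(8,7)] by blast
  then show ?thesis using closedin_superlevel_set[OF _ assms(7)] by blast
qed

end
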